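(* Let $\epsilon>0$ and $T>0$. Let $u$ satisfy the backward wave equation $$u''(t)=-\epsilon^2\Delta u(t)\quad\text{on }[0,T]$$ with regularity $u\in C([0,T];H^2(\mathbb R))\cap C^1([0,T];H^1(\mathbb R))$. Put $u_0=u(0)$, $v_0=u'(0)$, and assume the compatibility constraint $v_0=-\epsilon(-\Delta)^{1/2}u_0$. Then $u$ satisfies the half-diffusion equation $$\partial_t u=-\epsilon(-\Delta)^{1/2}u$$ on $[0,T]$ in $L^2(\mathbb R)$. Furthermore, define $\Phi(t):\mathbb M_s\to\mathbb M_s$ for $t\ge 0$ by $$\Phi(t)(u_0,v_0):=\bigl(e^{-t\epsilon(-\Delta)^{1/2}}u_0,\ -\epsilon(-\Delta)^{1/2}e^{-t\epsilon(-\Delta)^{1/2}}u_0\bigr),\qquad (u_0,v_0)\in\mathbb M_s.$$ Then $\{\Phi(t)\}_{t\ge0}$ is a $C_0$-semigroup on the closed subspace $\mathbb M_s\subset H^1(\mathbb R)\times L^2(\mathbb R)$.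
   Context: The half-Laplacian $(-\Delta)^{1/2}$ on $L^2(\mathbb R)$ has domain $H^1(\mathbb R)$; it is given by $(-\Delta)^{1/2}u(x)=\frac1\pi\,\mathrm{P.V.}\int_{\mathbb R}\frac{u(x)-u(y)}{(x-y)^2}\,dy$, equivalently it is the Fourier multiplier with symbol $|\xi|$. Here $\Delta=\partial_x^2$ and $'$ denotes $d/dt$. $e^{-t\epsilon(-\Delta)^{1/2}}$ denotes the contraction $C_0$-semigroup on $L^2(\mathbb R)$ generated by the self-adjoint dissipative operator $-\epsilon(-\Delta)^{1/2}$ (Fourier multiplier $e^{-\epsilon|\xi|t}$). The stable subspace is $$\mathbb M_s:=\{(u,v)\in H^1(\mathbb R)\times L^2(\mathbb R):\ v=-\epsilon(-\Delta)^{1/2}u\},$$ equipped with the norm of $H^1(\mathbb R)\times L^2(\mathbb R)$. *)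

theory Defs
  imports "HOL-Analysis.Analysis"
begin

section \<open>The Hilbert space of square-integrable complex functions on the line\<close>

definition square_integrable :: "(real \<Rightarrow> complex) \<Rightarrow> bool" where
  "square_integrable f \<longleftrightarrow>
     f \<in> borel_measurable lborel \<and> integrable lborel (\<lambda>x. (cmod (f x))\<^sup>2)"

definition ae_eq :: "(real \<Rightarrow> complex) \<Rightarrow> (real \<Rightarrow> complex) \<Rightarrow> bool" where
  "ae_eq f g \<longleftrightarrow> square_integrable f \<and> square_integrable g \<and> (AE x in lborel. f x = g x)"

lemma square_integrable_zero: "square_integrable (\<lambda>x. 0)"
  by (simp add: square_integrable_def)

quotient_type l2 = "real \<Rightarrow> complex" / partial: ae_eq
proof (rule part_equivpI)
  show "\<exists>f. ae_eq f f"
    using square_integrable_zero by (auto simp: ae_eq_def)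
  show "symp ae_eq"
    by (auto simp: symp_def ae_eq_def)
  show "transp ae_eq"
  proof (rule transpI)
    fix f g h assume "ae_eq f g" "ae_eq g h"
    then have sq: "square_integrable f" "square_integrable h"
      and ae: "AE x in lborel. f x = g x" "AE x in lborel. g x = h x"
      by (auto simp: ae_eq_def)
    from ae have "AE x in lborel. f x = h x"
      by eventually_elim simp
    then show "ae_eq f h"
      using sq by (simp add: ae_eq_def)
  qed
qed

lemma square_integrable_scale:
  "square_integrable f \<Longrightarrow> square_integrable (\<lambda>x. c * f x)"
  by (auto simp: square_integrable_def norm_mult power_mult_distrib)

lemma square_integrable_add:
  assumes "square_integrable f" "square_integrable g"
  shows "square_integrable (\<lambda>x. f x + g x)"
proof -
  have [measurable]: "f \<in> borel_measurable lborel" "g \<in> borel_measurable lborel"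
    using assms by (auto simp: square_integrable_def)
  have bound: "(cmod (z + w))\<^sup>2 \<le> 2 * (cmod z)\<^sup>2 + 2 * (cmod w)\<^sup>2" for z w :: complex
  proof -
    have "(cmod (z + w))\<^sup>2 \<le> (cmod z + cmod w)\<^sup>2"
      by (intro power_mono norm_triangle_ineq) auto
    also have "\<dots> \<le> 2 * (cmod z)\<^sup>2 + 2 * (cmod w)\<^sup>2"
      using zero_le_power2[of "cmod z - cmod w"] by (simp add: power2_eq_square algebra_simps)
    finally show ?thesis .
  qed
  have "integrable lborel (\<lambda>x. 2 * (cmod (f x))\<^sup>2 + 2 * (cmod (g x))\<^sup>2)"
    using assms by (auto simp: square_integrable_def)
  then have "integrable lborel (\<lambda>x. (cmod (f x + g x))\<^sup>2)"
    by (rule Bochner_Integration.integrable_bound) (use bound in auto)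
  then show ?thesis
    by (simp add: square_integrable_def)
qed

lemma square_integrable_minus:
  "square_integrable f \<Longrightarrow> square_integrable (\<lambda>x. - f x)"
  by (auto simp: square_integrable_def)

lemma square_integrable_inner:
  assumes "square_integrable f" "square_integrable g"
  shows "integrable lborel (\<lambda>x. f x \<bullet> g x)"
proof -
  have [measurable]: "f \<in> borel_measurable lborel" "g \<in> borel_measurable lborel"
    using assms by (auto simp: square_integrable_def)
  have bound: "\<bar>z \<bullet> w\<bar> \<le> (cmod z)\<^sup>2 + (cmod w)\<^sup>2" for z w :: complex
  proof -
    have "\<bar>z \<bullet> w\<bar> \<le> cmod z * cmod w"
      by (rule Cauchy_Schwarz_ineq2)
    also have "\<dots> \<le> (cmod z)\<^sup>2 + (cmod w)\<^sup>2"
      using sum_squares_bound[of "cmod z" "cmod w"] mult_nonneg_nonneg[OF norm_ge_zero[of z] norm_ge_zero[of w]]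
      by linarith
    finally show ?thesis .
  qed
  have "integrable lborel (\<lambda>x. (cmod (f x))\<^sup>2 + (cmod (g x))\<^sup>2)"
    using assms by (auto simp: square_integrable_def)
  then show ?thesis
    by (rule Bochner_Integration.integrable_bound) (use bound in auto)
qed

instantiation l2 :: real_inner
begin

lift_definition zero_l2 :: l2 is "\<lambda>x. 0"
  by (simp add: ae_eq_def square_integrable_zero)

lift_definition plus_l2 :: "l2 \<Rightarrow> l2 \<Rightarrow> l2" is "\<lambda>f g x. f x + g x"
  by (auto simp: ae_eq_def square_integrable_add)

lift_definition uminus_l2 :: "l2 \<Rightarrow> l2" is "\<lambda>f x. - f x"
  by (auto simp: ae_eq_def square_integrable_minus)

definition minus_l2 :: "l2 \<Rightarrow> l2 \<Rightarrow> l2" where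
  "minus_l2 f g = f + (- g)"

lift_definition scaleR_l2 :: "real \<Rightarrow> l2 \<Rightarrow> l2" is "\<lambda>r f x. of_real r * f x"
  by (auto simp: ae_eq_def square_integrable_scale)

lift_definition inner_l2 :: "l2 \<Rightarrow> l2 \<Rightarrow> real" is "\<lambda>f g. \<integral>x. f x \<bullet> g x \<partial>lborel"
  by (auto simp: ae_eq_def square_integrable_def intro!: integral_cong_AE)

definition norm_l2 :: "l2 \<Rightarrow> real" where
  "norm_l2 f = sqrt (f \<bullet> f)"

definition sgn_l2 :: "l2 \<Rightarrow> l2" where
  "sgn_l2 f = scaleR (inverse (norm f)) f"

definition dist_l2 :: "l2 \<Rightarrow> l2 \<Rightarrow> real" where
  "dist_l2 f g = norm (f - g)"

definition uniformity_l2 :: "(l2 \<times> l2) filter" where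
  "uniformity_l2 = (INF e\<in>{0<..}. principal {(x, y). dist x y < e})"

definition open_l2 :: "l2 set \<Rightarrow> bool" where
  "open_l2 S = (\<forall>x\<in>S. \<forall>\<^sub>F (x', y) in uniformity. x' = x \<longrightarrow> y \<in> S)"

instance
proof
  fix f g h :: l2 and r s :: real
  show "f + g + h = f + (g + h)"
    by transfer (auto simp: ae_eq_def square_integrable_add add.assoc)
  show "f + g = g + f"
    by transfer (auto simp: ae_eq_def square_integrable_add add.commute)
  show "0 + f = f"
    by transfer (auto simp: ae_eq_def)
  show "- f + f = 0"
    by transfer (auto simp: ae_eq_def square_integrable_zero)
  show "f - g = f + - g"
    by (simp add: minus_l2_def)
  show "r *\<^sub>R (f + g) = r *\<^sub>R f + r *\<^sub>R g"
    by transfer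
      (simp add: ae_eq_def square_integrable_add square_integrable_scale
        distrib_left distrib_right)
  show "(r + s) *\<^sub>R f = r *\<^sub>R f + s *\<^sub>R f"
    by transfer
      (simp add: ae_eq_def square_integrable_add square_integrable_scale distrib_right)
  show "r *\<^sub>R s *\<^sub>R f = (r * s) *\<^sub>R f"
    by transfer (simp add: ae_eq_def square_integrable_scale mult.assoc)
  show "1 *\<^sub>R f = f"
    by transfer (auto simp: ae_eq_def)
  show "sgn f = scaleR (inverse (norm f)) f" "dist f g = norm (f - g)"
    by (simp_all add: sgn_l2_def dist_l2_def)
  show "(uniformity :: (l2 \<times> l2) filter) = (INF e\<in>{0<..}. principal {(x, y). dist x y < e})"
    by (simp add: uniformity_l2_def)
  show "open S = (\<forall>x\<in>S. \<forall>\<^sub>F (x', y) in uniformity. x' = x \<longrightarrow> y \<in> S)" for S :: "l2 set"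
    by (simp add: open_l2_def)
  show "f \<bullet> g = g \<bullet> f"
    by transfer (simp add: inner_commute)
  show "(f + g) \<bullet> h = f \<bullet> h + g \<bullet> h"
    by transfer (auto simp: ae_eq_def inner_add_left square_integrable_inner)
  show "(r *\<^sub>R f) \<bullet> g = r * (f \<bullet> g)"
    by transfer (simp flip: scaleR_conv_of_real)
  show "0 \<le> f \<bullet> f"
    by transfer simp
  show "f \<bullet> f = 0 \<longleftrightarrow> f = 0"
  proof transfer
    fix f assume "ae_eq f f"
    then have f: "square_integrable f"
      by (simp add: ae_eq_def)
    have "(\<integral>x. f x \<bullet> f x \<partial>lborel) = 0 \<longleftrightarrow> (AE x in lborel. f x \<bullet> f x = 0)"
      by (intro integral_nonneg_eq_0_iff_AE square_integrable_inner f) auto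
    then show "(\<integral>x. f x \<bullet> f x \<partial>lborel) = 0 \<longleftrightarrow> ae_eq f (\<lambda>x. 0)"
      using f by (simp add: ae_eq_def square_integrable_zero)
  qed
  show "norm f = sqrt (f \<bullet> f)"
    by (simp add: norm_l2_def)
qed

end

lift_definition cscale :: "complex \<Rightarrow> l2 \<Rightarrow> l2" is "\<lambda>c f x. c * f x"
  by (auto simp: ae_eq_def square_integrable_scale)

text \<open>Complex scalar multiplication on the product space.\<close>
definition cscale2 :: "complex \<Rightarrow> l2 \<times> l2 \<Rightarrow> l2 \<times> l2" where
  "cscale2 c p = (cscale c (fst p), cscale c (snd p))"

lemma vector_space_cscale: "vector_space cscale"
proof
  fix a b :: complex and x y :: l2
  show "cscale a (x + y) = cscale a x + cscale a y"
    by transfer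
      (simp add: ae_eq_def square_integrable_add square_integrable_scale
        distrib_left distrib_right)
  show "cscale (a + b) x = cscale a x + cscale b x"
    by transfer
      (simp add: ae_eq_def square_integrable_add square_integrable_scale
        distrib_left distrib_right)
  show "cscale a (cscale b x) = cscale (a * b) x"
    by transfer (auto simp: ae_eq_def square_integrable_scale mult.assoc)
  show "cscale 1 x = x"
    by transfer (auto simp: ae_eq_def)
qed

lemma vector_space_cscale2: "vector_space cscale2"
proof -
  interpret vector_space cscale by (rule vector_space_cscale)
  show ?thesis
    by standard
      (auto simp: cscale2_def scale_left_distrib scale_right_distrib scale_scale)
qed

section \<open>Weak derivatives and Sobolev spaces\<close>

text \<open>Weak differentiation is tested against complex-valued $C^1$ functions of compact support;
  as usual, this gives the same notion as testing against smooth functions of compact support.\<close>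
definition test_function :: "(real \<Rightarrow> complex) \<Rightarrow> bool" where
  "test_function \<phi> \<longleftrightarrow> \<phi> C1_differentiable_on UNIV \<and> compact (closure {x. \<phi> x \<noteq> 0})"

lift_definition has_weak_deriv :: "l2 \<Rightarrow> l2 \<Rightarrow> bool" is
  "\<lambda>f g. \<forall>\<phi>. test_function \<phi> \<longrightarrow>
     (\<integral>x. f x * vector_derivative \<phi> (at x) \<partial>lborel) = - (\<integral>x. g x * \<phi> x \<partial>lborel)"
proof -
  fix f1 f2 g1 g2 :: "real \<Rightarrow> complex"
  assume "ae_eq f1 f2" "ae_eq g1 g2"
  then have [measurable]: "f1 \<in> borel_measurable lborel" "f2 \<in> borel_measurable lborel"
      "g1 \<in> borel_measurable lborel" "g2 \<in> borel_measurable lborel"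
    and ae: "AE x in lborel. f1 x = f2 x" "AE x in lborel. g1 x = g2 x"
    by (auto simp: ae_eq_def square_integrable_def)
  have "(\<integral>x. f1 x * vector_derivative \<phi> (at x) \<partial>lborel) =
          (\<integral>x. f2 x * vector_derivative \<phi> (at x) \<partial>lborel) \<and>
        (\<integral>x. g1 x * \<phi> x \<partial>lborel) = (\<integral>x. g2 x * \<phi> x \<partial>lborel)"
    if "test_function \<phi>" for \<phi>
  proof -
    have "continuous_on UNIV \<phi>" "continuous_on UNIV (\<lambda>x. vector_derivative \<phi> (at x))"
      using that C1_differentiable_imp_continuous_on
      by (auto simp: test_function_def C1_differentiable_on_eq)
    then have [measurable]: "\<phi> \<in> borel_measurable borel"
        "(\<lambda>x. vector_derivative \<phi> (at x)) \<in> borel_measurable borel"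
      by (auto intro: borel_measurable_continuous_onI)
    show ?thesis
      using ae by (auto intro!: integral_cong_AE)
  qed
  then show "(\<forall>\<phi>. test_function \<phi> \<longrightarrow>
        (\<integral>x. f1 x * vector_derivative \<phi> (at x) \<partial>lborel) = - (\<integral>x. g1 x * \<phi> x \<partial>lborel)) =
      (\<forall>\<phi>. test_function \<phi> \<longrightarrow>
        (\<integral>x. f2 x * vector_derivative \<phi> (at x) \<partial>lborel) = - (\<integral>x. g2 x * \<phi> x \<partial>lborel))"
    by simp
qed

definition weak_deriv :: "l2 \<Rightarrow> l2" where
  "weak_deriv u = (THE g. has_weak_deriv u g)"

definition laplacian :: "l2 \<Rightarrow> l2" where
  "laplacian u = weak_deriv (weak_deriv u)"

definition H1 :: "l2 set" where
  "H1 = {u. \<exists>g. has_weak_deriv u g}"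

definition H2 :: "l2 set" where
  "H2 = {u \<in> H1. weak_deriv u \<in> H1}"

definition norm_H1 :: "l2 \<Rightarrow> real" where
  "norm_H1 u = sqrt ((norm u)\<^sup>2 + (norm (weak_deriv u))\<^sup>2)"

definition norm_H2 :: "l2 \<Rightarrow> real" where
  "norm_H2 u = sqrt ((norm u)\<^sup>2 + (norm (weak_deriv u))\<^sup>2 + (norm (weak_deriv (weak_deriv u)))\<^sup>2)"

definition norm_H1L2 :: "l2 \<times> l2 \<Rightarrow> real" where
  "norm_H1L2 p = sqrt ((norm_H1 (fst p))\<^sup>2 + (norm (snd p))\<^sup>2)"

section \<open>Fourier multipliers\<close>

text \<open>The unitary Fourier--Plancherel transform is the $L^2$ limit, as $R \to \infty$, of the
  transforms $(2\pi)^{-1/2} \int_{-R}^{R} f(x) e^{-i x \xi}\,dx$ of the truncations of $f$. The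
  limit is expressed with the extended nonnegative integral, which takes the value $\infty$ on
  functions that are not square integrable.\<close>
definition truncated_fourier :: "(real \<Rightarrow> complex) \<Rightarrow> real \<Rightarrow> real \<Rightarrow> complex" where
  "truncated_fourier f R \<xi> =
     (\<integral>x. indicator {-R..R} x *\<^sub>R (f x * cis (- (x * \<xi>))) \<partial>lborel) / of_real (sqrt (2 * pi))"

lift_definition has_fourier :: "l2 \<Rightarrow> l2 \<Rightarrow> bool" is
  "\<lambda>f g. ((\<lambda>R. \<integral>\<^sup>+\<xi>. ennreal ((cmod (truncated_fourier f R \<xi> - g \<xi>))\<^sup>2) \<partial>lborel) \<longlongrightarrow> 0) at_top"
proof -
  fix f1 f2 g1 g2 :: "real \<Rightarrow> complex"
  assume "ae_eq f1 f2" "ae_eq g1 g2"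
  then have [measurable]: "f1 \<in> borel_measurable lborel" "f2 \<in> borel_measurable lborel"
      "g1 \<in> borel_measurable lborel" "g2 \<in> borel_measurable lborel"
    and ae: "AE x in lborel. f1 x = f2 x" "AE x in lborel. g1 x = g2 x"
    by (auto simp: ae_eq_def square_integrable_def)
  have [measurable]: "(\<lambda>x. cis (- (x * \<xi>))) \<in> borel_measurable borel" for \<xi>
    by (intro borel_measurable_continuous_onI continuous_intros)
  have *: "truncated_fourier f1 = truncated_fourier f2"
  proof (intro ext)
    fix R \<xi>
    have "(\<integral>x. indicator {-R..R} x *\<^sub>R (f1 x * cis (- (x * \<xi>))) \<partial>lborel) =
          (\<integral>x. indicator {-R..R} x *\<^sub>R (f2 x * cis (- (x * \<xi>))) \<partial>lborel)"
      using ae(1) by (intro integral_cong_AE) auto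
    then show "truncated_fourier f1 R \<xi> = truncated_fourier f2 R \<xi>"
      by (simp add: truncated_fourier_def)
  qed
  have "(\<integral>\<^sup>+\<xi>. ennreal ((cmod (truncated_fourier f2 R \<xi> - g1 \<xi>))\<^sup>2) \<partial>lborel) =
        (\<integral>\<^sup>+\<xi>. ennreal ((cmod (truncated_fourier f2 R \<xi> - g2 \<xi>))\<^sup>2) \<partial>lborel)" for R
    using ae(2) by (intro nn_integral_cong_AE) auto
  then show "((\<lambda>R. \<integral>\<^sup>+\<xi>. ennreal ((cmod (truncated_fourier f1 R \<xi> - g1 \<xi>))\<^sup>2) \<partial>lborel)
          \<longlongrightarrow> 0) at_top =
      ((\<lambda>R. \<integral>\<^sup>+\<xi>. ennreal ((cmod (truncated_fourier f2 R \<xi> - g2 \<xi>))\<^sup>2) \<partial>lborel)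
          \<longlongrightarrow> 0) at_top"
    by (simp add: *)
qed

definition fourier :: "l2 \<Rightarrow> l2" where
  "fourier u = (THE g. has_fourier u g)"

lift_definition is_product :: "(real \<Rightarrow> complex) \<Rightarrow> l2 \<Rightarrow> l2 \<Rightarrow> bool" is
  "\<lambda>m f g. AE \<xi> in lborel. g \<xi> = m \<xi> * f \<xi>"
proof -
  fix m and f1 f2 g1 g2 :: "real \<Rightarrow> complex"
  assume "ae_eq f1 f2" "ae_eq g1 g2"
  then have "AE x in lborel. f1 x = f2 x \<and> g1 x = g2 x"
    by (auto simp: ae_eq_def)
  then have "AE \<xi> in lborel. (g1 \<xi> = m \<xi> * f1 \<xi>) = (g2 \<xi> = m \<xi> * f2 \<xi>)"
    by eventually_elim auto
  then show "(AE \<xi> in lborel. g1 \<xi> = m \<xi> * f1 \<xi>) = (AE \<xi> in lborel. g2 \<xi> = m \<xi> * f2 \<xi>)"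
    by (rule eventually_subst)
qed

text \<open>The value is meaningful for those \<open>u\<close> in $L^2$ with $m \hat u$ in $L^2$.\<close>
definition fourier_multiplier :: "(real \<Rightarrow> complex) \<Rightarrow> l2 \<Rightarrow> l2" where
  "fourier_multiplier m u = (THE w. is_product m (fourier u) (fourier w))"

text \<open>The operator $(-\Delta)^{1/2}$, with domain \<open>H1\<close>.\<close>
definition half_laplacian :: "l2 \<Rightarrow> l2" where
  "half_laplacian = fourier_multiplier (\<lambda>\<xi>. of_real \<bar>\<xi>\<bar>)"

text \<open>The semigroup $e^{-t \epsilon (-\Delta)^{1/2}}$.\<close>
definition half_diffusion :: "real \<Rightarrow> real \<Rightarrow> l2 \<Rightarrow> l2" where
  "half_diffusion \<epsilon> t = fourier_multiplier (\<lambda>\<xi>. of_real (exp (- (\<epsilon> * \<bar>\<xi>\<bar> * t))))"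

section \<open>Curves and semigroups in normed subspaces\<close>

text \<open>Below, \<open>X\<close> is a linear subspace and \<open>N\<close> is its norm, which may be finer than the
  norm of the ambient type.\<close>
definition continuous_curve ::
  "'a::real_vector set \<Rightarrow> ('a \<Rightarrow> real) \<Rightarrow> real set \<Rightarrow> (real \<Rightarrow> 'a) \<Rightarrow> bool" where
  "continuous_curve X N I u \<longleftrightarrow>
     (\<forall>t\<in>I. u t \<in> X \<and> ((\<lambda>s. N (u s - u t)) \<longlongrightarrow> 0) (at t within I))"

text \<open>\<open>u\<close> is of class $C^1$ from \<open>I\<close> to \<open>(X, N)\<close>, with derivative \<open>v\<close>.\<close>
definition C1_curve ::
  "'a::real_vector set \<Rightarrow> ('a \<Rightarrow> real) \<Rightarrow> real set \<Rightarrow> (real \<Rightarrow> 'a) \<Rightarrow> (real \<Rightarrow> 'a) \<Rightarrow> bool" where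
  "C1_curve X N I u v \<longleftrightarrow>
     (\<forall>t\<in>I. u t \<in> X \<and>
        ((\<lambda>s. N ((u s - u t) /\<^sub>R (s - t) - v t)) \<longlongrightarrow> 0) (at t within I)) \<and>
     continuous_curve X N I v"

text \<open>Strongly continuous semigroup of bounded operators, linear over the complex numbers with
  respect to the scalar multiplication \<open>scl\<close>. Only the values of \<open>S t\<close> on \<open>X\<close> for
  nonnegative \<open>t\<close> matter.\<close>
definition C0_semigroup_on ::
  "(complex \<Rightarrow> 'a \<Rightarrow> 'a) \<Rightarrow> 'a::real_vector set \<Rightarrow> ('a \<Rightarrow> real) \<Rightarrow> (real \<Rightarrow> 'a \<Rightarrow> 'a) \<Rightarrow> bool" where
  "C0_semigroup_on scl X N S \<longleftrightarrow>
     (\<forall>t\<ge>0. \<forall>x\<in>X. S t x \<in> X) \<and>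
     (\<forall>t\<ge>0. \<forall>x\<in>X. \<forall>y\<in>X. S t (x + y) = S t x + S t y) \<and>
     (\<forall>t\<ge>0. \<forall>c. \<forall>x\<in>X. S t (scl c x) = scl c (S t x)) \<and>
     (\<forall>t\<ge>0. \<exists>C. \<forall>x\<in>X. N (S t x) \<le> C * N x) \<and>
     (\<forall>x\<in>X. S 0 x = x) \<and>
     (\<forall>s\<ge>0. \<forall>t\<ge>0. \<forall>x\<in>X. S (s + t) x = S s (S t x)) \<and>
     (\<forall>x\<in>X. ((\<lambda>t. N (S t x - x)) \<longlongrightarrow> 0) (at_right 0))"

section \<open>The stable subspace\<close>

definition stable_subspace :: "real \<Rightarrow> (l2 \<times> l2) set" where
  "stable_subspace \<epsilon> = {(u, v). u \<in> H1 \<and> v = - (\<epsilon> *\<^sub>R half_laplacian u)}"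

definition stable_flow :: "real \<Rightarrow> real \<Rightarrow> l2 \<times> l2 \<Rightarrow> l2 \<times> l2" where
  "stable_flow \<epsilon> t p =
     (half_diffusion \<epsilon> t (fst p), - (\<epsilon> *\<^sub>R half_laplacian (half_diffusion \<epsilon> t (fst p))))"

definition H1L2_topology :: "(l2 \<times> l2) topology" where
  "H1L2_topology = Metric_space.mtopology (H1 \<times> UNIV) (\<lambda>p q. norm_H1L2 (p - q))"

end

theory Submission
  imports Defs "HOL-Probability.Levy"
begin

text \<open>
  On the Fourier side everything is multiplication by functions of \<open>\<xi>\<close>, and the theorem
  reduces to pointwise identities and bounds between symbols.

  For the first part, the wave equation \<open>u'' = - \<epsilon>\<^sup>2 \<Delta> u\<close> factors as
  \<open>(d/dt - \<epsilon> A) (d/dt + \<epsilon> A) u = 0\<close> with \<open>A = (-\<Delta>)^(1/2)\<close>, since \<open>A\<^sup>2 = - \<Delta>\<close>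
  (\<open>half_laplacian_squared\<close>). The constraint says that the defect \<open>w = u' + \<epsilon> A u\<close> vanishes
  at time 0, and \<open>w' = \<epsilon> A w\<close>. Although this equation amplifies high frequencies without
  bound, each frequency cutoff of \<open>w\<close> solves a linear equation with a bounded generator, so
  Gronwall's inequality forces \<open>w = 0\<close> (\<open>backward_heat_uniqueness\<close>), which is the
  half-diffusion equation.

  For the second part, \<open>A\<close> is bounded from \<open>H1\<close> to \<open>l2\<close> because \<open>|\<xi>|\<close> and
  \<open>i \<xi>\<close> have the same modulus; its graph is therefore closed. The symbols
  \<open>exp (- \<epsilon> |\<xi>| t)\<close> are bounded by 1, multiplicative in \<open>t\<close> and tend to 1 as \<open>t\<close>
  tends to 0, and they commute with the symbols of \<open>A\<close> and of the derivative. This makes the flow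
  a contraction semigroup that acts componentwise on \<open>(u, D u, v)\<close>, and dominated convergence gives
  strong continuity.

  The reduction needs two facts about the transform. The first is Plancherel's theorem, including
  surjectivity, because \<open>fourier_multiplier\<close> inverts the transform. Parseval's identity for a
  pair of intervals is Levy's inversion theorem for a uniform distribution
  (\<open>interval_transform_gram\<close>). It extends to step functions by linearity, to all windowed
  functions by density and Fatou's lemma, and to the limit of growing windows by completeness of
  \<open>l2\<close> (\<open>has_fourier_fourier\<close>, \<open>norm_fourier\<close>). Surjectivity follows from the symmetry of
  the kernel: the adjoint is the transform conjugated by complex conjugation, hence also isometric
  (\<open>fourier_inverse_fourier\<close>). The second is that weak differentiation is exactly the
  multiplier \<open>i \<xi>\<close>, domain included (\<open>has_weak_deriv_iff\<close>).
\<close>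

section \<open>Calculus and completeness of the space of square-integrable functions\<close>

lemma ae_eq_self_iff: "ae_eq f f \<longleftrightarrow> square_integrable f"
  by (simp add: ae_eq_def)

lemma abs_l2_cases:
  obtains f where "square_integrable f" "u = abs_l2 f"
  by (induction u rule: l2.abs_induct) (auto simp: ae_eq_self_iff)

lemma square_integrable_measurable:
  "square_integrable f \<Longrightarrow> f \<in> borel_measurable borel"
  by (simp add: square_integrable_def)

lemma square_integrable_integrable:
  "square_integrable f \<Longrightarrow> integrable lborel (\<lambda>x. (cmod (f x))\<^sup>2)"
  by (simp add: square_integrable_def)

lemma square_integrable_diff:
  "square_integrable f \<Longrightarrow> square_integrable g \<Longrightarrow> square_integrable (\<lambda>x. f x - g x)"
  using square_integrable_add[of f "\<lambda>x. - g x"] by (simp add: square_integrable_minus)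

lemma square_integrable_sum:
  "(\<And>i. i \<in> I \<Longrightarrow> square_integrable (f i)) \<Longrightarrow> square_integrable (\<lambda>x. \<Sum>i\<in>I. f i x)"
  by (induction I rule: infinite_finite_induct)
    (auto intro: square_integrable_add square_integrable_zero)

lemma square_integrable_dominated:
  assumes "f \<in> borel_measurable borel" "square_integrable w"
    and "AE x in lborel. cmod (f x) \<le> cmod (w x)"
  shows "square_integrable f"
  unfolding square_integrable_def
proof
  show "integrable lborel (\<lambda>x. (cmod (f x))\<^sup>2)"
  proof (rule Bochner_Integration.integrable_bound[OF square_integrable_integrable[OF assms(2)]])
    show "AE x in lborel. norm ((cmod (f x))\<^sup>2) \<le> norm ((cmod (w x))\<^sup>2)"
      using assms(3) by eventually_elim (auto intro: power_mono)
  qed (use assms(1) in measurable)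
qed (use assms in simp)

lemma abs_l2_add:
  "square_integrable f \<Longrightarrow> square_integrable g \<Longrightarrow> abs_l2 f + abs_l2 g = abs_l2 (\<lambda>x. f x + g x)"
  by (simp add: plus_l2.abs_eq ae_eq_self_iff)

lemma abs_l2_uminus: "square_integrable f \<Longrightarrow> - abs_l2 f = abs_l2 (\<lambda>x. - f x)"
  by (simp add: uminus_l2.abs_eq ae_eq_self_iff)

lemma abs_l2_diff:
  "square_integrable f \<Longrightarrow> square_integrable g \<Longrightarrow> abs_l2 f - abs_l2 g = abs_l2 (\<lambda>x. f x - g x)"
  by (simp add: minus_l2_def abs_l2_uminus abs_l2_add square_integrable_minus)

lemma abs_l2_zero: "abs_l2 (\<lambda>x. 0) = 0"
  by (simp add: zero_l2_def)

lemma abs_l2_scaleR: "square_integrable f \<Longrightarrow> r *\<^sub>R abs_l2 f = abs_l2 (\<lambda>x. of_real r * f x)"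
  by (simp add: scaleR_l2.abs_eq ae_eq_self_iff)

lemma abs_l2_cscale: "square_integrable f \<Longrightarrow> cscale c (abs_l2 f) = abs_l2 (\<lambda>x. c * f x)"
  by (simp add: cscale.abs_eq ae_eq_self_iff)

lemma abs_l2_inner:
  "square_integrable f \<Longrightarrow> square_integrable g \<Longrightarrow>
    abs_l2 f \<bullet> abs_l2 g = (\<integral>x. f x \<bullet> g x \<partial>lborel)"
  by (simp add: inner_l2.abs_eq ae_eq_self_iff)

lemma abs_l2_norm:
  "square_integrable f \<Longrightarrow> (norm (abs_l2 f))\<^sup>2 = (\<integral>x. (cmod (f x))\<^sup>2 \<partial>lborel)"
  by (simp add: power2_norm_eq_inner abs_l2_inner)

lemma abs_l2_nn_integral:
  "square_integrable f \<Longrightarrow>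
    (\<integral>\<^sup>+x. ennreal ((cmod (f x))\<^sup>2) \<partial>lborel) = ennreal ((norm (abs_l2 f))\<^sup>2)"
  by (simp add: abs_l2_norm nn_integral_eq_integral square_integrable_integrable)

lemma abs_l2_sum:
  "(\<And>i. i \<in> I \<Longrightarrow> square_integrable (f i)) \<Longrightarrow>
    (\<Sum>i\<in>I. abs_l2 (f i)) = abs_l2 (\<lambda>x. \<Sum>i\<in>I. f i x)"
  by (induction I rule: infinite_finite_induct)
    (auto simp: abs_l2_zero abs_l2_add square_integrable_sum)

lemma abs_l2_norm_le:
  assumes "square_integrable f" "square_integrable g" "AE x in lborel. cmod (f x) \<le> C * cmod (g x)"
    and "C \<ge> 0"
  shows "norm (abs_l2 f) \<le> C * norm (abs_l2 g)"
proof -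
  have "(norm (abs_l2 f))\<^sup>2 \<le> (\<integral>x. C\<^sup>2 * (cmod (g x))\<^sup>2 \<partial>lborel)"
    unfolding abs_l2_norm[OF assms(1)]
  proof (rule integral_mono_AE)
    show "AE x in lborel. (cmod (f x))\<^sup>2 \<le> C\<^sup>2 * (cmod (g x))\<^sup>2"
      using assms(3)
    proof eventually_elim
      case (elim x)
      from power_mono[OF elim, of 2] show ?case
        by (simp add: power_mult_distrib)
    qed
  qed (use assms in \<open>auto simp: square_integrable_integrable\<close>)
  also have "\<dots> = (C * norm (abs_l2 g))\<^sup>2"
    by (simp add: abs_l2_norm assms power_mult_distrib)
  finally show ?thesis
    by (rule power2_le_imp_le) (simp add: assms(4))
qed

text \<open>Fatou's lemma: norms cannot jump up under almost everywhere convergence. No convergence in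
  \<open>l2\<close> is needed, which is what makes this the tool for identifying limits.\<close>
lemma square_integrable_limit_of_bounded:
  assumes s: "\<And>n. square_integrable (s n)" and f: "f \<in> borel_measurable borel"
    and lim: "AE x in lborel. (\<lambda>n. s n x) \<longlonglongrightarrow> f x"
    and bound: "\<And>n. norm (abs_l2 (s n)) \<le> C"
  shows "square_integrable f" "norm (abs_l2 f) \<le> C"
proof -
  have C: "0 \<le> C"
    using bound[of 0] norm_ge_zero order_trans by blast
  have [measurable]: "s n \<in> borel_measurable borel" "f \<in> borel_measurable borel" for n
    using s f by (auto simp: square_integrable_def)
  have "(\<integral>\<^sup>+x. ennreal ((cmod (f x))\<^sup>2) \<partial>lborel)
      = (\<integral>\<^sup>+x. liminf (\<lambda>n. ennreal ((cmod (s n x))\<^sup>2)) \<partial>lborel)"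
  proof (rule nn_integral_cong_AE)
    show "AE x in lborel. ennreal ((cmod (f x))\<^sup>2) = liminf (\<lambda>n. ennreal ((cmod (s n x))\<^sup>2))"
      using lim
    proof eventually_elim
      case (elim x)
      then have "(\<lambda>n. ennreal ((cmod (s n x))\<^sup>2)) \<longlonglongrightarrow> ennreal ((cmod (f x))\<^sup>2)"
        by (intro tendsto_intros)
      then show ?case
        by (metis lim_imp_Liminf trivial_limit_sequentially)
    qed
  qed
  also have "\<dots> \<le> liminf (\<lambda>n. \<integral>\<^sup>+x. ennreal ((cmod (s n x))\<^sup>2) \<partial>lborel)"
    by (intro nn_integral_liminf) measurable
  also have "\<dots> \<le> ennreal (C\<^sup>2)"
    using bound by (intro Liminf_le always_eventually allI)
      (auto simp: abs_l2_nn_integral s intro!: ennreal_leI power_mono)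
  finally have le: "(\<integral>\<^sup>+x. ennreal ((cmod (f x))\<^sup>2) \<partial>lborel) \<le> ennreal (C\<^sup>2)" .
  have "integrable lborel (\<lambda>x. (cmod (f x))\<^sup>2)"
  proof (rule integrableI_nonneg)
    show "(\<integral>\<^sup>+x. ennreal ((cmod (f x))\<^sup>2) \<partial>lborel) < \<infinity>"
      using le_less_trans[OF le ennreal_less_top] by simp
  qed auto
  then show sq: "square_integrable f"
    using f by (simp add: square_integrable_def)
  show "norm (abs_l2 f) \<le> C"
    using le C unfolding abs_l2_nn_integral[OF sq] by (auto intro: power2_le_imp_le)
qed

text \<open>Dominated convergence, with \<open>4 |w|\<^sup>2\<close> majorising \<open>|s n - f|\<^sup>2\<close>.\<close>
lemma abs_l2_dominated_convergence:
  assumes s: "\<And>n. s n \<in> borel_measurable borel" and f: "f \<in> borel_measurable borel"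
    and w: "square_integrable w"
    and lim: "AE x in lborel. (\<lambda>n. s n x) \<longlonglongrightarrow> f x"
    and bound: "\<And>n. AE x in lborel. cmod (s n x) \<le> cmod (w x)"
  shows "square_integrable f" "(\<lambda>n. abs_l2 (s n)) \<longlonglongrightarrow> abs_l2 f"
proof -
  have sq: "square_integrable (s n)" for n
    using square_integrable_dominated[OF s w bound] .
  have all: "AE x in lborel. \<forall>n. cmod (s n x) \<le> cmod (w x)"
    using bound by (simp add: AE_all_countable)
  have fw: "AE x in lborel. cmod (f x) \<le> cmod (w x)"
    using lim all
  proof eventually_elim
    case (elim x)
    then show ?case
      using LIMSEQ_le_const2[OF tendsto_norm[OF elim(1)]] by blast
  qed
  show sqf: "square_integrable f"
    using square_integrable_dominated[OF f w fw] .
  note [measurable] = s f square_integrable_measurable[OF w]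
  have "(\<lambda>n. \<integral>x. (cmod (s n x - f x))\<^sup>2 \<partial>lborel) \<longlonglongrightarrow> (\<integral>x. 0 \<partial>(lborel :: real measure))"
  proof (rule integral_dominated_convergence)
    show "integrable lborel (\<lambda>x. 4 * (cmod (w x))\<^sup>2)"
      by (simp add: square_integrable_integrable w)
    show "AE x in lborel. (\<lambda>n. (cmod (s n x - f x))\<^sup>2) \<longlonglongrightarrow> 0"
      using lim
    proof eventually_elim
      case (elim x)
      have "(\<lambda>n. (cmod (s n x - f x))\<^sup>2) \<longlonglongrightarrow> (cmod (f x - f x))\<^sup>2"
        by (intro tendsto_intros elim)
      then show ?case by simp
    qed
    show "AE x in lborel. norm ((cmod (s n x - f x))\<^sup>2) \<le> 4 * (cmod (w x))\<^sup>2" for n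
      using bound[of n] fw
    proof eventually_elim
      case (elim x)
      have "cmod (s n x - f x) \<le> 2 * cmod (w x)"
        using norm_triangle_ineq4[of "s n x" "f x"] elim by linarith
      then have "(cmod (s n x - f x))\<^sup>2 \<le> (2 * cmod (w x))\<^sup>2"
        by (intro power_mono) auto
      then show ?case
        by (simp add: power_mult_distrib)
    qed
  qed measurable
  then have "(\<lambda>n. (norm (abs_l2 (s n) - abs_l2 f))\<^sup>2) \<longlonglongrightarrow> 0"
    by (simp add: abs_l2_diff abs_l2_norm square_integrable_diff sq sqf)
  then have "(\<lambda>n. norm (abs_l2 (s n) - abs_l2 f)) \<longlonglongrightarrow> 0"
    using tendsto_real_sqrt by fastforce
  then show "(\<lambda>n. abs_l2 (s n)) \<longlonglongrightarrow> abs_l2 f"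
    by (simp add: tendsto_norm_zero_iff LIM_zero_iff)
qed

lemma Cauchy_fast_subseq:
  fixes X :: "nat \<Rightarrow> 'a::metric_space"
  assumes "Cauchy X"
  obtains r :: "nat \<Rightarrow> nat" where "strict_mono r" "\<And>n. dist (X (r (Suc n))) (X (r n)) < (1/2)^n"
proof -
  have "\<exists>M. \<forall>m\<ge>M. \<forall>k\<ge>M. dist (X m) (X k) < (1/2)^n" for n :: nat
    by (rule metric_CauchyD[OF assms]) simp
  then have "\<exists>M. \<forall>n. \<forall>m\<ge>M n. \<forall>k\<ge>M n. dist (X m) (X k) < (1/2)^n"
    by (rule choice[OF allI])
  then obtain M where M: "\<And>n m k. m \<ge> M n \<Longrightarrow> k \<ge> M n \<Longrightarrow> dist (X m) (X k) < (1/2)^n"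
    by blast
  define r where "r n = (\<Sum>k\<le>n. M k) + n" for n
  have "strict_mono r"
    by (auto simp: strict_mono_Suc_iff r_def)
  moreover have "r n \<ge> M n" "r (Suc n) \<ge> M n" for n
    using member_le_sum[of n "{..n}" M] by (auto simp: r_def)
  ultimately show ?thesis
    by (intro that) (auto intro: M)
qed

text \<open>The Riesz--Fischer theorem. Along a subsequence with increments below \<open>2\<^sup>-\<^sup>n\<close>
  the sum of the moduli of the increments has norm at most 2, so it is finite almost everywhere and
  the subsequence converges pointwise. Fatou's lemma turns the pointwise limit into a limit in norm.\<close>
theorem l2_Cauchy_convergent:
  fixes X :: "nat \<Rightarrow> l2"
  assumes "Cauchy X"
  shows "convergent X"
proof -
  obtain r :: "nat \<Rightarrow> nat"
    where r: "strict_mono r" "\<And>n. dist (X (r (Suc n))) (X (r n)) < (1/2)^n"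
    using Cauchy_fast_subseq[OF assms] by blast
  have "\<forall>n. \<exists>f. square_integrable f \<and> X (r n) = abs_l2 f"
    by (metis abs_l2_cases)
  then obtain f where f: "\<And>n. square_integrable (f n)" and Xf: "\<And>n. X (r n) = abs_l2 (f n)"
    by metis
  note [measurable] = square_integrable_measurable[OF f]
  define d where "d k x = f (Suc k) x - f k x" for k x
  have d: "square_integrable (d k)" for k
    unfolding d_def by (intro square_integrable_diff f)
  note [measurable] = square_integrable_measurable[OF d]
  have normd: "norm (abs_l2 (d k)) \<le> (1/2)^k" for k
    using r(2)[of k] by (simp add: Xf dist_norm abs_l2_diff f d_def[abs_def])
  have dc: "square_integrable (\<lambda>x. of_real (cmod (d k x)))" for k
    by (rule square_integrable_dominated[OF _ d]) auto
  \<comment> \<open>Minkowski's inequality, obtained from the triangle inequality in \<open>l2\<close>.\<close>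
  have part: "(\<integral>\<^sup>+x. ennreal ((\<Sum>k<N. cmod (d k x))\<^sup>2) \<partial>lborel) \<le> 4" for N
  proof -
    have "norm (abs_l2 (\<lambda>x. \<Sum>k<N. of_real (cmod (d k x)))) \<le> (\<Sum>k<N. (1/2)^k)"
    proof -
      have "norm (abs_l2 (\<lambda>x. of_real (cmod (d k x)))) \<le> 1 * norm (abs_l2 (d k))" for k
        by (rule abs_l2_norm_le[OF dc d]) auto
      then have "norm (abs_l2 (\<lambda>x. of_real (cmod (d k x)))) \<le> (1/2)^k" for k
        using normd[of k] by (metis mult_1 order_trans)
      then show ?thesis
        by (simp add: dc flip: abs_l2_sum) (rule order_trans[OF norm_sum], rule sum_mono)
    qed
    also have "\<dots> \<le> 2"
      by (simp add: sum_gp_strict)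
    finally have "(norm (abs_l2 (\<lambda>x. \<Sum>k<N. complex_of_real (cmod (d k x)))))\<^sup>2 \<le> 2\<^sup>2"
      by (intro power_mono) auto
    moreover have "square_integrable (\<lambda>x. \<Sum>k<N. complex_of_real (cmod (d k x)))"
      by (intro square_integrable_sum dc)
    from abs_l2_nn_integral[OF this]
    have "(\<integral>\<^sup>+x. ennreal ((\<Sum>k<N. cmod (d k x))\<^sup>2) \<partial>lborel)
      = ennreal ((norm (abs_l2 (\<lambda>x. \<Sum>k<N. complex_of_real (cmod (d k x)))))\<^sup>2)"
      by (simp flip: of_real_sum)
    ultimately show ?thesis
      using ennreal_leI by fastforce
  qed
  have "(\<integral>\<^sup>+x. (SUP N. ennreal ((\<Sum>k<N. cmod (d k x))\<^sup>2)) \<partial>lborel)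
      = (SUP N. \<integral>\<^sup>+x. ennreal ((\<Sum>k<N. cmod (d k x))\<^sup>2) \<partial>lborel)"
    by (intro nn_integral_monotone_convergence_SUP)
      (auto simp: incseq_def le_fun_def intro!: ennreal_leI power_mono sum_mono2 sum_nonneg)
  also have "\<dots> \<le> 4"
    by (intro SUP_least part)
  finally have "(\<integral>\<^sup>+x. (SUP N. ennreal ((\<Sum>k<N. cmod (d k x))\<^sup>2)) \<partial>lborel) \<noteq> \<infinity>"
    by (auto simp: top_unique)
  then have "AE x in lborel. (SUP N. ennreal ((\<Sum>k<N. cmod (d k x))\<^sup>2)) \<noteq> \<infinity>"
    by (intro nn_integral_PInf_AE) auto
  then have conv: "AE x in lborel. convergent (\<lambda>n. f n x)"
  proof eventually_elim
    case (elim x)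
    then obtain B where B: "(SUP N. ennreal ((\<Sum>k<N. cmod (d k x))\<^sup>2)) = ennreal B" "B \<ge> 0"
      by (cases "(SUP N. ennreal ((\<Sum>k<N. cmod (d k x))\<^sup>2))") auto
    have "(\<Sum>k<N. cmod (d k x)) \<le> sqrt B" for N
    proof -
      have "ennreal ((\<Sum>k<N. cmod (d k x))\<^sup>2) \<le> ennreal B"
        unfolding B(1)[symmetric] by (rule SUP_upper) auto
      then show ?thesis
        using B(2) by (simp add: real_le_rsqrt)
    qed
    then have "summable (\<lambda>k. cmod (d k x))"
      by (intro summableI_nonneg_bounded) auto
    then have "summable (\<lambda>k. d k x)"
      by (rule summable_norm_cancel)
    then have "convergent (\<lambda>n. f n x - f 0 x)"
      using sum_lessThan_telescope[of "\<lambda>n. f n x"]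
      by (simp add: summable_iff_convergent d_def)
    then show ?case
      by (simp add: convergent_diff_const_right_iff)
  qed
  define g where "g x = lim (\<lambda>n. f n x)" for x
  have g [measurable]: "g \<in> borel_measurable borel"
    unfolding g_def by (rule borel_measurable_lim_metric) measurable
  have lim: "AE x in lborel. (\<lambda>n. f n x) \<longlonglongrightarrow> g x"
    using conv by eventually_elim (simp add: g_def convergent_LIMSEQ_iff)
  \<comment> \<open>Membership of \<open>g\<close> in the space is part of the conclusion, so Fatou is applied to \<open>g - f n\<close>.\<close>
  have key: "square_integrable (\<lambda>x. g x - f n x) \<and> norm (abs_l2 (\<lambda>x. g x - f n x)) \<le> e"
    if e: "\<And>m. m \<ge> n \<Longrightarrow> norm (X (r m) - X (r n)) \<le> e" for n e
  proof -
    have 1: "square_integrable (\<lambda>x. f (m + n) x - f n x)" for m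
      by (intro square_integrable_diff f)
    have 2: "(\<lambda>x. g x - f n x) \<in> borel_measurable borel"
      by measurable
    have 3: "AE x in lborel. (\<lambda>m. f (m + n) x - f n x) \<longlonglongrightarrow> g x - f n x"
      using lim by eventually_elim (intro tendsto_intros LIMSEQ_ignore_initial_segment)
    have 4: "norm (abs_l2 (\<lambda>x. f (m + n) x - f n x)) \<le> e" for m
      using e[of "m + n"] by (simp add: Xf abs_l2_diff f)
    show ?thesis
      using square_integrable_limit_of_bounded[OF 1 2 3 4] by blast
  qed
  have Cr: "Cauchy (X \<circ> r)"
    using \<open>Cauchy X\<close> r(1) by (rule Cauchy_subseq_Cauchy)
  have ev: "\<exists>N. \<forall>n\<ge>N. square_integrable (\<lambda>x. g x - f n x) \<and> norm (abs_l2 (\<lambda>x. g x - f n x)) \<le> e"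
    if "e > 0" for e
  proof -
    obtain N where "\<forall>m\<ge>N. \<forall>n\<ge>N. dist ((X \<circ> r) m) ((X \<circ> r) n) < e"
      using metric_CauchyD[OF Cr \<open>e > 0\<close>] by blast
    then have "norm (X (r m) - X (r n)) \<le> e" if "n \<ge> N" "m \<ge> n" for m n
      using that by (simp add: dist_norm less_imp_le)
    then show ?thesis
      using key by blast
  qed
  obtain N where "square_integrable (\<lambda>x. g x - f N x)"
    using ev[of 1] by auto
  from square_integrable_add[OF this f[of N]] have sg: "square_integrable g"
    by simp
  have "(X \<circ> r) \<longlonglongrightarrow> abs_l2 g"
  proof (rule metric_LIMSEQ_I)
    fix e :: real assume "e > 0"
    then obtain N where N: "\<forall>n\<ge>N. norm (abs_l2 (\<lambda>x. g x - f n x)) \<le> e / 2"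
      using ev[of "e / 2"] by auto
    have "dist ((X \<circ> r) n) (abs_l2 g) < e" if "n \<ge> N" for n
    proof -
      have "dist ((X \<circ> r) n) (abs_l2 g) = norm (abs_l2 (\<lambda>x. g x - f n x))"
        by (subst dist_commute) (simp add: Xf dist_norm abs_l2_diff f sg)
      then show ?thesis
        using N[rule_format, OF that] \<open>e > 0\<close> by linarith
    qed
    then show "\<exists>N. \<forall>n\<ge>N. dist ((X \<circ> r) n) (abs_l2 g) < e"
      by blast
  qed
  then have "X \<longlonglongrightarrow> abs_l2 g"
    using Cauchy_converges_subseq[OF \<open>Cauchy X\<close> r(1)] by (simp add: o_def)
  then show "convergent X"
    by (rule convergentI)
qed

instance l2 :: banach
  by standard (rule l2_Cauchy_convergent)

section \<open>Density of step functions\<close>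

lemma square_integrable_bounded_indicator:
  "A \<in> sets borel \<Longrightarrow> square_integrable (\<lambda>x. c * indicator (A \<inter> {a..b}) x)"
proof -
  assume A [measurable]: "A \<in> sets borel"
  have "integrable lborel (\<lambda>x. (cmod c)\<^sup>2 * indicator (A \<inter> {a..b}) x :: real)"
  proof (intro integrable_mult_right integrable_real_indicator)
    have "emeasure lborel (A \<inter> {a..b}) \<le> emeasure lborel {a..b}"
      by (rule emeasure_mono) auto
    also have "\<dots> < \<infinity>"
      by (simp add: emeasure_lborel_Icc_eq)
    finally show "emeasure lborel (A \<inter> {a..b}) < \<infinity>" .
  qed auto
  also have "(\<lambda>x. (cmod c)\<^sup>2 * indicator (A \<inter> {a..b}) x) = (\<lambda>x. (cmod (c * indicator (A \<inter> {a..b}) x))\<^sup>2)"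
    by (auto simp: fun_eq_iff indicator_def)
  finally show ?thesis
    by (simp add: square_integrable_def)
qed

lemma square_integrable_interval: "square_integrable (\<lambda>x. c * indicator {a..b} x)"
  using square_integrable_bounded_indicator[of UNIV c a b] by simp

text \<open>Indicators of intervals form an intersection-stable generator of the Borel sets, so a
  Dynkin class argument inside a fixed bounded window reaches the indicators of all bounded Borel
  sets: complements become differences and disjoint unions become dominated limits. Simple
  functions, cut off to growing windows, then approximate any square-integrable function.\<close>
theorem interval_indicators_dense:
  fixes V :: "l2 set"
  assumes "closed V" "subspace V" and ivl: "\<And>c a b. abs_l2 (\<lambda>x. c * indicator {a..b} x) \<in> V"
  shows "u \<in> V"
proof -
  define I where "I n = {- real n..real n}" for n :: nat
  have I [measurable]: "I n \<in> sets borel" for n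
    by (simp add: I_def)
  have sq: "square_integrable (\<lambda>x. c * indicator (A \<inter> I n) x)" if "A \<in> sets borel" for A n c
    unfolding I_def using that by (rule square_integrable_bounded_indicator)
  have sqI: "square_integrable (\<lambda>x. c * indicator (I n) x)" for c n
    using sq[of UNIV c n] by simp
  have Borel: "abs_l2 (\<lambda>x. c * indicator (A \<inter> I n) x) \<in> V" if "A \<in> sets borel" for A n c
  proof -
    have "Int_stable (range (\<lambda>(a, b). {a..b::real}))"
      by (auto simp: Int_stable_def)
    moreover have "range (\<lambda>(a, b). {a..b::real}) \<subseteq> Pow UNIV"
      by simp
    moreover have "A \<in> sigma_sets UNIV (range (\<lambda>(a, b). {a..b::real}))"
      using that by (simp add: borel_eq_atLeastAtMost)
    ultimately show ?thesis
    proof (induction rule: sigma_sets_induct_disjoint)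
      case (basic A)
      then obtain a b where "A = {a..b}"
        by auto
      then have "A \<inter> I n = {max a (- real n)..min b (real n)}"
        by (auto simp: I_def)
      then show ?case
        by (simp add: ivl)
    next
      case empty
      then show ?case
        using subspace_0[OF assms(2)] by (simp add: abs_l2_zero)
    next
      case (compl A)
      then have A: "A \<in> sets borel"
        by (simp add: borel_eq_atLeastAtMost)
      have "abs_l2 (\<lambda>x. c * indicator (I n) x) - abs_l2 (\<lambda>x. c * indicator (A \<inter> I n) x)
          = abs_l2 (\<lambda>x. c * indicator ((UNIV - A) \<inter> I n) x)"
        unfolding abs_l2_diff[OF sqI sq[OF A]]
        by (intro arg_cong[where f = abs_l2] ext) (auto simp: indicator_def)
      moreover have "abs_l2 (\<lambda>x. c * indicator (I n) x) \<in> V"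
        unfolding I_def by (rule ivl)
      ultimately show ?case
        using subspace_diff[OF assms(2) _ compl(2)] by metis
    next
      case (union B)
      have B [measurable]: "B i \<in> sets borel" for i
        using union(2) by (auto simp: borel_eq_atLeastAtMost)
      have mem: "abs_l2 (\<lambda>x. c * indicator ((\<Union>i<N. B i) \<inter> I n) x) \<in> V" for N
      proof -
        have "abs_l2 (\<lambda>x. c * indicator ((\<Union>i<N. B i) \<inter> I n) x)
            = (\<Sum>i<N. abs_l2 (\<lambda>x. c * indicator (B i \<inter> I n) x))"
        proof -
          have "indicator (\<Union>i<N. B i) x = (\<Sum>i<N. indicator (B i) x :: complex)" for x
            using union(1) by (intro indicator_UN_disjoint) (auto intro: disjoint_family_on_mono)
          then have "(\<lambda>x. c * indicator ((\<Union>i<N. B i) \<inter> I n) x)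
              = (\<lambda>x. \<Sum>i<N. c * indicator (B i \<inter> I n) x)"
            by (simp only: indicator_inter_arith sum_distrib_right sum_distrib_left mult.assoc)
          then show ?thesis
            by (simp only: abs_l2_sum[OF sq[OF B]])
        qed
        then show ?thesis
          using union(3) by (auto intro: subspace_sum[OF assms(2)])
      qed
      have lim: "(\<lambda>N. abs_l2 (\<lambda>x. c * indicator ((\<Union>i<N. B i) \<inter> I n) x))
          \<longlonglongrightarrow> abs_l2 (\<lambda>x. c * indicator ((\<Union>i. B i) \<inter> I n) x)"
      proof (rule abs_l2_dominated_convergence(2)[OF _ _ sqI[of c n]])
        have "(\<lambda>N. indicator (\<Union>i<N. B i) x :: complex) \<longlonglongrightarrow> indicator (\<Union>i. B i) x" for x
          by (rule LIMSEQ_indicator_UN)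
        then have "(\<lambda>N. c * (indicator (\<Union>i<N. B i) x * indicator (I n) x))
            \<longlonglongrightarrow> c * (indicator (\<Union>i. B i) x * indicator (I n) x)" for x
          by (intro tendsto_intros)
        then show "AE x in lborel. (\<lambda>N. c * indicator ((\<Union>i<N. B i) \<inter> I n) x)
            \<longlonglongrightarrow> c * indicator ((\<Union>i. B i) \<inter> I n) x"
          by (simp add: indicator_inter_arith)
      qed (auto simp: indicator_def)
      show ?case
        by (rule closed_sequentially[OF assms(1) mem lim])
    qed
  qed
  obtain f where f: "square_integrable f" and u: "u = abs_l2 f"
    by (rule abs_l2_cases)
  note [measurable] = square_integrable_measurable[OF f]
  obtain s where s: "\<And>i. simple_function borel (s i)" "\<And>x. (\<lambda>i. s i x) \<longlonglongrightarrow> f x"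
    and bound: "\<And>i x. cmod (s i x) \<le> 2 * cmod (f x)"
    using borel_measurable_implies_sequence_metric[of f borel 0]
    by (auto simp: square_integrable_measurable f)
  have sm [measurable]: "s i \<in> borel_measurable borel" for i
    by (rule borel_measurable_simple_function) (rule s)
  have mem: "abs_l2 (\<lambda>x. s n x * indicator (I n) x) \<in> V" for n
  proof -
    let ?A = "\<lambda>y. s n -` {y}"
    have fin: "finite (range (s n))" and A [measurable]: "?A y \<in> sets borel" for y
      using s(1)[of n] by (auto simp: simple_function_def intro: measurable_sets_borel[OF sm])
    have "(\<lambda>x. s n x * indicator (I n) x) = (\<lambda>x. \<Sum>y\<in>range (s n). y * indicator (?A y \<inter> I n) x)"
    proof
      fix x
      have "(\<Sum>y\<in>range (s n). y * indicator (?A y \<inter> I n) x)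
          = (\<Sum>y\<in>range (s n). if y = s n x then y * indicator (I n) x else 0)"
        by (intro sum.cong) (auto simp: indicator_def)
      also have "\<dots> = s n x * indicator (I n) x"
        using fin by (simp add: sum.delta)
      finally show "s n x * indicator (I n) x = (\<Sum>y\<in>range (s n). y * indicator (?A y \<inter> I n) x)"
        by simp
    qed
    then have "abs_l2 (\<lambda>x. s n x * indicator (I n) x)
        = (\<Sum>y\<in>range (s n). abs_l2 (\<lambda>x. y * indicator (?A y \<inter> I n) x))"
      by (simp add: abs_l2_sum sq)
    then show ?thesis
      using Borel[OF A] by (auto intro: subspace_sum[OF assms(2)])
  qed
  have lim: "(\<lambda>n. abs_l2 (\<lambda>x. s n x * indicator (I n) x)) \<longlonglongrightarrow> abs_l2 f"
  proof (rule abs_l2_dominated_convergence(2)[OF _ _ square_integrable_scale[OF f, of 2]])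
    show "AE x in lborel. (\<lambda>n. s n x * indicator (I n) x) \<longlonglongrightarrow> f x"
    proof (rule AE_I2)
      fix x
      obtain N :: nat where N: "\<bar>x\<bar> \<le> real N"
        using real_arch_simple by blast
      have "eventually (\<lambda>n. s n x = s n x * indicator (I n) x) sequentially"
        using eventually_ge_at_top[of N]
      proof eventually_elim
        case (elim n)
        then have "x \<in> I n"
          using N by (auto simp: I_def)
        then show ?case by simp
      qed
      then show "(\<lambda>n. s n x * indicator (I n) x) \<longlonglongrightarrow> f x"
        by (rule Lim_transform_eventually[OF s(2)])
    qed
    show "AE x in lborel. cmod (s n x * indicator (I n) x) \<le> cmod (2 * f x)" for n
      using bound[of n] by (auto simp: norm_mult indicator_def)
  qed measurable
  show "u \<in> V"
    unfolding u by (rule closed_sequentially[OF assms(1) mem lim])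
qed

lemma subspace_closure_normed:
  fixes S :: "'a::real_normed_vector set"
  assumes "subspace S"
  shows "subspace (closure S)"
proof (rule subspaceI)
  show "0 \<in> closure S"
    using subspace_0[OF assms] closure_subset by blast
next
  fix x y assume "x \<in> closure S" "y \<in> closure S"
  then obtain f g where "\<And>n. f n \<in> S" "f \<longlonglongrightarrow> x" "\<And>n. g n \<in> S" "g \<longlonglongrightarrow> y"
    unfolding closure_sequential by blast
  then have "(\<lambda>n. f n + g n) \<longlonglongrightarrow> x + y" "\<And>n. f n + g n \<in> S"
    by (auto intro: tendsto_add subspace_add[OF assms])
  then show "x + y \<in> closure S"
    unfolding closure_sequential by (intro exI[of _ "\<lambda>n. f n + g n"]) blast
next
  fix c x assume "x \<in> closure S"
  then obtain f where "\<And>n. f n \<in> S" "f \<longlonglongrightarrow> x"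
    unfolding closure_sequential by blast
  then have "(\<lambda>n. c *\<^sub>R f n) \<longlonglongrightarrow> c *\<^sub>R x" "\<And>n. c *\<^sub>R f n \<in> S"
    by (auto intro: tendsto_scaleR subspace_scale[OF assms])
  then show "c *\<^sub>R x \<in> closure S"
    unfolding closure_sequential by (intro exI[of _ "\<lambda>n. c *\<^sub>R f n"]) blast
qed

text \<open>The step functions. The span is real-linear; complex combinations are covered because the
  generators carry a complex factor.\<close>
definition interval_span :: "l2 set" where
  "interval_span = span {abs_l2 (\<lambda>x. c * indicator {a..b} x) |c a b. True}"

lemma closed_superset_interval_span:
  assumes "closed W" "interval_span \<subseteq> W"
  shows "u \<in> W"
proof -
  have "u \<in> closure interval_span"
  proof (rule interval_indicators_dense)
    show "subspace (closure interval_span)"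
      unfolding interval_span_def by (intro subspace_closure_normed subspace_span)
    show "abs_l2 (\<lambda>x. c * indicator {a..b} x) \<in> closure interval_span" for c a b
      unfolding interval_span_def by (intro closure_subset[THEN subsetD] span_base) blast
  qed simp
  then show ?thesis
    using closure_minimal[OF assms(2,1)] by blast
qed

section \<open>Fourier transforms of intervals\<close>

text \<open>The unnormalised Fourier integral of the indicator of \<open>[a, b]\<close>.\<close>
definition interval_transform :: "real \<Rightarrow> real \<Rightarrow> real \<Rightarrow> complex" where
  "interval_transform a b \<xi> = (\<integral>x. indicator {a..b} x *\<^sub>R cis (- (x * \<xi>)) \<partial>lborel)"

lemma measurable_cis [measurable]: "cis \<in> borel_measurable borel"
  by (intro borel_measurable_continuous_onI continuous_intros)

lemma measurable_cnj [measurable]: "cnj \<in> borel_measurable borel"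
  by (intro borel_measurable_continuous_onI continuous_intros)

lemma measurable_interval_transform [measurable]:
  "interval_transform a b \<in> borel_measurable borel"
  unfolding interval_transform_def[abs_def] by measurable

lemma interval_transform_empty:
  assumes "b \<le> a"
  shows "interval_transform a b \<xi> = 0"
proof -
  have "AE x in lborel. indicator {a..b} x *\<^sub>R cis (- (x * \<xi>)) = 0"
    using AE_lborel_singleton[of a] by eventually_elim (use assms in \<open>auto simp: indicator_def\<close>)
  then show ?thesis
    unfolding interval_transform_def by (rule integral_eq_zero_AE)
qed

lemma interval_transform_eq:
  assumes "a \<le> b" "\<xi> \<noteq> 0"
  shows "interval_transform a b \<xi> = (iexp (- (\<xi> * a)) - iexp (- (\<xi> * b))) / (\<i> * \<xi>)"
proof -
  have "interval_transform a b \<xi> = - cis (- (b * \<xi>)) / (\<i> * \<xi>) - (- cis (- (a * \<xi>)) / (\<i> * \<xi>))"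
    unfolding interval_transform_def
  proof (rule integral_FTC_atLeastAtMost[OF assms(1)])
    fix x
    have "((\<lambda>z. - exp (- (\<i> * (z * \<xi>))) / (\<i> * \<xi>)) has_field_derivative
        exp (- (\<i> * (of_real x * \<xi>)))) (at (of_real x))"
      using assms(2) by (auto intro!: derivative_eq_intros simp: algebra_simps)
    from has_vector_derivative_real_field[OF this] show "((\<lambda>x. - cis (- (x * \<xi>)) / (\<i> * \<xi>)) has_vector_derivative cis (- (x * \<xi>))) (at x within {a..b})"
      by (simp add: cis_conv_exp)
  qed (intro continuous_intros)
  then show ?thesis
    using assms(2) by (simp add: cis_conv_exp field_simps)
qed

lemma norm_interval_transform_le: "cmod (interval_transform a b \<xi>) \<le> \<bar>b - a\<bar>"
proof (cases "a \<le> b")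
  case True
  have "cmod (interval_transform a b \<xi>) \<le> (\<integral>x. indicator {a..b} x \<partial>lborel)"
    unfolding interval_transform_def 
  proof (rule Bochner_Integration.integral_norm_bound_integral)
    have "set_integrable lborel {a..b} (\<lambda>x. cis (- (x * \<xi>)))"
      by (intro borel_integrable_atLeastAtMost' continuous_intros)
    then show "integrable lborel (\<lambda>x. indicator {a..b} x *\<^sub>R cis (- (x * \<xi>)))"
      by (simp add: set_integrable_def)
  qed (use True in auto)
  then show ?thesis
    using True by simp
qed (simp add: interval_transform_empty)

lemma norm_interval_transform_decay: "cmod (\<xi> * interval_transform a b \<xi>) \<le> 2"
proof (cases "a \<le> b \<and> \<xi> \<noteq> 0")
  case True
  then have "\<xi> * interval_transform a b \<xi> = - \<i> * (iexp (- (\<xi> * a)) - iexp (- (\<xi> * b)))"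
    by (simp add: interval_transform_eq field_simps)
  then have "cmod (\<xi> * interval_transform a b \<xi>) = cmod (iexp (- (\<xi> * a)) - iexp (- (\<xi> * b)))"
    by (simp add: norm_mult)
  also have "\<dots> \<le> cmod (iexp (- (\<xi> * a))) + cmod (iexp (- (\<xi> * b)))"
    by (rule norm_triangle_ineq4)
  also have "\<dots> = 2"
    by (simp only: norm_exp_i_times)
  finally show ?thesis .
qed (auto simp: interval_transform_empty)

text \<open>The transform is bounded and decays like \<open>1 / |\<xi>|\<close>, hence its square is
  dominated by a multiple of \<open>1 / (1 + \<xi>\<^sup>2)\<close>.\<close>
lemma square_integrable_interval_transform: "square_integrable (interval_transform a b)"
proof -
  have "integrable lborel (\<lambda>x::real. ((b - a)\<^sup>2 + 4) * inverse (1 + x\<^sup>2))"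
    using integrable_inverse_1_plus_square
    by (intro integrable_mult_right) (simp add: set_integrable_def einterval_def)
  then have "integrable lborel (\<lambda>\<xi>. (cmod (interval_transform a b \<xi>))\<^sup>2)"
  proof (rule Bochner_Integration.integrable_bound)
    show "AE \<xi> in lborel. norm ((cmod (interval_transform a b \<xi>))\<^sup>2) \<le> norm (((b - a)\<^sup>2 + 4) * inverse (1 + \<xi>\<^sup>2))"
    proof (rule AE_I2)
      fix \<xi> :: real
      have "(cmod (interval_transform a b \<xi>))\<^sup>2 \<le> (b - a)\<^sup>2"
        using power_mono[OF norm_interval_transform_le, of a b \<xi> 2] by simp
      moreover have "\<xi>\<^sup>2 * (cmod (interval_transform a b \<xi>))\<^sup>2 \<le> 4"
        using power_mono[OF norm_interval_transform_decay, of \<xi> a b 2]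
        by (simp add: norm_mult power_mult_distrib)
      ultimately have "(1 + \<xi>\<^sup>2) * (cmod (interval_transform a b \<xi>))\<^sup>2 \<le> (b - a)\<^sup>2 + 4"
        by (simp add: distrib_right)
      moreover have "1 + \<xi>\<^sup>2 > 0"
        by (simp add: add_pos_nonneg)
      ultimately have "(cmod (interval_transform a b \<xi>))\<^sup>2 \<le> ((b - a)\<^sup>2 + 4) * inverse (1 + \<xi>\<^sup>2)"
        by (simp add: field_simps)
      then show "norm ((cmod (interval_transform a b \<xi>))\<^sup>2) \<le> norm (((b - a)\<^sup>2 + 4) * inverse (1 + \<xi>\<^sup>2))"
        by simp
    qed
  qed measurable
  then show ?thesis
    by (simp add: square_integrable_def)
qed

lemma square_integrable_cnj: "square_integrable f \<Longrightarrow> square_integrable (\<lambda>x. cnj (f x))"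
proof (rule square_integrable_dominated)
  assume "square_integrable f"
  then have [measurable]: "f \<in> borel_measurable borel"
    by (rule square_integrable_measurable)
  show "(\<lambda>x. cnj (f x)) \<in> borel_measurable borel"
    by measurable
qed auto

lemma square_integrable_mult:
  assumes "square_integrable f" "square_integrable g"
  shows "integrable lborel (\<lambda>x. f x * g x)"
proof (rule Bochner_Integration.integrable_bound)
  have [measurable]: "f \<in> borel_measurable borel" "g \<in> borel_measurable borel"
    using assms by (auto intro: square_integrable_measurable)
  show "integrable lborel (\<lambda>x. (cmod (f x))\<^sup>2 + (cmod (g x))\<^sup>2)"
    using assms by (auto intro: square_integrable_integrable)
  show "(\<lambda>x. f x * g x) \<in> borel_measurable lborel"
    by measurable
  have "cmod z * cmod w \<le> (cmod z)\<^sup>2 + (cmod w)\<^sup>2" for z w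
    using sum_squares_bound[of "cmod z" "cmod w"] mult_nonneg_nonneg[OF norm_ge_zero[of z] norm_ge_zero[of w]]
    by linarith
  then show "AE x in lborel. norm (f x * g x) \<le> norm ((cmod (f x))\<^sup>2 + (cmod (g x))\<^sup>2)"
    by (auto simp: norm_mult)
qed

text \<open>Up to normalisation and conjugation the transform of an interval is the characteristic
  function of the uniform distribution on it; this is the bridge to the inversion theorem.\<close>
lemma char_uniform:
  assumes "c < d"
  shows "char (uniform_measure lborel {c..d}) t = cnj (interval_transform c d t) / of_real (d - c)"
proof -
  have "(\<lambda>x. indicator {c..d} x / emeasure lborel {c..d}) = (\<lambda>x. ennreal (indicator {c..d} x / (d - c)))"
    using assms by (auto simp: fun_eq_iff indicator_def divide_ennreal simp flip: ennreal_1)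
  then have "char (uniform_measure lborel {c..d}) t = (\<integral>x. (indicator {c..d} x / (d - c)) *\<^sub>R iexp (t * x) \<partial>lborel)"
    unfolding char_def uniform_measure_def using assms
    by (simp add: integral_density)
  also have "\<dots> = (\<integral>x. cnj (indicator {c..d} x *\<^sub>R cis (- (x * t))) / of_real (d - c) \<partial>lborel)"
    by (intro Bochner_Integration.integral_cong refl)
      (auto simp: indicator_def cis_cnj scaleR_conv_of_real mult_ac simp flip: of_real_mult cis_conv_exp)
  also have "\<dots> = cnj (interval_transform c d t) / of_real (d - c)"
    unfolding interval_transform_def by (simp del: complex_cnj_scaleR flip: integral_cnj)
  finally show ?thesis .
qed

text \<open>Parseval's identity for two intervals. Levy's inversion theorem for the uniform
  distribution on \<open>[c, d]\<close>, evaluated on \<open>(a, b]\<close>, is this identity for the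
  integrals over \<open>[-T, T]\<close>. Both transforms are square integrable, so these integrals
  converge to the full one.\<close>
theorem interval_transform_gram:
  "(\<integral>\<xi>. interval_transform a b \<xi> * cnj (interval_transform c d \<xi>) \<partial>lborel)
    = of_real (2 * pi * measure lborel ({a..b} \<inter> {c..d}))"
proof (cases "a < b \<and> c < d")
  case True
  then have ab: "a < b" and cd: "c < d"
    by auto
  let ?M = "uniform_measure lborel {c..d}"
  let ?P = "\<lambda>\<xi>. interval_transform a b \<xi> * cnj (interval_transform c d \<xi>)"
  have intP: "integrable lborel ?P"
    by (intro square_integrable_mult square_integrable_cnj square_integrable_interval_transform)
  interpret real_distribution ?M
  proof (unfold real_distribution_def real_distribution_axioms_def, safe)
    show "prob_space ?M"
      using cd by (intro prob_space_uniform_measure) auto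
  qed auto
  have "({c..d} \<inter> {x}) = (if x \<in> {c..d} then {x} else {})" for x
    by auto
  then have "measure ?M {x} = 0" for x
    using cd by (subst measure_uniform_measure) auto
  then have Levy: "(\<lambda>T. 1 / (2 * pi) * (CLBINT t=-real T..real T. (iexp (-(t * a)) - iexp (-(t * b))) / (\<i> * t) * char ?M t))
      \<longlonglongrightarrow> measure ?M {a<..b}"
    using Levy_Inversion[of a b] ab by simp
  have eq: "(CLBINT t=-real T..real T. (iexp (-(t * a)) - iexp (-(t * b))) / (\<i> * t) * char ?M t)
      = (\<integral>t. indicator {- real T..real T} t *\<^sub>R ?P t \<partial>lborel) / of_real (d - c)" for T
  proof -
    have "(CLBINT t=-real T..real T. (iexp (-(t * a)) - iexp (-(t * b))) / (\<i> * t) * char ?M t)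
      = (CLBINT t:{- real T..real T}. (iexp (-(t * a)) - iexp (-(t * b))) / (\<i> * t) * char ?M t)"
      by (rule interval_integral_Icc) simp
    also have "\<dots> = (\<integral>t. indicator {- real T..real T} t *\<^sub>R ?P t / of_real (d - c) \<partial>lborel)"
      unfolding set_lebesgue_integral_def
    proof (rule integral_cong_AE)
      show "AE t in lborel. indicator {- real T..real T} t *\<^sub>R
          ((iexp (-(t * a)) - iexp (-(t * b))) / (\<i> * t) * char ?M t)
        = indicator {- real T..real T} t *\<^sub>R ?P t / of_real (d - c)"
        using AE_lborel_singleton[of 0]
        by eventually_elim (use ab in \<open>simp add: interval_transform_eq[of a b] char_uniform[OF cd] scaleR_conv_of_real\<close>)
    qed (auto simp: char_uniform[OF cd])
    finally show ?thesis
      by simp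
  qed
  have "(\<lambda>T. \<integral>t. indicator {- real T..real T} t *\<^sub>R ?P t \<partial>lborel) \<longlonglongrightarrow> (\<integral>t. ?P t \<partial>lborel)"
  proof (rule integral_dominated_convergence[OF _ _ integrable_norm[OF intP]])
    show "AE t in lborel. (\<lambda>T. indicator {- real T..real T} t *\<^sub>R ?P t) \<longlonglongrightarrow> ?P t"
    proof (rule AE_I2)
      fix t :: real
      obtain N :: nat where N: "\<bar>t\<bar> \<le> real N"
        using real_arch_simple by blast
      have "eventually (\<lambda>T. ?P t = indicator {- real T..real T} t *\<^sub>R ?P t) sequentially"
        using eventually_ge_at_top[of N] by eventually_elim (use N in \<open>auto simp: indicator_def\<close>)
      then show "(\<lambda>T. indicator {- real T..real T} t *\<^sub>R ?P t) \<longlonglongrightarrow> ?P t"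
        by (rule Lim_transform_eventually[OF tendsto_const])
    qed
  qed (auto simp: indicator_def)
  then have lim: "(\<lambda>T. 1 / (2 * pi) * ((\<integral>t. indicator {- real T..real T} t *\<^sub>R ?P t \<partial>lborel) / of_real (d - c)))
      \<longlonglongrightarrow> 1 / (2 * pi) * ((\<integral>t. ?P t \<partial>lborel) / of_real (d - c))"
    using cd by (intro tendsto_intros) auto
  have lev: "1 / (2 * pi) * ((\<integral>t. ?P t \<partial>lborel) / of_real (d - c)) = measure ?M {a<..b}"
    by (rule LIMSEQ_unique[OF lim Levy[unfolded eq]])
  have meas: "measure ?M {a<..b} = measure lborel ({a..b} \<inter> {c..d}) / (d - c)"
  proof -
    have "measure lborel ({c..d} \<inter> {a<..b}) = measure lborel ({a..b} \<inter> {c..d})"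
      unfolding measure_def
      by (intro arg_cong[where f = enn2real] emeasure_eq_AE) (use AE_lborel_singleton[of a] in auto)
    then show ?thesis
      using cd by (subst measure_uniform_measure) auto
  qed
  have fin: "X = of_real (2 * pi * m)"
    if "of_real (1 / (2 * pi)) * (X / of_real k) = of_real (m / k)" "k \<noteq> 0" for X :: complex and m k
    using that by (simp add: field_simps)
  show ?thesis
    by (rule fin[OF lev[unfolded meas]]) (use cd in simp)
next
  case False
  have "{a..b} \<inter> {c..d} \<subseteq> {a, c}"
    using False by auto
  then have "finite ({a..b} \<inter> {c..d})"
    by (rule finite_subset) simp
  then have "measure lborel ({a..b} \<inter> {c..d}) = 0"
    by (simp add: measure_def emeasure_lborel_countable countable_finite)
  then show ?thesis
    using False by (auto simp: interval_transform_empty)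
qed

section \<open>Fourier integrals over bounded windows\<close>

text \<open>The truncated Fourier integral depends only on the class of the function and is defined for
  every \<open>\<xi>\<close>, so it can be handled as an actual function of \<open>\<xi>\<close> before it is
  known to be square integrable.\<close>
lift_definition window_fourier :: "l2 \<Rightarrow> real \<Rightarrow> real \<Rightarrow> complex" is truncated_fourier
proof -
  fix f g :: "real \<Rightarrow> complex"
  assume "ae_eq f g"
  then have [measurable]: "f \<in> borel_measurable borel" "g \<in> borel_measurable borel"
    and ae: "AE x in lborel. f x = g x"
    by (auto simp: ae_eq_def square_integrable_def)
  have "(\<integral>x. indicator {-R..R} x *\<^sub>R (f x * cis (- (x * \<xi>))) \<partial>lborel)
      = (\<integral>x. indicator {-R..R} x *\<^sub>R (g x * cis (- (x * \<xi>))) \<partial>lborel)" for R \<xi>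
    using ae by (intro integral_cong_AE) auto
  then show "truncated_fourier f = truncated_fourier g"
    by (simp add: truncated_fourier_def[abs_def])
qed

lift_definition window :: "real \<Rightarrow> l2 \<Rightarrow> l2" is "\<lambda>R f x. indicator {-R..R} x * f x"
proof -
  fix R and f g :: "real \<Rightarrow> complex"
  assume "ae_eq f g"
  then have sq: "square_integrable f" "square_integrable g" and ae: "AE x in lborel. f x = g x"
    by (auto simp: ae_eq_def)
  have "square_integrable (\<lambda>x. indicator {-R..R} x * h x)" if "square_integrable h" for h
    using square_integrable_measurable[OF that]
    by (intro square_integrable_dominated[OF _ that]) (auto simp: indicator_def)
  moreover have "AE x in lborel. indicator {-R..R} x * f x = indicator {-R..R} x * g x"
    using ae by eventually_elim simp
  ultimately show "ae_eq (\<lambda>x. indicator {-R..R} x * f x) (\<lambda>x. indicator {-R..R} x * g x)"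
    using sq by (simp add: ae_eq_def)
qed

lemma window_fourier_abs:
  "square_integrable f \<Longrightarrow> window_fourier (abs_l2 f) = truncated_fourier f"
  by (simp add: window_fourier.abs_eq ae_eq_self_iff)

lemma window_abs:
  "square_integrable f \<Longrightarrow> window R (abs_l2 f) = abs_l2 (\<lambda>x. indicator {-R..R} x * f x)"
  by (simp add: window.abs_eq ae_eq_self_iff)

lemma square_integrable_window:
  assumes "square_integrable f"
  shows "square_integrable (\<lambda>x. indicator {-R..R} x * f x)"
  using square_integrable_measurable[OF assms]
  by (intro square_integrable_dominated[OF _ assms]) (auto simp: indicator_def)

text \<open>Exponentials cut off to \<open>[-R, R]\<close>. Pairing with them is the truncated Fourier
  integral, whose linearity and continuity in the \<open>l2\<close> argument thereby come for free.\<close>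
definition plane_wave :: "real \<Rightarrow> real \<Rightarrow> l2" where
  "plane_wave R \<xi> = abs_l2 (\<lambda>x. indicator {-R..R} x * cis (x * \<xi>) / of_real (sqrt (2 * pi)))"

lemma square_integrable_plane_wave:
  "square_integrable (\<lambda>x. indicator {-R..R} x * cis (x * \<xi>) / of_real (sqrt (2 * pi)))"
  by (rule square_integrable_dominated[OF _ square_integrable_interval[of "1 / of_real (sqrt (2 * pi))" "-R" R]])
    (auto simp: norm_mult norm_divide)

lemma Re_mult_cnj_eq_inner: "Re (z * cnj w) = z \<bullet> w"
  and Im_mult_cnj_eq_inner: "Im (z * cnj w) = z \<bullet> (\<i> * w)"
  by (simp_all add: inner_complex_def)

lemma window_fourier_eq:
  "window_fourier u R \<xi> = Complex (u \<bullet> plane_wave R \<xi>) (u \<bullet> cscale \<i> (plane_wave R \<xi>))"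
proof -
  obtain f where f: "square_integrable f" and u: "u = abs_l2 f"
    by (rule abs_l2_cases)
  let ?e = "\<lambda>x. indicator {-R..R} x * cis (x * \<xi>) / of_real (sqrt (2 * pi)) :: complex"
  note e = square_integrable_plane_wave[of R \<xi>]
  have eq: "truncated_fourier f R \<xi> = (\<integral>x. f x * cnj (?e x) \<partial>lborel)"
    unfolding truncated_fourier_def
    by (subst integral_divide_zero[symmetric])
      (intro Bochner_Integration.integral_cong refl, auto simp: indicator_def cis_cnj)
  have int: "integrable lborel (\<lambda>x. f x * cnj (?e x))"
    using f e by (intro square_integrable_mult square_integrable_cnj)
  have "Re (truncated_fourier f R \<xi>) = u \<bullet> plane_wave R \<xi>"
    unfolding eq u plane_wave_def integral_Re[OF int, symmetric] abs_l2_inner[OF f e]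
    by (intro Bochner_Integration.integral_cong refl) (rule Re_mult_cnj_eq_inner)
  moreover have "Im (truncated_fourier f R \<xi>) = u \<bullet> cscale \<i> (plane_wave R \<xi>)"
    unfolding eq u plane_wave_def integral_Im[OF int, symmetric] abs_l2_cscale[OF e]
      abs_l2_inner[OF f square_integrable_scale[OF e]]
    by (intro Bochner_Integration.integral_cong refl) (rule Im_mult_cnj_eq_inner)
  ultimately show ?thesis
    by (simp add: u window_fourier_abs f complex_eq_iff)
qed

lemma window_fourier_add: "window_fourier (u + v) R \<xi> = window_fourier u R \<xi> + window_fourier v R \<xi>"
  by (simp add: window_fourier_eq inner_add_left complex_eq_iff)

lemma window_fourier_scaleR: "window_fourier (r *\<^sub>R u) R \<xi> = of_real r * window_fourier u R \<xi>"
  by (simp add: window_fourier_eq complex_eq_iff)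

lemma window_fourier_zero: "window_fourier 0 R \<xi> = 0"
  by (simp add: window_fourier_eq complex_eq_iff)

lemma window_fourier_tendsto:
  assumes "f \<longlonglongrightarrow> u"
  shows "(\<lambda>n. window_fourier (f n) R \<xi>) \<longlonglongrightarrow> window_fourier u R \<xi>"
  unfolding window_fourier_eq using assms by (intro tendsto_Complex tendsto_intros)

lemma measurable_window_fourier [measurable]: "window_fourier u R \<in> borel_measurable borel"
proof -
  obtain f where f: "square_integrable f" and u: "u = abs_l2 f"
    by (rule abs_l2_cases)
  note [measurable] = square_integrable_measurable[OF f]
  show ?thesis
    unfolding u window_fourier_abs[OF f] truncated_fourier_def by measurable
qed

lemma window_fourier_interval:
  "window_fourier (abs_l2 (\<lambda>x. c * indicator {a..b} x)) R \<xi>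
    = c * interval_transform (max a (- R)) (min b R) \<xi> / of_real (sqrt (2 * pi))"
proof -
  have "(\<integral>x. indicator {-R..R} x *\<^sub>R (c * indicator {a..b} x * cis (- (x * \<xi>))) \<partial>lborel)
      = (\<integral>x. c * (indicator {max a (- R)..min b R} x *\<^sub>R cis (- (x * \<xi>))) \<partial>lborel)"
    by (intro Bochner_Integration.integral_cong refl) (auto simp: indicator_def)
  then show ?thesis
    unfolding window_fourier_abs[OF square_integrable_interval] truncated_fourier_def
      interval_transform_def integral_mult_right_zero by simp
qed

lemma window_add: "window R (u + v) = window R u + window R v"
  by transfer (auto simp: ae_eq_def distrib_left square_integrable_add square_integrable_window)

lemma window_scaleR: "window R (r *\<^sub>R u) = r *\<^sub>R window R u"
  by (rule abs_l2_cases[of u])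
    (simp add: window_abs abs_l2_scaleR square_integrable_scale square_integrable_window mult.left_commute)

lemma norm_window_le: "norm (window R u) \<le> norm u"
proof -
  obtain f where f: "square_integrable f" "u = abs_l2 f"
    by (rule abs_l2_cases)
  then have "norm (window R u) \<le> 1 * norm u"
    unfolding f(2) window_abs[OF f(1)]
    by (intro abs_l2_norm_le square_integrable_window) (auto simp: indicator_def)
  then show ?thesis by simp
qed

lemma bounded_linear_window: "bounded_linear (window R)"
  by (rule bounded_linear_intro[of _ 1]) (auto simp: window_add window_scaleR norm_window_le)

lemma window_symmetric: "window R u \<bullet> v = u \<bullet> window R v"
proof -
  obtain f where f: "square_integrable f" "u = abs_l2 f"
    by (rule abs_l2_cases)
  obtain g where g: "square_integrable g" "v = abs_l2 g"
    by (rule abs_l2_cases)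
  show ?thesis
    unfolding f(2) g(2) window_abs[OF f(1)] window_abs[OF g(1)]
      abs_l2_inner[OF square_integrable_window[OF f(1)] g(1)]
      abs_l2_inner[OF f(1) square_integrable_window[OF g(1)]]
    by (intro Bochner_Integration.integral_cong refl) (auto simp: indicator_def)
qed

lemma window_window: "window R (window S u) = window (min R S) u"
proof -
  obtain f where f: "square_integrable f" "u = abs_l2 f"
    by (rule abs_l2_cases)
  have "indicator {-R..R} x * (indicator {-S..S} x * f x) = indicator {-min R S..min R S} x * f x" for x
    by (auto simp: indicator_def)
  then show ?thesis
    unfolding f(2) by (simp only: window_abs f(1) square_integrable_window)
qed

lemma inner_times_complex: "(c * z) \<bullet> (d * w) = Re (c * cnj d * (z * cnj w))" for c z d w :: complex
  by (simp add: inner_complex_def algebra_simps)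

lemma window_fourier_gram_intervals:
  fixes c d :: complex
  defines "e \<equiv> \<lambda>c a b. abs_l2 (\<lambda>x. c * indicator {a..b} x)"
  shows "square_integrable (window_fourier (e c a b) R)"
    and "(\<integral>\<xi>. window_fourier (e c a b) R \<xi> \<bullet> window_fourier (e d a' b') R \<xi> \<partial>lborel)
      = window R (e c a b) \<bullet> e d a' b'"
proof -
  show "square_integrable (window_fourier (e c a b) R)"
    using square_integrable_scale[OF square_integrable_interval_transform, of "c / of_real (sqrt (2 * pi))"]
    unfolding e_def window_fourier_interval[abs_def] by simp
next
  define E where "E a b = interval_transform (max a (- R)) (min b R)" for a b
  define k where "k = c * cnj d"
  have int: "integrable lborel (\<lambda>\<xi>. E a b \<xi> * cnj (E a' b' \<xi>))"
    unfolding E_def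
    by (intro square_integrable_mult square_integrable_cnj square_integrable_interval_transform)
  have m: "measure lborel ({max a (- R)..min b R} \<inter> {max a' (- R)..min b' R})
      = measure lborel ({-R..R} \<inter> {a..b} \<inter> {a'..b'})"
    by (intro arg_cong[where f = "measure lborel"]) auto
  have "(\<integral>\<xi>. window_fourier (e c a b) R \<xi> \<bullet> window_fourier (e d a' b') R \<xi> \<partial>lborel)
      = (\<integral>\<xi>. Re (k / of_real (2 * pi) * (E a b \<xi> * cnj (E a' b' \<xi>))) \<partial>lborel)"
  proof (intro Bochner_Integration.integral_cong refl)
    fix \<xi>
    have "window_fourier (e c a b) R \<xi> \<bullet> window_fourier (e d a' b') R \<xi>
        = Re (c / of_real (sqrt (2 * pi)) * cnj (d / of_real (sqrt (2 * pi))) * (E a b \<xi> * cnj (E a' b' \<xi>)))"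
      unfolding e_def window_fourier_interval E_def[symmetric] inner_times_complex[symmetric] by simp
    also have "c / of_real (sqrt (2 * pi)) * cnj (d / of_real (sqrt (2 * pi))) = k / of_real (2 * pi)"
      by (simp add: k_def flip: of_real_mult)
    finally show "window_fourier (e c a b) R \<xi> \<bullet> window_fourier (e d a' b') R \<xi>
        = Re (k / of_real (2 * pi) * (E a b \<xi> * cnj (E a' b' \<xi>)))" .
  qed
  also have "\<dots> = Re (k / of_real (2 * pi) * (\<integral>\<xi>. E a b \<xi> * cnj (E a' b' \<xi>) \<partial>lborel))"
    using int by (subst integral_Re) auto
  also have "\<dots> = Re (k * of_real (measure lborel ({-R..R} \<inter> {a..b} \<inter> {a'..b'})))"
    unfolding E_def interval_transform_gram m by simp
  also have "\<dots> = (\<integral>x. Re k * indicator ({-R..R} \<inter> {a..b} \<inter> {a'..b'}) x \<partial>lborel)"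
  proof -
    have "emeasure lborel ({-R..R} \<inter> {a..b} \<inter> {a'..b'}) \<le> emeasure lborel {-R..R}"
      by (intro emeasure_mono) auto
    also have "\<dots> < \<infinity>"
      by (simp add: emeasure_lborel_Icc_eq)
    finally show ?thesis
      by simp
  qed
  also have "\<dots> = window R (e c a b) \<bullet> e d a' b'"
    unfolding e_def window_abs[OF square_integrable_interval]
      abs_l2_inner[OF square_integrable_window[OF square_integrable_interval] square_integrable_interval]
    by (intro Bochner_Integration.integral_cong refl)
      (auto simp: indicator_def k_def inner_complex_def)
  finally show "(\<integral>\<xi>. window_fourier (e c a b) R \<xi> \<bullet> window_fourier (e d a' b') R \<xi> \<partial>lborel)
      = window R (e c a b) \<bullet> e d a' b'" .
qed

text \<open>The Gram identity for intervals extends to step functions, one argument at a time.\<close>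
lemma window_fourier_isometry_span:
  assumes "u \<in> interval_span"
  shows "square_integrable (window_fourier u R)"
    and "norm (abs_l2 (window_fourier u R)) = norm (window R u)"
proof -
  let ?G = "{abs_l2 (\<lambda>x. c * indicator {a..b} x) |c a b. True}"
  let ?W = "\<lambda>u. window_fourier u R"
  have sub: "subspace {u. square_integrable (?W u) \<and>
      abs_l2 (?W u) \<bullet> abs_l2 (?W v) = window R u \<bullet> v}"
    if "square_integrable (?W v)" for v
  proof (rule subspaceI)
    show "0 \<in> {u. square_integrable (?W u) \<and> abs_l2 (?W u) \<bullet> abs_l2 (?W v) = window R u \<bullet> v}"
      using window_scaleR[of R 0]
      by (simp add: window_fourier_zero[abs_def] square_integrable_zero abs_l2_zero)
  next
    fix u w
    assume u: "u \<in> {u. square_integrable (?W u) \<and> abs_l2 (?W u) \<bullet> abs_l2 (?W v) = window R u \<bullet> v}"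
      and w: "w \<in> {u. square_integrable (?W u) \<and> abs_l2 (?W u) \<bullet> abs_l2 (?W v) = window R u \<bullet> v}"
    have "?W (u + w) = (\<lambda>\<xi>. ?W u \<xi> + ?W w \<xi>)"
      by (simp add: fun_eq_iff window_fourier_add)
    then show "u + w \<in> {u. square_integrable (?W u) \<and> abs_l2 (?W u) \<bullet> abs_l2 (?W v) = window R u \<bullet> v}"
      using u w by (simp add: square_integrable_add window_add inner_add_left flip: abs_l2_add)
  next
    fix r u
    assume u: "u \<in> {u. square_integrable (?W u) \<and> abs_l2 (?W u) \<bullet> abs_l2 (?W v) = window R u \<bullet> v}"
    have "?W (r *\<^sub>R u) = (\<lambda>\<xi>. of_real r * ?W u \<xi>)"
      by (simp add: fun_eq_iff window_fourier_scaleR)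
    then show "r *\<^sub>R u \<in> {u. square_integrable (?W u) \<and> abs_l2 (?W u) \<bullet> abs_l2 (?W v) = window R u \<bullet> v}"
      using u by (simp add: square_integrable_scale window_scaleR flip: abs_l2_scaleR)
  qed
  have base: "square_integrable (?W g)" if "g \<in> ?G" for g
    using that window_fourier_gram_intervals(1) by fast
  have gram: "abs_l2 (?W g) \<bullet> abs_l2 (?W g') = window R g \<bullet> g'" if "g \<in> ?G" "g' \<in> ?G" for g g'
    unfolding abs_l2_inner[OF base[OF that(1)] base[OF that(2)]]
    using that window_fourier_gram_intervals(2) by fast
  have 1: "square_integrable (?W u) \<and> abs_l2 (?W u) \<bullet> abs_l2 (?W g) = window R u \<bullet> g"
    if "g \<in> ?G" "u \<in> interval_span" for g u
    using that(2) unfolding interval_span_def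
    by (rule span_induct[OF _ sub]) (use that(1) base gram in auto)
  have "abs_l2 (\<lambda>x. 0 * indicator {0..0} x) \<in> ?G"
    by blast
  then have sq: "square_integrable (?W u)" if "u \<in> interval_span" for u
    using 1 that by blast
  have "square_integrable (?W v) \<and> abs_l2 (?W v) \<bullet> abs_l2 (?W u) = window R v \<bullet> u"
    if "v \<in> interval_span" for v
    using that unfolding interval_span_def
  proof (rule span_induct[OF _ sub[OF sq[OF assms]]])
    fix g assume "g \<in> ?G"
    then show "square_integrable (?W g) \<and> abs_l2 (?W g) \<bullet> abs_l2 (?W u) = window R g \<bullet> u"
      using 1[OF _ assms, of g] base[of g] window_symmetric[of R u g] by (simp only: inner_commute)
  qed
  from this[OF assms] have "abs_l2 (?W u) \<bullet> abs_l2 (?W u) = window R u \<bullet> u"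
    by blast
  also have "\<dots> = window R (window R u) \<bullet> u"
    by (simp add: window_window)
  also have "\<dots> = window R u \<bullet> window R u"
    by (rule window_symmetric)
  finally show "norm (abs_l2 (?W u)) = norm (window R u)"
    by (simp add: norm_eq_sqrt_inner)
  show "square_integrable (?W u)"
    by (rule sq[OF assms])
qed

text \<open>The inequality passes from step functions to all of \<open>l2\<close>: truncated Fourier
  integrals converge pointwise along a convergent sequence, so Fatou's lemma gives both square
  integrability and the bound for the limit.\<close>
lemma window_fourier_contraction:
  "square_integrable (window_fourier u R) \<and> norm (abs_l2 (window_fourier u R)) \<le> norm u"
proof -
  let ?K = "{u. square_integrable (window_fourier u R) \<and> norm (abs_l2 (window_fourier u R)) \<le> norm u}"
  have "u \<in> ?K"
  proof (rule closed_superset_interval_span)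
    show "interval_span \<subseteq> ?K"
      using norm_window_le by (auto simp: window_fourier_isometry_span)
    show "closed ?K"
      unfolding closed_sequential_limits
    proof safe
      fix f l assume f: "\<forall>n. f n \<in> ?K" "f \<longlonglongrightarrow> l"
      have *: "square_integrable (window_fourier l R) \<and> norm (abs_l2 (window_fourier l R)) \<le> norm l + e"
        if "e > 0" for e
      proof -
        have "eventually (\<lambda>n. norm (f n) < norm l + e) sequentially"
          using tendsto_norm[OF f(2)] that by (intro order_tendstoD) auto
        then obtain N where N: "\<And>n. n \<ge> N \<Longrightarrow> norm (f n) < norm l + e"
          by (auto simp: eventually_sequentially)
        have lim: "(\<lambda>n. window_fourier (f (n + N)) R \<xi>) \<longlonglongrightarrow> window_fourier l R \<xi>" for \<xi>
          by (intro window_fourier_tendsto LIMSEQ_ignore_initial_segment f(2))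
        have b: "norm (abs_l2 (window_fourier (f (n + N)) R)) \<le> norm l + e" for n
          using f(1) N[of "n + N"] by (auto intro: order_trans less_imp_le)
        have sq: "square_integrable (window_fourier (f (n + N)) R)" for n
          using f(1) by auto
        show ?thesis
          using square_integrable_limit_of_bounded[OF sq measurable_window_fourier AE_I2[OF lim] b] by blast
      qed
      show "square_integrable (window_fourier l R)"
        by (rule *[THEN conjunct1, OF zero_less_one])
      show "norm (abs_l2 (window_fourier l R)) \<le> norm l"
        by (rule field_le_epsilon) (rule *[THEN conjunct2])
    qed
  qed
  then show ?thesis by simp
qed

section \<open>The Plancherel theorem\<close>

definition window_transform :: "real \<Rightarrow> l2 \<Rightarrow> l2" where
  "window_transform R u = abs_l2 (window_fourier u R)"

lemma square_integrable_window_fourier: "square_integrable (window_fourier u R)"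
  by (rule window_fourier_contraction[THEN conjunct1])

lemma norm_window_transform_le: "norm (window_transform R u) \<le> norm u"
  unfolding window_transform_def by (rule window_fourier_contraction[THEN conjunct2])

lemma window_transform_add:
  "window_transform R (u + v) = window_transform R u + window_transform R v"
  unfolding window_transform_def
  by (simp add: window_fourier_add[abs_def] abs_l2_add square_integrable_window_fourier)

lemma window_transform_scaleR: "window_transform R (r *\<^sub>R u) = r *\<^sub>R window_transform R u"
  unfolding window_transform_def
  by (simp add: window_fourier_scaleR[abs_def] abs_l2_scaleR square_integrable_window_fourier)

lemma bounded_linear_window_transform: "bounded_linear (window_transform R)"
  by (rule bounded_linear_intro[of _ 1])
    (auto simp: window_transform_add window_transform_scaleR norm_window_transform_le)

text \<open>Now that both sides are norms of bounded operators, the identity extends by continuity from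
  the dense set of step functions.\<close>
lemma norm_window_transform: "norm (window_transform R u) = norm (window R u)"
proof -
  have "u \<in> {u. norm (window_transform R u) = norm (window R u)}"
  proof (rule closed_superset_interval_span)
    show "interval_span \<subseteq> {u. norm (window_transform R u) = norm (window R u)}"
      unfolding window_transform_def using window_fourier_isometry_span(2) by blast
    show "closed {u. norm (window_transform R u) = norm (window R u)}"
      by (intro closed_Collect_eq continuous_on_norm linear_continuous_on
          bounded_linear_window_transform bounded_linear_window)
  qed
  then show ?thesis by simp
qed

lemma window_fourier_window: "window_fourier (window S u) R = window_fourier u (min R S)"
proof -
  obtain f where f: "square_integrable f" "u = abs_l2 f"
    by (rule abs_l2_cases)
  have "indicator {-R..R} x *\<^sub>R (indicator {-S..S} x * f x * z) = indicator {-min R S..min R S} x *\<^sub>R (f x * z)"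
    for x z
    by (auto simp: indicator_def)
  then show ?thesis
    unfolding f(2) window_abs[OF f(1)] window_fourier_abs[OF f(1)]
      window_fourier_abs[OF square_integrable_window[OF f(1)]] truncated_fourier_def[abs_def]
    by simp
qed

lemma window_transform_window: "window_transform R (window S u) = window_transform (min R S) u"
  by (simp add: window_transform_def window_fourier_window)

lemma window_tendsto: "((\<lambda>R. window R u) \<longlongrightarrow> u) at_top"
proof (rule tendsto_at_topI_sequentially)
  fix X :: "nat \<Rightarrow> real" assume X: "filterlim X at_top sequentially"
  obtain f where f: "square_integrable f" "u = abs_l2 f"
    by (rule abs_l2_cases)
  note [measurable] = square_integrable_measurable[OF f(1)]
  show "(\<lambda>n. window (X n) u) \<longlonglongrightarrow> u"
    unfolding f(2) window_abs[OF f(1)]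
  proof (rule abs_l2_dominated_convergence(2)[OF _ _ f(1)])
    show "AE x in lborel. (\<lambda>n. indicator {- X n..X n} x * f x) \<longlonglongrightarrow> f x"
    proof (rule AE_I2)
      fix x
      have "eventually (\<lambda>n. f x = indicator {- X n..X n} x * f x) sequentially"
        using filterlim_at_top[THEN iffD1, OF X, rule_format, of "\<bar>x\<bar>"]
        by eventually_elim (auto simp: indicator_def)
      then show "(\<lambda>n. indicator {- X n..X n} x * f x) \<longlonglongrightarrow> f x"
        by (rule Lim_transform_eventually[OF tendsto_const])
    qed
  qed (auto simp: indicator_def)
qed

lemma tendsto_of_norm_bound:
  fixes l :: "'a::real_normed_vector"
  assumes "\<And>x. norm (f x - l) \<le> b x" "(b \<longlongrightarrow> 0) F"
  shows "(f \<longlongrightarrow> l) F"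
  by (rule LIM_zero_cancel, rule Lim_null_comparison[OF _ assms(2)]) (simp add: assms(1))

lemma has_fourier_iff: "has_fourier u g \<longleftrightarrow> ((\<lambda>R. window_transform R u) \<longlongrightarrow> g) at_top"
proof -
  obtain f where f: "square_integrable f" "u = abs_l2 f"
    by (rule abs_l2_cases)
  obtain h where h: "square_integrable h" "g = abs_l2 h"
    by (rule abs_l2_cases)
  have "(\<integral>\<^sup>+\<xi>. ennreal ((cmod (truncated_fourier f R \<xi> - h \<xi>))\<^sup>2) \<partial>lborel)
      = ennreal ((norm (window_transform R u - g))\<^sup>2)" for R
    using square_integrable_window_fourier[of u R] h
    by (simp add: window_transform_def f window_fourier_abs abs_l2_diff abs_l2_nn_integral square_integrable_diff)
  then have "has_fourier u g \<longleftrightarrow> ((\<lambda>R. ennreal ((norm (window_transform R u - g))\<^sup>2)) \<longlongrightarrow> ennreal 0) at_top"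
    by (simp add: f h has_fourier.abs_eq ae_eq_self_iff)
  also have "\<dots> \<longleftrightarrow> ((\<lambda>R. (norm (window_transform R u - g))\<^sup>2) \<longlongrightarrow> 0) at_top"
    by (intro tendsto_ennreal_iff) auto
  also have "\<dots> \<longleftrightarrow> ((\<lambda>R. norm (window_transform R u - g)) \<longlongrightarrow> 0) at_top"
  proof
    assume "((\<lambda>R. (norm (window_transform R u - g))\<^sup>2) \<longlongrightarrow> 0) at_top"
    then have "((\<lambda>R. sqrt ((norm (window_transform R u - g))\<^sup>2)) \<longlongrightarrow> sqrt 0) at_top"
      by (rule tendsto_real_sqrt)
    then show "((\<lambda>R. norm (window_transform R u - g)) \<longlongrightarrow> 0) at_top"
      by simp
  next
    assume "((\<lambda>R. norm (window_transform R u - g)) \<longlongrightarrow> 0) at_top"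
    from tendsto_power[OF this, of 2]
    show "((\<lambda>R. (norm (window_transform R u - g))\<^sup>2) \<longlongrightarrow> 0) at_top"
      by simp
  qed
  finally show ?thesis
    by (simp add: tendsto_norm_zero_iff LIM_zero_iff)
qed

text \<open>The transforms of the windowed functions form a Cauchy family, because
  \<open>window_transform R u - window_transform S u\<close> is the transform of a part of
  \<open>u - window S u\<close>, and windows exhaust \<open>u\<close>. Completeness of \<open>l2\<close> supplies the limit.\<close>
theorem has_fourier_fourier: "has_fourier u (fourier u)"
proof -
  have bound: "norm (window_transform R u - window_transform S u) \<le> norm (u - window S u)" if "S \<le> R" for R S
  proof -
    have "window_transform R u - window_transform S u = window_transform R (u - window S u)"
      using that window_transform_add[of R "u - window S u" "window S u"]
      by (simp add: window_transform_window algebra_simps)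
    then show ?thesis
      by (simp add: norm_window_transform_le)
  qed
  have lim0: "((\<lambda>R. norm (u - window R u)) \<longlongrightarrow> 0) at_top"
    using tendsto_norm[OF tendsto_diff[OF tendsto_const[of u] window_tendsto[of u]]] by simp
  have "Cauchy (\<lambda>n. window_transform (real n) u)"
  proof (rule metric_CauchyI)
    fix e :: real assume e: "e > 0"
    have "eventually (\<lambda>R. norm (u - window R u) < e / 2) at_top"
      using lim0 e by (intro order_tendstoD) auto
    then obtain N where N: "\<And>R. R \<ge> N \<Longrightarrow> norm (u - window R u) < e / 2"
      by (auto simp: eventually_at_top_linorder)
    obtain M :: nat where M: "real M \<ge> N"
      using real_arch_simple by blast
    have "dist (window_transform (real m) u) (window_transform (real n) u) < e" if "m \<ge> M" "n \<ge> M" for m n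
    proof -
      have "dist (window_transform (real m) u) (window_transform (real M) u) < e / 2"
        using bound[of "real M" "real m"] N[OF M] that by (simp add: dist_norm)
      moreover have "dist (window_transform (real n) u) (window_transform (real M) u) < e / 2"
        using bound[of "real M" "real n"] N[OF M] that by (simp add: dist_norm)
      ultimately show ?thesis
        by (rule dist_triangle_half_l)
    qed
    then show "\<exists>M. \<forall>m\<ge>M. \<forall>n\<ge>M. dist (window_transform (real m) u) (window_transform (real n) u) < e"
      by blast
  qed
  then obtain g where g: "(\<lambda>n. window_transform (real n) u) \<longlonglongrightarrow> g"
    using Cauchy_convergent convergent_def by blast
  have "norm (window_transform R u - g) \<le> norm (u - window R u)" for R
  proof (rule LIMSEQ_le_const2)
    show "(\<lambda>n. norm (window_transform R u - window_transform (real n) u)) \<longlonglongrightarrow> norm (window_transform R u - g)"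
      by (intro tendsto_intros g)
    obtain M :: nat where M: "real M \<ge> R"
      using real_arch_simple by blast
    show "\<exists>N. \<forall>n\<ge>N. norm (window_transform R u - window_transform (real n) u) \<le> norm (u - window R u)"
      using M
      by (intro exI[of _ M]) (auto simp: norm_minus_commute[of "window_transform R u"] intro: bound)
  qed
  then have "((\<lambda>R. window_transform R u) \<longlongrightarrow> g) at_top"
    by (rule tendsto_of_norm_bound[OF _ lim0])
  then have "has_fourier u g"
    by (simp add: has_fourier_iff)
  moreover have "g' = g" if "has_fourier u g'" for g'
    using that \<open>has_fourier u g\<close> tendsto_unique[OF trivial_limit_at_top_linorder]
    unfolding has_fourier_iff by blast
  ultimately show ?thesis
    unfolding fourier_def by (rule theI)
qed

lemma window_transform_tendsto: "((\<lambda>R. window_transform R u) \<longlongrightarrow> fourier u) at_top"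
  using has_fourier_fourier by (simp add: has_fourier_iff)

lemma fourier_eqI: "((\<lambda>R. window_transform R u) \<longlongrightarrow> g) at_top \<Longrightarrow> fourier u = g"
  by (rule tendsto_unique[OF trivial_limit_at_top_linorder window_transform_tendsto])

lemma fourier_add: "fourier (u + v) = fourier u + fourier v"
  by (rule fourier_eqI) (simp add: window_transform_add tendsto_add window_transform_tendsto)

lemma fourier_scaleR: "fourier (r *\<^sub>R u) = r *\<^sub>R fourier u"
  by (rule fourier_eqI) (simp add: window_transform_scaleR tendsto_scaleR window_transform_tendsto)

theorem norm_fourier: "norm (fourier u) = norm u"
proof (rule tendsto_unique[OF trivial_limit_at_top_linorder])
  show "((\<lambda>R. norm (window_transform R u)) \<longlongrightarrow> norm (fourier u)) at_top"
    by (intro tendsto_norm window_transform_tendsto)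
  show "((\<lambda>R. norm (window_transform R u)) \<longlongrightarrow> norm u) at_top"
    unfolding norm_window_transform by (intro tendsto_norm window_tendsto)
qed

lemma bounded_linear_fourier: "bounded_linear fourier"
  by (rule bounded_linear_intro[of _ 1]) (auto simp: fourier_add fourier_scaleR norm_fourier)

lemma fourier_diff: "fourier (u - v) = fourier u - fourier v"
  by (rule linear_diff[OF bounded_linear.linear[OF bounded_linear_fourier]])

lemma fourier_uminus: "fourier (- u) = - fourier u"
  by (rule linear_neg[OF bounded_linear.linear[OF bounded_linear_fourier]])

lemma fourier_zero: "fourier 0 = 0"
  by (rule linear_0[OF bounded_linear.linear[OF bounded_linear_fourier]])

lemma fourier_inner: "fourier u \<bullet> fourier v = u \<bullet> v"
  by (simp add: dot_norm norm_fourier flip: fourier_add)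

lemma norm_cscale: "norm (cscale c u) = cmod c * norm u"
proof -
  obtain f where f: "square_integrable f" "u = abs_l2 f"
    by (rule abs_l2_cases)
  have "(norm (cscale c u))\<^sup>2 = (cmod c * norm u)\<^sup>2"
    by (simp add: f abs_l2_cscale abs_l2_norm square_integrable_scale norm_mult power_mult_distrib)
  then show ?thesis
    by simp
qed

lemma cscale_add: "cscale c (u + v) = cscale c u + cscale c v"
  using vector_space.vector_space_assms(1)[OF vector_space_cscale] .

lemma cscale_scaleR: "cscale c (r *\<^sub>R u) = r *\<^sub>R cscale c u"
  by (rule abs_l2_cases[of u]) (simp add: abs_l2_cscale abs_l2_scaleR square_integrable_scale mult.left_commute)

lemma bounded_linear_cscale: "bounded_linear (cscale c)"
  by (rule bounded_linear_intro[of _ "cmod c"]) (auto simp: cscale_add cscale_scaleR norm_cscale)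

lemma window_fourier_cscale: "window_fourier (cscale c u) R \<xi> = c * window_fourier u R \<xi>"
proof -
  obtain f where f: "square_integrable f" "u = abs_l2 f"
    by (rule abs_l2_cases)
  have "(\<integral>x. indicator {-R..R} x *\<^sub>R (c * f x * cis (- (x * \<xi>))) \<partial>lborel)
      = c * (\<integral>x. indicator {-R..R} x *\<^sub>R (f x * cis (- (x * \<xi>))) \<partial>lborel)"
    unfolding integral_mult_right_zero[symmetric]
    by (intro Bochner_Integration.integral_cong refl) (simp add: mult_ac)
  then show ?thesis
    unfolding f(2) abs_l2_cscale[OF f(1)] window_fourier_abs[OF f(1)]
      window_fourier_abs[OF square_integrable_scale[OF f(1)]] truncated_fourier_def
    by simp
qed

lemma fourier_cscale: "fourier (cscale c u) = cscale c (fourier u)"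
proof (rule fourier_eqI)
  have "window_transform R (cscale c u) = cscale c (window_transform R u)" for R
    unfolding window_transform_def
    by (simp add: window_fourier_cscale[abs_def] abs_l2_cscale square_integrable_window_fourier)
  then show "((\<lambda>R. window_transform R (cscale c u)) \<longlongrightarrow> cscale c (fourier u)) at_top"
    by (simp add: bounded_linear.tendsto[OF bounded_linear_cscale] window_transform_tendsto)
qed

lift_definition cnj_l2 :: "l2 \<Rightarrow> l2" is "\<lambda>f x. cnj (f x)"
  by (auto simp: ae_eq_def square_integrable_cnj)

lemma abs_l2_cnj: "square_integrable f \<Longrightarrow> cnj_l2 (abs_l2 f) = abs_l2 (\<lambda>x. cnj (f x))"
  by (simp add: cnj_l2.abs_eq ae_eq_self_iff)

lemma cnj_l2_cnj_l2: "cnj_l2 (cnj_l2 u) = u"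
  by (rule abs_l2_cases[of u]) (simp add: abs_l2_cnj square_integrable_cnj)

lemma norm_cnj_l2: "norm (cnj_l2 u) = norm u"
proof -
  obtain f where f: "square_integrable f" "u = abs_l2 f"
    by (rule abs_l2_cases)
  have "(norm (cnj_l2 u))\<^sup>2 = (norm u)\<^sup>2"
    by (simp add: f abs_l2_cnj abs_l2_norm square_integrable_cnj)
  then show ?thesis
    by simp
qed

lemma cnj_l2_add: "cnj_l2 (u + v) = cnj_l2 u + cnj_l2 v"
  by transfer (auto simp: ae_eq_def square_integrable_cnj square_integrable_add)

lemma cnj_l2_scaleR: "cnj_l2 (r *\<^sub>R u) = r *\<^sub>R cnj_l2 u"
  by (rule abs_l2_cases[of u]) (simp add: abs_l2_cnj abs_l2_scaleR square_integrable_scale square_integrable_cnj)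

lemma bounded_linear_cnj_l2: "bounded_linear cnj_l2"
  by (rule bounded_linear_intro[of _ 1]) (auto simp: cnj_l2_add cnj_l2_scaleR norm_cnj_l2)

lemma integrable_window:
  assumes "square_integrable f"
  shows "integrable lborel (\<lambda>x. indicator {-R..R} x * f x)"
  using square_integrable_mult[OF square_integrable_interval[of 1 "-R" R] assms] by simp

lemma abs_l2_inner_cnj:
  assumes "square_integrable f" "square_integrable h"
  shows "abs_l2 f \<bullet> cnj_l2 (abs_l2 h) = Re (\<integral>x. f x * h x \<partial>lborel)"
  unfolding abs_l2_cnj[OF assms(2)] abs_l2_inner[OF assms(1) square_integrable_cnj[OF assms(2)]]
  by (subst integral_Re[symmetric]) (auto simp: inner_complex_def square_integrable_mult assms)

text \<open>Fubini's theorem for the kernel \<open>exp (- i x \<xi>)\<close>, which is symmetric in its two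
  variables. Cutting off both functions makes them integrable. The conjugation turns the real
  inner product into the real part of the bilinear pairing.\<close>
lemma window_transform_symmetric:
  "window_transform R u \<bullet> cnj_l2 (window S v) = window R u \<bullet> cnj_l2 (window_transform S v)"
proof -
  obtain f where f: "square_integrable f" "u = abs_l2 f"
    by (rule abs_l2_cases)
  obtain h where h: "square_integrable h" "v = abs_l2 h"
    by (rule abs_l2_cases)
  note [measurable] = square_integrable_measurable[OF f(1)] square_integrable_measurable[OF h(1)]
  define a where "a x = indicator {-R..R} x * f x" for x
  define b where "b \<xi> = indicator {-S..S} \<xi> * h \<xi>" for \<xi>
  have a: "integrable lborel a" and b: "integrable lborel b"
    unfolding a_def[abs_def] b_def[abs_def] by (intro integrable_window f h)+
  have [measurable]: "a \<in> borel_measurable borel" "b \<in> borel_measurable borel"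
    using a b by (simp_all add: borel_measurable_integrable)
  have sqa: "square_integrable a" and sqb: "square_integrable b"
    unfolding a_def[abs_def] b_def[abs_def] by (intro square_integrable_window f h)+
  define K where "K x \<xi> = a x * b \<xi> * cis (- (x * \<xi>)) / of_real (sqrt (2 * pi))" for x \<xi>
  have Fa: "window_fourier u R \<xi> = (\<integral>x. a x * cis (- (x * \<xi>)) / of_real (sqrt (2 * pi)) \<partial>lborel)" for \<xi>
    unfolding f(2) window_fourier_abs[OF f(1)] truncated_fourier_def integral_divide_zero a_def
    by (intro arg_cong2[where f = "(/)"] Bochner_Integration.integral_cong refl) (simp add: indicator_def)
  have Fb: "window_fourier v S x = (\<integral>\<xi>. b \<xi> * cis (- (x * \<xi>)) / of_real (sqrt (2 * pi)) \<partial>lborel)" for x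
    unfolding h(2) window_fourier_abs[OF h(1)] truncated_fourier_def integral_divide_zero b_def
    by (intro arg_cong2[where f = "(/)"] Bochner_Integration.integral_cong refl) (simp add: indicator_def mult.commute)
  have K: "integrable (lborel \<Otimes>\<^sub>M lborel) (\<lambda>(x, \<xi>). K x \<xi>)"
  proof (rule lborel_pair.Fubini_integrable)
    show "(\<lambda>(x, \<xi>). K x \<xi>) \<in> borel_measurable (lborel \<Otimes>\<^sub>M lborel)"
      unfolding K_def by measurable
    have "integrable lborel (\<lambda>x. cmod (a x) * ((\<integral>\<xi>. cmod (b \<xi>) \<partial>lborel) / sqrt (2 * pi)))"
      using a by simp
    then show "integrable lborel (\<lambda>x. \<integral>\<xi>. norm (case (x, \<xi>) of (x, \<xi>) \<Rightarrow> K x \<xi>) \<partial>lborel)"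
      by (simp add: K_def norm_mult norm_divide)
    have "integrable lborel (\<lambda>\<xi>. K x \<xi>)" for x
      unfolding K_def
    proof (rule Bochner_Integration.integrable_bound)
      show "integrable lborel (\<lambda>\<xi>. a x * b \<xi> / of_real (sqrt (2 * pi)))"
        using b by simp
    qed (auto simp: norm_mult norm_divide)
    then show "AE x in lborel. integrable lborel (\<lambda>\<xi>. case (x, \<xi>) of (x, \<xi>) \<Rightarrow> K x \<xi>)"
      by simp
  qed
  have "(\<integral>\<xi>. window_fourier u R \<xi> * b \<xi> \<partial>lborel) = (\<integral>\<xi>. (\<integral>x. K x \<xi> \<partial>lborel) \<partial>lborel)"
    unfolding Fa integral_mult_left_zero[symmetric] K_def by (simp add: mult_ac)
  also have "\<dots> = (\<integral>x. (\<integral>\<xi>. K x \<xi> \<partial>lborel) \<partial>lborel)"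
    by (rule lborel_pair.Fubini_integral[OF K])
  also have "\<dots> = (\<integral>x. a x * window_fourier v S x \<partial>lborel)"
    unfolding Fb integral_mult_right_zero[symmetric] K_def by (simp add: mult_ac)
  finally have eq: "(\<integral>\<xi>. window_fourier u R \<xi> * b \<xi> \<partial>lborel) = (\<integral>x. a x * window_fourier v S x \<partial>lborel)" .
  have wu: "window R u = abs_l2 a" and wv: "window S v = abs_l2 b"
    unfolding f(2) h(2) by (simp_all add: window_abs f h a_def[abs_def] b_def[abs_def])
  show ?thesis
    unfolding wu wv window_transform_def
      abs_l2_inner_cnj[OF square_integrable_window_fourier sqb]
      abs_l2_inner_cnj[OF sqa square_integrable_window_fourier] eq ..
qed

lemma fourier_symmetric: "fourier u \<bullet> cnj_l2 v = u \<bullet> cnj_l2 (fourier v)"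
proof (rule tendsto_unique[OF trivial_limit_at_top_linorder])
  note cnj = bounded_linear.tendsto[OF bounded_linear_cnj_l2]
  show "((\<lambda>R. window_transform R u \<bullet> cnj_l2 (window R v)) \<longlongrightarrow> fourier u \<bullet> cnj_l2 v) at_top"
    by (intro tendsto_inner cnj window_transform_tendsto window_tendsto)
  show "((\<lambda>R. window_transform R u \<bullet> cnj_l2 (window R v)) \<longlongrightarrow> u \<bullet> cnj_l2 (fourier v)) at_top"
    unfolding window_transform_symmetric
    by (intro tendsto_inner cnj window_transform_tendsto window_tendsto)
qed

text \<open>The adjoint of the transform with respect to the real inner product. By symmetry of the
  kernel it is the transform conjugated by complex conjugation, hence again an isometry.\<close>
definition inverse_fourier :: "l2 \<Rightarrow> l2" where
  "inverse_fourier v = cnj_l2 (fourier (cnj_l2 v))"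

lemma bounded_linear_inverse_fourier: "bounded_linear inverse_fourier"
  unfolding inverse_fourier_def
  by (intro bounded_linear_compose[OF bounded_linear_cnj_l2]
      bounded_linear_compose[OF bounded_linear_fourier] bounded_linear_cnj_l2)

lemma norm_inverse_fourier: "norm (inverse_fourier v) = norm v"
  by (simp add: inverse_fourier_def norm_cnj_l2 norm_fourier)

lemma fourier_adjoint: "fourier u \<bullet> v = u \<bullet> inverse_fourier v"
  using fourier_symmetric[of u "cnj_l2 v"] by (simp add: inverse_fourier_def cnj_l2_cnj_l2)

theorem inverse_fourier_fourier: "inverse_fourier (fourier u) = u"
proof -
  have "w \<bullet> inverse_fourier (fourier u) = w \<bullet> u" for w
    using fourier_adjoint[of w "fourier u"] by (simp add: fourier_inner)
  from this[of "inverse_fourier (fourier u) - u"]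
  have "(inverse_fourier (fourier u) - u) \<bullet> (inverse_fourier (fourier u) - u) = 0"
    by (simp add: inner_diff_right)
  then show ?thesis by simp
qed

text \<open>Surjectivity without a separate inversion argument: the adjoint is a left inverse and is itself
  injective, so it is a two-sided inverse.\<close>
theorem fourier_inverse_fourier: "fourier (inverse_fourier v) = v"
proof -
  have "inverse_fourier (fourier (inverse_fourier v) - v) = 0"
    by (simp add: linear_diff[OF bounded_linear.linear[OF bounded_linear_inverse_fourier]]
        inverse_fourier_fourier)
  then have "norm (fourier (inverse_fourier v) - v) = 0"
    using norm_inverse_fourier by (metis norm_zero)
  then show ?thesis by simp
qed

lemma fourier_inject: "fourier u = fourier v \<longleftrightarrow> u = v"
  using inverse_fourier_fourier by metis

section \<open>Multiplication operators and Fourier multipliers\<close>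

lemma is_product_abs:
  "square_integrable f \<Longrightarrow> square_integrable g \<Longrightarrow>
    is_product m (abs_l2 f) (abs_l2 g) \<longleftrightarrow> (AE \<xi> in lborel. g \<xi> = m \<xi> * f \<xi>)"
  by (simp add: is_product.abs_eq ae_eq_self_iff)

lemma is_product_unique:
  assumes "is_product m f g" "is_product m f h"
  shows "g = h"
  using assms
proof (transfer fixing: m)
  fix f g h :: "real \<Rightarrow> complex"
  assume "ae_eq g g" "ae_eq h h" "AE \<xi> in lborel. g \<xi> = m \<xi> * f \<xi>" "AE \<xi> in lborel. h \<xi> = m \<xi> * f \<xi>"
  then show "ae_eq g h"
    by (auto simp: ae_eq_def elim: AE_mp)
qed

lemma is_product_add: "is_product m f g \<Longrightarrow> is_product m f' g' \<Longrightarrow> is_product m (f + f') (g + g')"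
proof (transfer fixing: m)
  fix f g f' g' :: "real \<Rightarrow> complex"
  assume "AE \<xi> in lborel. g \<xi> = m \<xi> * f \<xi>" "AE \<xi> in lborel. g' \<xi> = m \<xi> * f' \<xi>"
  then show "AE \<xi> in lborel. g \<xi> + g' \<xi> = m \<xi> * (f \<xi> + f' \<xi>)"
    by eventually_elim (simp add: distrib_left)
qed

lemma is_product_cscale: "is_product m f g \<Longrightarrow> is_product m (cscale c f) (cscale c g)"
proof (transfer fixing: m c)
  fix f g :: "real \<Rightarrow> complex"
  assume "AE \<xi> in lborel. g \<xi> = m \<xi> * f \<xi>"
  then show "AE \<xi> in lborel. c * g \<xi> = m \<xi> * (c * f \<xi>)"
    by eventually_elim simp
qed

lemma is_product_scaleR: "is_product m f g \<Longrightarrow> is_product m (r *\<^sub>R f) (r *\<^sub>R g)"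
proof (transfer fixing: m r)
  fix f g :: "real \<Rightarrow> complex"
  assume "AE \<xi> in lborel. g \<xi> = m \<xi> * f \<xi>"
  then show "AE \<xi> in lborel. of_real r * g \<xi> = m \<xi> * (of_real r * f \<xi>)"
    by eventually_elim simp
qed

lemma is_product_diff: "is_product m f g \<Longrightarrow> is_product m f' g' \<Longrightarrow> is_product m (f - f') (g - g')"
  using is_product_add[of m f g "- f'" "- g'"] is_product_scaleR[of m f' g' "-1"] by simp

lemma is_product_compose:
  "is_product m f g \<Longrightarrow> is_product n g h \<Longrightarrow> is_product (\<lambda>\<xi>. n \<xi> * m \<xi>) f h"
proof (transfer fixing: m n)
  fix f g h :: "real \<Rightarrow> complex"
  assume "AE \<xi> in lborel. g \<xi> = m \<xi> * f \<xi>" "AE \<xi> in lborel. h \<xi> = n \<xi> * g \<xi>"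
  then show "AE \<xi> in lborel. h \<xi> = n \<xi> * m \<xi> * f \<xi>"
    by eventually_elim simp
qed

lemma is_product_quotient:
  "is_product m f g \<Longrightarrow> is_product (\<lambda>\<xi>. n \<xi> * m \<xi>) f h \<Longrightarrow> is_product n g h"
proof (transfer fixing: m n)
  fix f g h :: "real \<Rightarrow> complex"
  assume "AE \<xi> in lborel. g \<xi> = m \<xi> * f \<xi>" "AE \<xi> in lborel. h \<xi> = n \<xi> * m \<xi> * f \<xi>"
  then show "AE \<xi> in lborel. h \<xi> = n \<xi> * g \<xi>"
    by eventually_elim simp
qed

lemma is_product_one: "is_product (\<lambda>\<xi>. 1) f f"
  by transfer simp

lemma is_product_norm_le:
  assumes "is_product m f g" "is_product n f h" "\<And>\<xi>. cmod (m \<xi>) \<le> C * cmod (n \<xi>)" "C \<ge> 0"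
  shows "norm g \<le> C * norm h"
proof -
  obtain f0 where f: "square_integrable f0" "f = abs_l2 f0"
    by (rule abs_l2_cases)
  obtain g0 where g: "square_integrable g0" "g = abs_l2 g0"
    by (rule abs_l2_cases)
  obtain h0 where h: "square_integrable h0" "h = abs_l2 h0"
    by (rule abs_l2_cases)
  have "AE \<xi> in lborel. g0 \<xi> = m \<xi> * f0 \<xi>" "AE \<xi> in lborel. h0 \<xi> = n \<xi> * f0 \<xi>"
    using assms(1,2) f g h by (simp_all add: is_product_abs)
  then have "AE \<xi> in lborel. cmod (g0 \<xi>) \<le> C * cmod (h0 \<xi>)"
  proof eventually_elim
    case (elim \<xi>)
    then show ?case
      using mult_right_mono[OF assms(3)[of \<xi>], of "cmod (f0 \<xi>)"] by (simp add: norm_mult mult.assoc)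
  qed
  then show ?thesis
    unfolding g(2) h(2) by (rule abs_l2_norm_le[OF g(1) h(1) _ assms(4)])
qed

lemma is_product_norm_eq:
  assumes "is_product m f g" "is_product n f h" "\<And>\<xi>. cmod (m \<xi>) = cmod (n \<xi>)"
  shows "norm g = norm h"
  using is_product_norm_le[OF assms(1,2), of 1] is_product_norm_le[OF assms(2,1), of 1] assms(3) by simp

lemma is_product_exists:
  assumes "is_product n f h" "m \<in> borel_measurable borel" "\<And>\<xi>. cmod (m \<xi>) \<le> cmod (n \<xi>)"
  shows "\<exists>g. is_product m f g"
proof -
  obtain f0 where f: "square_integrable f0" "f = abs_l2 f0"
    by (rule abs_l2_cases)
  obtain h0 where h: "square_integrable h0" "h = abs_l2 h0"
    by (rule abs_l2_cases)
  have ae: "AE \<xi> in lborel. h0 \<xi> = n \<xi> * f0 \<xi>"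
    using assms(1) f h by (simp add: is_product_abs)
  have "square_integrable (\<lambda>\<xi>. m \<xi> * f0 \<xi>)"
  proof (rule square_integrable_dominated[OF _ h(1)])
    show "(\<lambda>\<xi>. m \<xi> * f0 \<xi>) \<in> borel_measurable borel"
      using assms(2) square_integrable_measurable[OF f(1)] by measurable
    show "AE \<xi> in lborel. cmod (m \<xi> * f0 \<xi>) \<le> cmod (h0 \<xi>)"
      using ae by eventually_elim (simp add: norm_mult mult_right_mono assms(3))
  qed
  then have "is_product m f (abs_l2 (\<lambda>\<xi>. m \<xi> * f0 \<xi>))"
    using f by (simp add: is_product_abs)
  then show ?thesis ..
qed

lemma is_product_bounded_exists:
  assumes "m \<in> borel_measurable borel" "\<And>\<xi>. cmod (m \<xi>) \<le> 1"
  shows "\<exists>g. is_product m f g"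
  by (rule is_product_exists[OF is_product_one assms(1)]) (simp add: assms(2))

text \<open>Multiplication by a possibly unbounded \<open>m\<close> is a closed operator. Multiplying by
  \<open>b = 1 / (1 + |m|)\<close> replaces the relation by one between the bounded multipliers
  \<open>b\<close> and \<open>b m\<close>, which passes to limits.\<close>
lemma is_product_closed:
  assumes m: "m \<in> borel_measurable borel" and prod: "\<And>k. is_product m (f k) (g k)"
    and f: "f \<longlonglongrightarrow> f'" and g: "g \<longlonglongrightarrow> g'"
  shows "is_product m f' g'"
proof -
  define b where "b \<xi> = complex_of_real (1 / (1 + cmod (m \<xi>)))" for \<xi>
  have [measurable]: "m \<in> borel_measurable borel" "b \<in> borel_measurable borel"
    using m by (auto simp: b_def[abs_def])
  have b1: "cmod (b \<xi>) \<le> 1" and b2: "cmod (b \<xi> * m \<xi>) \<le> 1" and b0: "b \<xi> \<noteq> 0" for \<xi>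
  proof -
    have pos: "1 + cmod (m \<xi>) > 0"
      by (simp add: add_pos_nonneg)
    then have "cmod (b \<xi>) = 1 / (1 + cmod (m \<xi>))"
      unfolding b_def norm_of_real by simp
    with pos show "cmod (b \<xi>) \<le> 1" "cmod (b \<xi> * m \<xi>) \<le> 1" "b \<xi> \<noteq> 0"
      by (auto simp: norm_mult)
  qed
  obtain x where x: "is_product b g' x"
    using is_product_bounded_exists[of b] b1 by auto
  have "\<exists>x. \<forall>k. is_product b (g k) (x k)"
    using is_product_bounded_exists[of b] b1 by (intro choice) auto
  then obtain xs where xs: "\<And>k. is_product b (g k) (xs k)"
    by blast
  have bm: "(\<lambda>\<xi>. b \<xi> * m \<xi>) \<in> borel_measurable borel"
    by measurable
  obtain y where y: "is_product (\<lambda>\<xi>. b \<xi> * m \<xi>) f' y"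
    using is_product_bounded_exists[OF bm b2] by auto
  have ys: "is_product (\<lambda>\<xi>. b \<xi> * m \<xi>) (f k) (xs k)" for k
    by (rule is_product_compose[OF prod xs])
  have "norm (xs k - x) \<le> norm (g k - g')" for k
    using is_product_norm_le[OF is_product_diff[OF xs x] is_product_one, of 1] b1 by simp
  moreover have "(\<lambda>k. norm (g k - g')) \<longlonglongrightarrow> 0"
    using tendsto_norm[OF LIM_zero[OF g]] by simp
  ultimately have limx: "xs \<longlonglongrightarrow> x"
    by (rule tendsto_of_norm_bound)
  have "norm (xs k - y) \<le> norm (f k - f')" for k
    using is_product_norm_le[OF is_product_diff[OF ys y] is_product_one, of 1] b2 by simp
  moreover have "(\<lambda>k. norm (f k - f')) \<longlonglongrightarrow> 0"
    using tendsto_norm[OF LIM_zero[OF f]] by simp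
  ultimately have "xs \<longlonglongrightarrow> y"
    by (rule tendsto_of_norm_bound)
  then have "x = y"
    using limx LIMSEQ_unique by blast
  then have "is_product (\<lambda>\<xi>. b \<xi> * m \<xi>) f' x"
    using y by simp
  with x show ?thesis
  proof (transfer fixing: m b)
    fix f g x :: "real \<Rightarrow> complex"
    assume "AE \<xi> in lborel. x \<xi> = b \<xi> * g \<xi>" "AE \<xi> in lborel. x \<xi> = b \<xi> * m \<xi> * f \<xi>"
    then show "AE \<xi> in lborel. g \<xi> = m \<xi> * f \<xi>"
    proof eventually_elim
      case (elim \<xi>)
      then have "b \<xi> * g \<xi> = b \<xi> * (m \<xi> * f \<xi>)"
        by (simp only: mult.assoc)
      then show ?case
        using b0[of \<xi>] by simp
    qed
  qed
qed

lemma is_product_strong_limit: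
  assumes m: "\<And>k. m k \<in> borel_measurable borel" "\<And>k \<xi>. cmod (m k \<xi>) \<le> 1" "\<And>\<xi>. (\<lambda>k. m k \<xi>) \<longlonglongrightarrow> 1"
    and prod: "\<And>k. is_product (m k) f (g k)"
  shows "g \<longlonglongrightarrow> f"
proof -
  obtain f0 where f: "square_integrable f0" "f = abs_l2 f0"
    by (rule abs_l2_cases)
  note [measurable] = m(1) square_integrable_measurable[OF f(1)]
  have sq: "square_integrable (\<lambda>\<xi>. m k \<xi> * f0 \<xi>)" for k
    by (rule square_integrable_dominated[OF _ f(1)]) (auto simp: norm_mult m(2) mult_left_le_one_le)
  have "g = (\<lambda>k. abs_l2 (\<lambda>\<xi>. m k \<xi> * f0 \<xi>))"
  proof
    fix k
    show "g k = abs_l2 (\<lambda>\<xi>. m k \<xi> * f0 \<xi>)"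
      using f sq by (intro is_product_unique[OF prod]) (simp add: is_product_abs)
  qed
  moreover have "(\<lambda>k. abs_l2 (\<lambda>\<xi>. m k \<xi> * f0 \<xi>)) \<longlonglongrightarrow> f"
    unfolding f(2)
  proof (rule abs_l2_dominated_convergence(2)[OF _ _ f(1)])
    have "(\<lambda>k. m k \<xi> * f0 \<xi>) \<longlonglongrightarrow> 1 * f0 \<xi>" for \<xi>
      by (intro tendsto_intros m(3))
    then show "AE \<xi> in lborel. (\<lambda>k. m k \<xi> * f0 \<xi>) \<longlonglongrightarrow> f0 \<xi>"
      by simp
  qed (auto simp: norm_mult m(2) mult_left_le_one_le)
  ultimately show ?thesis
    by simp
qed

lemma is_product_skew:
  assumes "is_product m f g" "is_product m f' g'" "\<And>\<xi>. cnj (m \<xi>) = - m \<xi>"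
  shows "f \<bullet> g' = - (g \<bullet> f')"
proof -
  obtain f0 where f: "square_integrable f0" "f = abs_l2 f0"
    by (rule abs_l2_cases)
  obtain g0 where g: "square_integrable g0" "g = abs_l2 g0"
    by (rule abs_l2_cases)
  obtain f1 where f': "square_integrable f1" "f' = abs_l2 f1"
    by (rule abs_l2_cases)
  obtain g1 where g': "square_integrable g1" "g' = abs_l2 g1"
    by (rule abs_l2_cases)
  have "AE \<xi> in lborel. g0 \<xi> = m \<xi> * f0 \<xi>" "AE \<xi> in lborel. g1 \<xi> = m \<xi> * f1 \<xi>"
    using assms(1,2) f g f' g' by (simp_all add: is_product_abs)
  then have "AE \<xi> in lborel. f0 \<xi> \<bullet> g1 \<xi> = - (g0 \<xi> \<bullet> f1 \<xi>)"
  proof eventually_elim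
    case (elim \<xi>)
    have "f0 \<xi> \<bullet> g1 \<xi> = Re (f0 \<xi> * cnj (m \<xi> * f1 \<xi>))"
      by (simp only: elim Re_mult_cnj_eq_inner)
    also have "f0 \<xi> * cnj (m \<xi> * f1 \<xi>) = - (m \<xi> * f0 \<xi> * cnj (f1 \<xi>))"
      by (simp add: assms(3))
    also have "Re \<dots> = - (g0 \<xi> \<bullet> f1 \<xi>)"
      by (simp only: uminus_complex.sel Re_mult_cnj_eq_inner elim)
    finally show ?case .
  qed
  then have "(\<integral>\<xi>. f0 \<xi> \<bullet> g1 \<xi> \<partial>lborel) = (\<integral>\<xi>. - (g0 \<xi> \<bullet> f1 \<xi>) \<partial>lborel)"
    using f g f' g' by (intro integral_cong_AE) (auto simp: square_integrable_def)
  then show ?thesis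
    by (simp add: f g f' g' abs_l2_inner)
qed

text \<open>The graph of the Fourier multiplier with symbol \<open>m\<close>. Working with the graph avoids
  the default values that \<open>fourier_multiplier\<close> takes outside its domain.\<close>
definition multiplies :: "(real \<Rightarrow> complex) \<Rightarrow> l2 \<Rightarrow> l2 \<Rightarrow> bool" where
  "multiplies m u w \<longleftrightarrow> is_product m (fourier u) (fourier w)"

lemma multiplies_exists:
  "is_product m (fourier u) g \<Longrightarrow> multiplies m u (inverse_fourier g)"
  by (simp add: multiplies_def fourier_inverse_fourier)

lemma multiplies_unique: "multiplies m u w \<Longrightarrow> multiplies m u w' \<Longrightarrow> w = w'"
  unfolding multiplies_def using is_product_unique fourier_inject by blast

lemma fourier_multiplier_eq:
  assumes "multiplies m u w"
  shows "fourier_multiplier m u = w"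
  unfolding fourier_multiplier_def multiplies_def[symmetric]
  using assms multiplies_unique[OF _ assms] by (rule the_equality)

section \<open>Weak differentiation as a Fourier multiplier\<close>

lemma square_integrable_compact_support:
  fixes f :: "real \<Rightarrow> complex"
  assumes "continuous_on UNIV f" "\<And>x. R \<le> \<bar>x\<bar> \<Longrightarrow> f x = 0"
  shows "square_integrable f"
proof -
  have "compact (f ` {-R..R})"
    by (intro compact_continuous_image continuous_on_subset[OF assms(1)]) auto
  from compact_imp_bounded[OF this] obtain B where B: "\<And>x. x \<in> {-R..R} \<Longrightarrow> cmod (f x) \<le> B"
    unfolding bounded_iff by blast
  show ?thesis
  proof (rule square_integrable_dominated[OF _ square_integrable_interval[of "of_real B" "-R" R]])
    show "f \<in> borel_measurable borel"
      by (rule borel_measurable_continuous_onI[OF assms(1)])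
    have "cmod (f x) \<le> cmod (of_real B * indicator {-R..R} x)" for x
    proof (cases "x \<in> {-R..R}")
      case True
      then show ?thesis
        using B[OF True] by simp
    next
      case False
      then have "R \<le> \<bar>x\<bar>"
        by auto
      with assms(2) show ?thesis
        by simp
    qed
    then show "AE x in lborel. cmod (f x) \<le> cmod (of_real B * indicator {-R..R} x)"
      by simp
  qed
qed

lemma has_vector_derivative_cis:
  "((\<lambda>x. cis (- (x * \<xi>))) has_vector_derivative - (\<i> * of_real \<xi>) * cis (- (x * \<xi>))) (at x within S)"
proof -
  have "((\<lambda>z. exp (- (\<i> * (z * of_real \<xi>)))) has_field_derivative
      - (\<i> * of_real \<xi>) * exp (- (\<i> * (of_real x * of_real \<xi>)))) (at (of_real x))"
    by (auto intro!: derivative_eq_intros)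
  from has_vector_derivative_real_field[OF this] show ?thesis
    by (simp add: cis_conv_exp)
qed

lemma fourier_windowed:
  assumes "window R u = u"
  shows "fourier u = window_transform R u"
proof (rule fourier_eqI)
  have "eventually (\<lambda>S. window_transform R u = window_transform S u) at_top"
    using eventually_ge_at_top[of R]
  proof eventually_elim
    case (elim S)
    then show ?case
      using window_transform_window[of S R u] assms by (simp add: min_absorb2)
  qed
  then show "((\<lambda>S. window_transform S u) \<longlongrightarrow> window_transform R u) at_top"
    by (rule Lim_transform_eventually[OF tendsto_const])
qed

lemma window_supported:
  assumes "square_integrable f" "\<And>x. R \<le> \<bar>x\<bar> \<Longrightarrow> f x = 0"
  shows "window R (abs_l2 f) = abs_l2 f"
proof -
  have "(\<lambda>x. indicator {-R..R} x * f x) = f"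
  proof
    fix x
    show "indicator {-R..R} x * f x = f x"
      using assms(2)[of x] by (cases "x \<in> {-R..R}") auto
  qed
  then show ?thesis
    by (simp add: window_abs assms(1))
qed

lemma multiplies_supported:
  assumes f: "square_integrable f" "\<And>x. R \<le> \<bar>x\<bar> \<Longrightarrow> f x = 0"
    and g: "square_integrable g" "\<And>x. R \<le> \<bar>x\<bar> \<Longrightarrow> g x = 0"
    and eq: "\<And>\<xi>. truncated_fourier g R \<xi> = m \<xi> * truncated_fourier f R \<xi>"
  shows "multiplies m (abs_l2 f) (abs_l2 g)"
proof -
  have "fourier (abs_l2 h) = abs_l2 (truncated_fourier h R)"
    if "square_integrable h" "\<And>x. R \<le> \<bar>x\<bar> \<Longrightarrow> h x = 0" for h
  proof -
    have "fourier (abs_l2 h) = window_transform R (abs_l2 h)"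
      by (intro fourier_windowed window_supported that)
    then show ?thesis
      by (simp only: window_transform_def window_fourier_abs that(1))
  qed
  then have "fourier (abs_l2 f) = abs_l2 (truncated_fourier f R)" "fourier (abs_l2 g) = abs_l2 (truncated_fourier g R)"
    using f g by blast+
  moreover have "square_integrable (truncated_fourier f R)" "square_integrable (truncated_fourier g R)"
    using square_integrable_window_fourier[of "abs_l2 f" R] square_integrable_window_fourier[of "abs_l2 g" R]
    by (simp_all add: window_fourier_abs f g)
  ultimately show ?thesis
    by (simp add: multiplies_def is_product_abs eq)
qed

text \<open>Integration by parts; the boundary terms vanish.\<close>
lemma truncated_fourier_derivative:
  fixes f f' :: "real \<Rightarrow> complex"
  assumes R: "R \<ge> 0" and deriv: "\<And>x. (f has_vector_derivative f' x) (at x)"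
    and cont: "continuous_on UNIV f'" and zero: "f (- R) = 0" "f R = 0"
  shows "truncated_fourier f' R \<xi> = \<i> * of_real \<xi> * truncated_fourier f R \<xi>"
proof -
  have contf: "continuous_on UNIV f"
    by (intro continuous_at_imp_continuous_on ballI has_vector_derivative_continuous[OF deriv])
  let ?e = "\<lambda>x. cis (- (x * \<xi>))"
  let ?I = "\<lambda>g. (\<integral>x. indicator {-R..R} x *\<^sub>R (g x * ?e x) \<partial>lborel)"
  have int: "integrable lborel (\<lambda>x. indicator {-R..R} x *\<^sub>R (g x * ?e x))" if "continuous_on UNIV g" for g
  proof -
    have "set_integrable lborel {-R..R} (\<lambda>x. g x * ?e x)"
      by (intro borel_integrable_atLeastAtMost' continuous_intros continuous_on_subset[OF that]) auto
    then show ?thesis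
      by (simp only: set_integrable_def)
  qed
  have "(\<integral>x. indicator {-R..R} x *\<^sub>R (f' x * ?e x - \<i> * of_real \<xi> * (f x * ?e x)) \<partial>lborel)
      = f R * ?e R - f (- R) * ?e (- R)"
  proof (rule integral_FTC_atLeastAtMost)
    fix x
    have "((\<lambda>x. f x * ?e x) has_vector_derivative f x * (- (\<i> * of_real \<xi>) * ?e x) + f' x * ?e x) (at x within {-R..R})"
      by (rule has_vector_derivative_mult[OF has_vector_derivative_at_within[OF deriv] has_vector_derivative_cis])
    moreover have "f x * (- (\<i> * of_real \<xi>) * ?e x) + f' x * ?e x = f' x * ?e x - \<i> * of_real \<xi> * (f x * ?e x)"
      by (simp add: algebra_simps)
    ultimately show "((\<lambda>x. f x * ?e x) has_vector_derivative (f' x * ?e x - \<i> * of_real \<xi> * (f x * ?e x)))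
        (at x within {-R..R})"
      by (simp only:)
  next
    show "continuous_on {-R..R} (\<lambda>x. f' x * ?e x - \<i> * of_real \<xi> * (f x * ?e x))"
      by (intro continuous_intros continuous_on_subset[OF cont] continuous_on_subset[OF contf]) auto
  qed (use R in simp)
  also have "(\<integral>x. indicator {-R..R} x *\<^sub>R (f' x * ?e x - \<i> * of_real \<xi> * (f x * ?e x)) \<partial>lborel)
      = (\<integral>x. indicator {-R..R} x *\<^sub>R (f' x * ?e x) - \<i> * of_real \<xi> * (indicator {-R..R} x *\<^sub>R (f x * ?e x)) \<partial>lborel)"
    by (intro Bochner_Integration.integral_cong refl) (simp add: indicator_def)
  also have "\<dots> = ?I f' - \<i> * of_real \<xi> * ?I f"
    unfolding integral_mult_right_zero[symmetric]
    by (intro Bochner_Integration.integral_diff integrable_mult_right int cont contf)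
  finally show ?thesis
    by (simp add: truncated_fourier_def zero)
qed

abbreviation derivative_symbol :: "real \<Rightarrow> complex" where
  "derivative_symbol \<xi> \<equiv> \<i> * of_real \<xi>"

lemma multiplies_classical_derivative:
  fixes f f' :: "real \<Rightarrow> complex"
  assumes deriv: "\<And>x. (f has_vector_derivative f' x) (at x)" and cont: "continuous_on UNIV f'"
    and zero: "\<And>x. R \<le> \<bar>x\<bar> \<Longrightarrow> f x = 0" "\<And>x. R \<le> \<bar>x\<bar> \<Longrightarrow> f' x = 0" and R: "R \<ge> 0"
  shows "square_integrable f" "square_integrable f'" "multiplies derivative_symbol (abs_l2 f) (abs_l2 f')"
proof -
  have contf: "continuous_on UNIV f"
    by (intro continuous_at_imp_continuous_on ballI has_vector_derivative_continuous[OF deriv])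
  show f: "square_integrable f"
    by (rule square_integrable_compact_support[OF contf zero(1)])
  show f': "square_integrable f'"
    by (rule square_integrable_compact_support[OF cont zero(2)])
  show "multiplies derivative_symbol (abs_l2 f) (abs_l2 f')"
  proof (rule multiplies_supported[OF f zero(1) f' zero(2)])
    have "f (- R) = 0" "f R = 0"
      using R by (simp_all add: zero(1))
    then show "truncated_fourier f' R \<xi> = derivative_symbol \<xi> * truncated_fourier f R \<xi>" for \<xi>
      by (rule truncated_fourier_derivative[OF R deriv cont])
  qed
qed

lemma test_function_derivative:
  assumes "test_function \<phi>"
  obtains R where "R \<ge> 0" "\<And>x. (\<phi> has_vector_derivative vector_derivative \<phi> (at x)) (at x)"
    "continuous_on UNIV (\<lambda>x. vector_derivative \<phi> (at x))"
    "\<And>x. R \<le> \<bar>x\<bar> \<Longrightarrow> \<phi> x = 0" "\<And>x. R \<le> \<bar>x\<bar> \<Longrightarrow> vector_derivative \<phi> (at x) = 0"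
proof -
  let ?K = "closure {x. \<phi> x \<noteq> 0}"
  have C1: "\<phi> C1_differentiable_on UNIV" and K: "compact ?K"
    using assms by (auto simp: test_function_def)
  obtain B where B: "\<And>x. x \<in> ?K \<Longrightarrow> \<bar>x\<bar> \<le> B"
    using compact_imp_bounded[OF K] by (auto simp: bounded_iff)
  define R where "R = \<bar>B\<bar> + 1"
  have deriv: "(\<phi> has_vector_derivative vector_derivative \<phi> (at x)) (at x)" for x
    using C1 by (auto simp: C1_differentiable_on_eq vector_derivative_works)
  have out: "x \<notin> ?K" if "R \<le> \<bar>x\<bar>" for x
    using B[of x] that by (auto simp: R_def)
  then have zero: "\<phi> x = 0" if "R \<le> \<bar>x\<bar>" for x
    using that closure_subset[of "{x. \<phi> x \<noteq> 0}"] by blast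
  have zero': "vector_derivative \<phi> (at x) = 0" if "R \<le> \<bar>x\<bar>" for x
  proof (rule vector_derivative_at, rule has_vector_derivative_transform_within_open)
    show "((\<lambda>y. 0) has_vector_derivative 0) (at x)"
      by (rule has_vector_derivative_const)
    show "open (- ?K)"
      by (intro open_Compl closed_closure)
    show "x \<in> - ?K"
      using out[OF that] by simp
    show "0 = \<phi> y" if "y \<in> - ?K" for y
      using that closure_subset[of "{x. \<phi> x \<noteq> 0}"] by auto
  qed
  have cont: "continuous_on UNIV (\<lambda>x. vector_derivative \<phi> (at x))"
    using C1 by (simp add: C1_differentiable_on_eq)
  have "R \<ge> 0"
    by (simp add: R_def)
  then show ?thesis
    using deriv cont zero zero' by (rule that)
qed

lemma has_weak_deriv_abs:
  "square_integrable f \<Longrightarrow> square_integrable g \<Longrightarrow> has_weak_deriv (abs_l2 f) (abs_l2 g) \<longleftrightarrow>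
    (\<forall>\<phi>. test_function \<phi> \<longrightarrow>
     (\<integral>x. f x * vector_derivative \<phi> (at x) \<partial>lborel) = - (\<integral>x. g x * \<phi> x \<partial>lborel))"
  by (simp add: has_weak_deriv.abs_eq ae_eq_self_iff)

text \<open>Test functions have classical derivatives, so the transform of their derivative is known.
  Isometry and skew-symmetry of multiplication by \<open>i \<xi>\<close> then move the derivative onto
  \<open>u\<close>.\<close>
lemma has_weak_deriv_if_multiplies:
  assumes "multiplies derivative_symbol u w"
  shows "has_weak_deriv u w"
proof -
  obtain f where f: "square_integrable f" "u = abs_l2 f"
    by (rule abs_l2_cases)
  obtain g where g: "square_integrable g" "w = abs_l2 g"
    by (rule abs_l2_cases)
  have "(\<integral>x. f x * vector_derivative \<phi> (at x) \<partial>lborel) = - (\<integral>x. g x * \<phi> x \<partial>lborel)"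
    if test: "test_function \<phi>" for \<phi>
  proof -
    obtain R where R: "R \<ge> 0" and deriv: "\<And>x. (\<phi> has_vector_derivative vector_derivative \<phi> (at x)) (at x)"
      and cont: "continuous_on UNIV (\<lambda>x. vector_derivative \<phi> (at x))"
      and zero: "\<And>x. R \<le> \<bar>x\<bar> \<Longrightarrow> \<phi> x = 0" "\<And>x. R \<le> \<bar>x\<bar> \<Longrightarrow> vector_derivative \<phi> (at x) = 0"
      using test_function_derivative[OF test] by blast
    let ?d = "\<lambda>x. vector_derivative \<phi> (at x)"
    have sq: "square_integrable \<phi>" "square_integrable ?d"
      using multiplies_classical_derivative[OF deriv cont zero R] by blast+
    \<comment> \<open>The real inner product only sees real parts; the factor \<open>c\<close> recovers the imaginary part.\<close>
    have re: "Re (c * (\<integral>x. f x * ?d x \<partial>lborel)) = Re (c * - (\<integral>x. g x * \<phi> x \<partial>lborel))" for c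
    proof -
      let ?p = "\<lambda>x. cnj (c * \<phi> x)" and ?q = "\<lambda>x. cnj (c * ?d x)"
      have "(?p has_vector_derivative ?q x) (at x)" for x
        by (intro bounded_linear.has_vector_derivative[OF bounded_linear_cnj]
            bounded_linear.has_vector_derivative[OF bounded_linear_mult_right] deriv)
      moreover have "continuous_on UNIV ?q"
        by (intro continuous_intros cont)
      ultimately have sq': "square_integrable ?p" "square_integrable ?q"
        and mult: "multiplies derivative_symbol (abs_l2 ?p) (abs_l2 ?q)"
        using multiplies_classical_derivative[of ?p ?q R] zero R by auto
      have "u \<bullet> abs_l2 ?q = - (w \<bullet> abs_l2 ?p)"
        using is_product_skew[OF assms[unfolded multiplies_def] mult[unfolded multiplies_def]]
        by (simp add: fourier_inner)
      then have "u \<bullet> cnj_l2 (abs_l2 (\<lambda>x. c * ?d x)) = - (w \<bullet> cnj_l2 (abs_l2 (\<lambda>x. c * \<phi> x)))"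
        by (simp add: abs_l2_cnj square_integrable_scale sq)
      then have "Re (\<integral>x. f x * (c * ?d x) \<partial>lborel) = - Re (\<integral>x. g x * (c * \<phi> x) \<partial>lborel)"
        unfolding f(2) g(2) abs_l2_inner_cnj[OF f(1) square_integrable_scale[OF sq(2)]]
          abs_l2_inner_cnj[OF g(1) square_integrable_scale[OF sq(1)]] .
      then show ?thesis
        by (simp add: mult.left_commute[of _ c])
    qed
    show ?thesis
      using re[of 1] re[of "- \<i>"] by (simp add: complex_eq_iff)
  qed
  then show ?thesis
    by (simp add: has_weak_deriv_abs f g)
qed

text \<open>The difference quotient deviates from \<open>2 max 0 y\<close> by at most \<open>|h|\<close>, whatever
  the signs of \<open>y\<close> and \<open>y + h\<close>.\<close>
lemma has_real_derivative_pos_part_squared: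
  "((\<lambda>y::real. (max 0 y)\<^sup>2) has_real_derivative 2 * max 0 y) (at y)"
proof -
  have bound: "\<bar>((max 0 (y + h))\<^sup>2 - (max 0 y)\<^sup>2) / h - 2 * max 0 y\<bar> \<le> \<bar>h\<bar>" if "h \<noteq> 0" for h
  proof -
    have "\<bar>(max 0 (y + h))\<^sup>2 - (max 0 y)\<^sup>2 - 2 * max 0 y * h\<bar> \<le> h\<^sup>2"
    proof (cases "y \<ge> 0"; cases "y + h \<ge> 0")
      assume "y \<ge> 0" "y + h \<ge> 0"
      then show ?thesis
        by (simp add: max_def power2_eq_square algebra_simps)
    next
      assume *: "y \<ge> 0" "\<not> y + h \<ge> 0"
      then have "(y + h)\<^sup>2 \<le> h\<^sup>2"
        by (intro power2_mono) auto
      moreover have "(max 0 (y + h))\<^sup>2 - (max 0 y)\<^sup>2 - 2 * max 0 y * h = h\<^sup>2 - (y + h)\<^sup>2"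
        using * by (simp add: max_def power2_eq_square algebra_simps)
      ultimately show ?thesis
        by simp
    next
      assume *: "\<not> y \<ge> 0" "y + h \<ge> 0"
      then have "(y + h)\<^sup>2 \<le> h\<^sup>2"
        by (intro power_mono) auto
      then show ?thesis
        using * by (simp add: max_def)
    next
      assume "\<not> y \<ge> 0" "\<not> y + h \<ge> 0"
      then show ?thesis
        by (simp add: max_def)
    qed
    moreover have "((max 0 (y + h))\<^sup>2 - (max 0 y)\<^sup>2) / h - 2 * max 0 y
        = ((max 0 (y + h))\<^sup>2 - (max 0 y)\<^sup>2 - 2 * max 0 y * h) / h"
      using that by (simp add: field_simps)
    ultimately show ?thesis
      using that by (simp add: divide_le_eq power2_eq_square abs_mult_self_eq flip: abs_mult)
  qed
  have "((\<lambda>h. \<bar>h\<bar>) \<longlongrightarrow> 0) (at (0::real))"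
    by (intro tendsto_eq_intros) auto
  then have "((\<lambda>h. ((max 0 (y + h))\<^sup>2 - (max 0 y)\<^sup>2) / h - 2 * max 0 y) \<longlongrightarrow> 0) (at 0)"
    by (rule Lim_null_comparison[rotated]) (use bound in \<open>auto simp: eventually_at_filter\<close>)
  then show ?thesis
    unfolding DERIV_def by (rule LIM_zero_cancel)
qed

text \<open>A cutoff with exactly the regularity that \<open>test_function\<close> requires. Its value 1 at the
  origin makes the stretched cutoffs tend to 1 everywhere.\<close>
definition bump :: "real \<Rightarrow> real" where
  "bump x = (max 0 (1 - x\<^sup>2))\<^sup>2"

definition bump_deriv :: "real \<Rightarrow> real" where
  "bump_deriv x = - 4 * x * max 0 (1 - x\<^sup>2)"

lemma bump_has_real_derivative:
  "((\<lambda>x. bump (x / N)) has_real_derivative bump_deriv (x / N) / N) (at x)"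
proof -
  have "((\<lambda>x. 1 - (x / N)\<^sup>2) has_real_derivative - (2 * (x / N) / N)) (at x)"
    by (cases "N = 0") (auto intro!: derivative_eq_intros simp: power2_eq_square)
  from DERIV_chain'[OF this has_real_derivative_pos_part_squared] show ?thesis
    by (simp add: bump_def bump_deriv_def mult_ac)
qed

lemma bump_bounds: "\<bar>bump x\<bar> \<le> 1" "\<bar>bump_deriv x\<bar> \<le> 4"
proof -
  have m: "0 \<le> max 0 (1 - x\<^sup>2)" "max 0 (1 - x\<^sup>2) \<le> 1"
    by auto
  then show "\<bar>bump x\<bar> \<le> 1"
    by (simp add: bump_def power_le_one)
  have "\<bar>x\<bar> * max 0 (1 - x\<^sup>2) \<le> 1"
  proof (cases "\<bar>x\<bar> \<le> 1")
    case True
    then show ?thesis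
      using m by (simp add: mult_le_one)
  next
    case False
    then have "1 < x\<^sup>2"
      by (simp add: abs_square_le_1 not_le[symmetric])
    then show ?thesis
      by (simp add: max_def)
  qed
  moreover have "\<bar>bump_deriv x\<bar> = 4 * (\<bar>x\<bar> * max 0 (1 - x\<^sup>2))"
    by (simp add: bump_deriv_def abs_mult)
  ultimately show "\<bar>bump_deriv x\<bar> \<le> 4"
    by linarith
qed

lemma bump_support: "1 \<le> \<bar>x\<bar> \<Longrightarrow> bump x = 0" "1 \<le> \<bar>x\<bar> \<Longrightarrow> bump_deriv x = 0"
  using abs_le_square_iff[of 1 x] by (simp_all add: bump_def bump_deriv_def max_def)

lemma continuous_bump: "continuous_on UNIV bump" "continuous_on UNIV bump_deriv"
  unfolding bump_def[abs_def] bump_deriv_def[abs_def] by (intro continuous_intros)+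

lemma bump_scaled_tendsto:
  "(\<lambda>k. bump (x / real (Suc k))) \<longlonglongrightarrow> 1"
  "(\<lambda>k. bump_deriv (x / real (Suc k)) / real (Suc k)) \<longlonglongrightarrow> 0"
proof -
  have N: "filterlim (\<lambda>k. real (Suc k)) at_infinity sequentially"
    by (intro filterlim_at_top_imp_at_infinity filterlim_compose[OF filterlim_real_sequentially] filterlim_Suc)
  have x: "(\<lambda>k. x / real (Suc k)) \<longlonglongrightarrow> 0"
    by (rule tendsto_divide_0[OF tendsto_const N])
  have "isCont bump 0" "isCont bump_deriv 0"
    using continuous_bump by (auto simp: continuous_on_eq_continuous_at)
  from this[THEN isCont_tendsto_compose, OF x]
  have b: "(\<lambda>k. bump (x / real (Suc k))) \<longlonglongrightarrow> bump 0"
    and d: "(\<lambda>k. bump_deriv (x / real (Suc k))) \<longlonglongrightarrow> bump_deriv 0"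
    by auto
  show "(\<lambda>k. bump (x / real (Suc k))) \<longlonglongrightarrow> 1"
    using b by (simp add: bump_def)
  show "(\<lambda>k. bump_deriv (x / real (Suc k)) / real (Suc k)) \<longlonglongrightarrow> 0"
    by (rule tendsto_divide_0[OF d N])
qed

lemma measurable_bump [measurable]: "bump \<in> borel_measurable borel" "bump_deriv \<in> borel_measurable borel"
  by (intro borel_measurable_continuous_onI continuous_bump)+

text \<open>Testing against the cutoff exponentials \<open>bump (x / N) exp (- i x \<xi>)\<close> says exactly
  that the transform of \<open>b g + d f\<close> is \<open>i \<xi>\<close> times the transform of
  \<open>b f\<close>, where \<open>b\<close> is the scaled cutoff and \<open>d\<close> its derivative. As \<open>N\<close>
  grows, \<open>b f\<close> tends to \<open>f\<close>, \<open>b g\<close> to \<open>g\<close> and \<open>d f\<close> to 0;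
  closedness of multiplication by \<open>i \<xi>\<close> gives the claim.\<close>
lemma multiplies_if_has_weak_deriv:
  assumes "has_weak_deriv u w"
  shows "multiplies derivative_symbol u w"
proof -
  obtain f where f: "square_integrable f" "u = abs_l2 f"
    by (rule abs_l2_cases)
  obtain g where g: "square_integrable g" "w = abs_l2 g"
    by (rule abs_l2_cases)
  note [measurable] = square_integrable_measurable[OF f(1)] square_integrable_measurable[OF g(1)]
  \<comment> \<open>The shift by one keeps the scale positive.\<close>
  define N where "N k = real (Suc k)" for k
  have N: "N k > 0" "N k \<ge> 1" for k
    by (simp_all add: N_def)
  define b where "b k x = complex_of_real (bump (x / N k))" for k x
  define d where "d k x = complex_of_real (bump_deriv (x / N k) / N k)" for k x
  have [measurable]: "b k \<in> borel_measurable borel" "d k \<in> borel_measurable borel" for k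
    unfolding b_def[abs_def] d_def[abs_def] by measurable
  have bN: "cmod (b k x) \<le> 1" and dN: "cmod (d k x) \<le> 4" for k x
  proof -
    show "cmod (b k x) \<le> 1"
      using bump_bounds(1) by (simp add: b_def)
    have "\<bar>bump_deriv (x / N k)\<bar> \<le> 4 * N k"
      using bump_bounds(2)[of "x / N k"] N(2)[of k] by linarith
    then show "cmod (d k x) \<le> 4"
      using N(1)[of k] by (simp add: d_def norm_divide divide_le_eq)
  qed
  have supp: "b k x = 0" "d k x = 0" if "N k \<le> \<bar>x\<bar>" for k x
  proof -
    have "1 \<le> \<bar>x / N k\<bar>"
      using that N(1)[of k] by simp
    then show "b k x = 0" "d k x = 0"
      by (simp_all add: b_def d_def bump_support)
  qed
  have contb: "continuous_on UNIV (b k)" and contd: "continuous_on UNIV (d k)" for k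
    unfolding b_def[abs_def] d_def[abs_def] using N(1)[of k]
    by (auto intro!: continuous_intros continuous_on_compose2[OF continuous_bump(1)]
        continuous_on_compose2[OF continuous_bump(2)])
  have derivb: "(b k has_vector_derivative d k x) (at x)" for k x
    unfolding b_def[abs_def] d_def
    by (intro has_vector_derivative_of_real)
      (rule bump_has_real_derivative)
  have sq: "square_integrable (\<lambda>x. b k x * h x)" "square_integrable (\<lambda>x. d k x * h x)"
    if h: "square_integrable h" for k h
  proof -
    note [measurable] = square_integrable_measurable[OF h]
    show "square_integrable (\<lambda>x. b k x * h x)"
      using bN by (intro square_integrable_dominated[OF _ h]) (auto simp: norm_mult mult_left_le_one_le)
    show "square_integrable (\<lambda>x. d k x * h x)"
      using dN by (intro square_integrable_dominated[OF _ square_integrable_scale[OF h, of 4]])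
        (auto simp: norm_mult mult_right_mono)
  qed
  have mult: "multiplies derivative_symbol (abs_l2 (\<lambda>x. b k x * f x)) (abs_l2 (\<lambda>x. b k x * g x + d k x * f x))" for k
  proof (rule multiplies_supported)
    show "square_integrable (\<lambda>x. b k x * f x)" "square_integrable (\<lambda>x. b k x * g x + d k x * f x)"
      by (intro square_integrable_add sq f g)+
    show "b k x * f x = 0" "b k x * g x + d k x * f x = 0" if "N k \<le> \<bar>x\<bar>" for x
      using supp[OF that] by simp_all
    fix \<xi>
    let ?e = "\<lambda>x. cis (- (x * \<xi>))"
    define \<phi> where "\<phi> x = b k x * ?e x" for x
    define \<psi> where "\<psi> x = d k x * ?e x" for x
    have deriv: "(\<phi> has_vector_derivative \<psi> x - derivative_symbol \<xi> * \<phi> x) (at x)" for x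
      using has_vector_derivative_mult[OF derivb has_vector_derivative_cis[of \<xi> x UNIV], of k]
      unfolding \<phi>_def[abs_def] \<psi>_def by (simp add: algebra_simps)
    have cont\<phi>: "continuous_on UNIV \<phi>" and cont\<psi>: "continuous_on UNIV \<psi>"
      unfolding \<phi>_def[abs_def] \<psi>_def[abs_def] by (intro continuous_intros contb contd)+
    have "{x. \<phi> x \<noteq> 0} \<subseteq> {- N k..N k}"
    proof
      fix x assume "x \<in> {x. \<phi> x \<noteq> 0}"
      then have "\<not> N k \<le> \<bar>x\<bar>"
        using supp(1)[of k x] by (auto simp: \<phi>_def)
      then show "x \<in> {- N k..N k}"
        by auto
    qed
    then have "bounded {x. \<phi> x \<noteq> 0}"
      using bounded_closed_interval bounded_subset by blast
    then have "test_function \<phi>"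
      unfolding test_function_def C1_differentiable_on_def compact_closure
      using deriv by (intro conjI exI[of _ "\<lambda>x. \<psi> x - derivative_symbol \<xi> * \<phi> x"])
        (auto intro!: continuous_intros cont\<phi> cont\<psi>)
    then have "(\<integral>x. f x * vector_derivative \<phi> (at x) \<partial>lborel) = - (\<integral>x. g x * \<phi> x \<partial>lborel)"
      using assms[unfolded f(2) g(2) has_weak_deriv_abs[OF f(1) g(1)]] by blast
    then have weak: "(\<integral>x. f x * (\<psi> x - derivative_symbol \<xi> * \<phi> x) \<partial>lborel) = - (\<integral>x. g x * \<phi> x \<partial>lborel)"
      by (simp only: vector_derivative_at[OF deriv])
    have sq\<phi>: "square_integrable \<phi>" and sq\<psi>: "square_integrable \<psi>"
      using supp by (auto intro!: square_integrable_compact_support[OF cont\<phi>, of "N k"]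
          square_integrable_compact_support[OF cont\<psi>, of "N k"] simp: \<phi>_def \<psi>_def)
    have int: "integrable lborel (\<lambda>x. f x * \<psi> x)" "integrable lborel (\<lambda>x. f x * \<phi> x)"
      "integrable lborel (\<lambda>x. g x * \<phi> x)"
      by (intro square_integrable_mult f g sq\<phi> sq\<psi>)+
    have "(\<integral>x. f x * (\<psi> x - derivative_symbol \<xi> * \<phi> x) \<partial>lborel)
        = (\<integral>x. f x * \<psi> x - derivative_symbol \<xi> * (f x * \<phi> x) \<partial>lborel)"
      by (intro Bochner_Integration.integral_cong refl) (simp add: algebra_simps)
    also have "\<dots> = (\<integral>x. f x * \<psi> x \<partial>lborel) - derivative_symbol \<xi> * (\<integral>x. f x * \<phi> x \<partial>lborel)"
      unfolding integral_mult_right_zero[symmetric]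
      by (intro Bochner_Integration.integral_diff integrable_mult_right int)
    finally have weak': "(\<integral>x. g x * \<phi> x \<partial>lborel) + (\<integral>x. f x * \<psi> x \<partial>lborel)
        = derivative_symbol \<xi> * (\<integral>x. f x * \<phi> x \<partial>lborel)"
      using weak by (simp add: algebra_simps)
    have ind: "indicator {- N k..N k} x *\<^sub>R z = (z :: complex)" if "N k \<le> \<bar>x\<bar> \<Longrightarrow> z = 0" for x z
      using that by (cases "x \<in> {- N k..N k}") auto
    have "(\<integral>x. indicator {- N k..N k} x *\<^sub>R (b k x * f x * ?e x) \<partial>lborel) = (\<integral>x. f x * \<phi> x \<partial>lborel)"
      by (intro Bochner_Integration.integral_cong refl, subst ind) (auto simp: \<phi>_def supp mult_ac)
    moreover have "(\<integral>x. indicator {- N k..N k} x *\<^sub>R ((b k x * g x + d k x * f x) * ?e x) \<partial>lborel)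
        = (\<integral>x. g x * \<phi> x + f x * \<psi> x \<partial>lborel)"
      by (intro Bochner_Integration.integral_cong refl, subst ind) (auto simp: \<phi>_def \<psi>_def supp algebra_simps)
    moreover have "\<dots> = (\<integral>x. g x * \<phi> x \<partial>lborel) + (\<integral>x. f x * \<psi> x \<partial>lborel)"
      by (intro Bochner_Integration.integral_add int)
    ultimately show "truncated_fourier (\<lambda>x. b k x * g x + d k x * f x) (N k) \<xi>
        = derivative_symbol \<xi> * truncated_fourier (\<lambda>x. b k x * f x) (N k) \<xi>"
      unfolding truncated_fourier_def by (simp add: weak')
  qed
  have limb: "(\<lambda>k. b k x) \<longlonglongrightarrow> 1" and limd: "(\<lambda>k. d k x) \<longlonglongrightarrow> 0" for x
    using tendsto_of_real[OF bump_scaled_tendsto(1)[of x], where 'a = complex]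
      tendsto_of_real[OF bump_scaled_tendsto(2)[of x], where 'a = complex]
    by (simp_all only: b_def d_def N_def of_real_0 of_real_1)
  have cut: "(\<lambda>k. abs_l2 (\<lambda>x. b k x * h x)) \<longlonglongrightarrow> abs_l2 h" if h: "square_integrable h" for h
  proof (rule abs_l2_dominated_convergence(2)[OF _ _ h])
    note [measurable] = square_integrable_measurable[OF h]
    show "(\<lambda>x. b k x * h x) \<in> borel_measurable borel" "h \<in> borel_measurable borel" for k
      by measurable
    have "(\<lambda>k. b k x * h x) \<longlonglongrightarrow> 1 * h x" for x
      by (intro tendsto_intros limb)
    then show "AE x in lborel. (\<lambda>k. b k x * h x) \<longlonglongrightarrow> h x"
      by simp
    show "AE x in lborel. cmod (b k x * h x) \<le> cmod (h x)" for k
      using bN by (auto simp: norm_mult mult_left_le_one_le)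
  qed
  have "(\<lambda>k. abs_l2 (\<lambda>x. d k x * f x)) \<longlonglongrightarrow> abs_l2 (\<lambda>x. 0)"
  proof (rule abs_l2_dominated_convergence(2)[OF _ _ square_integrable_scale[OF f(1), of 4]])
    have "(\<lambda>k. d k x * f x) \<longlonglongrightarrow> 0 * f x" for x
      by (intro tendsto_intros limd)
    then show "AE x in lborel. (\<lambda>k. d k x * f x) \<longlonglongrightarrow> 0"
      by simp
    show "AE x in lborel. cmod (d k x * f x) \<le> cmod (4 * f x)" for k
      using dN by (auto simp: norm_mult mult_right_mono)
  qed measurable
  from tendsto_add[OF cut[OF g(1)] this]
  have limg: "(\<lambda>k. abs_l2 (\<lambda>x. b k x * g x + d k x * f x)) \<longlonglongrightarrow> w"
    by (simp add: abs_l2_add[OF sq(1)[OF g(1)] sq(2)[OF f(1)]] abs_l2_zero g(2))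
  have limf: "(\<lambda>k. abs_l2 (\<lambda>x. b k x * f x)) \<longlonglongrightarrow> u"
    using cut[OF f(1)] by (simp add: f(2))
  have "derivative_symbol \<in> borel_measurable borel"
    by measurable
  then show ?thesis
    unfolding multiplies_def
    by (rule is_product_closed[OF _ mult[unfolded multiplies_def]
          bounded_linear.tendsto[OF bounded_linear_fourier limf]
          bounded_linear.tendsto[OF bounded_linear_fourier limg]])
qed

theorem has_weak_deriv_iff: "has_weak_deriv u w \<longleftrightarrow> multiplies derivative_symbol u w"
  using has_weak_deriv_if_multiplies multiplies_if_has_weak_deriv by blast

section \<open>The half-Laplacian and bounded multipliers\<close>

lemma multiplies_add: "multiplies m u w \<Longrightarrow> multiplies m v z \<Longrightarrow> multiplies m (u + v) (w + z)"
  by (simp add: multiplies_def fourier_add is_product_add)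

lemma multiplies_diff: "multiplies m u w \<Longrightarrow> multiplies m v z \<Longrightarrow> multiplies m (u - v) (w - z)"
  by (simp add: multiplies_def fourier_diff is_product_diff)

lemma multiplies_scaleR: "multiplies m u w \<Longrightarrow> multiplies m (r *\<^sub>R u) (r *\<^sub>R w)"
  by (simp add: multiplies_def fourier_scaleR is_product_scaleR)

lemma multiplies_cscale: "multiplies m u w \<Longrightarrow> multiplies m (cscale c u) (cscale c w)"
  by (simp add: multiplies_def fourier_cscale is_product_cscale)

lemma multiplies_compose:
  "multiplies m u w \<Longrightarrow> multiplies n w z \<Longrightarrow> multiplies (\<lambda>\<xi>. n \<xi> * m \<xi>) u z"
  unfolding multiplies_def by (rule is_product_compose)

lemma multiplies_quotient:
  "multiplies m u w \<Longrightarrow> multiplies (\<lambda>\<xi>. n \<xi> * m \<xi>) u z \<Longrightarrow> multiplies n w z"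
  unfolding multiplies_def by (rule is_product_quotient)

lemma multiplies_zero: "multiplies m 0 0"
  unfolding multiplies_def fourier_zero by transfer simp

lemma is_product_uminus_symbol: "is_product m f g \<Longrightarrow> is_product (\<lambda>\<xi>. - m \<xi>) f (- g)"
proof (transfer fixing: m)
  fix f g :: "real \<Rightarrow> complex"
  assume "AE \<xi> in lborel. g \<xi> = m \<xi> * f \<xi>"
  then show "AE \<xi> in lborel. - g \<xi> = - m \<xi> * f \<xi>"
    by eventually_elim simp
qed

lemma multiplies_uminus_symbol: "multiplies m u w \<Longrightarrow> multiplies (\<lambda>\<xi>. - m \<xi>) u (- w)"
  by (simp add: multiplies_def fourier_uminus is_product_uminus_symbol)

lemma multiplies_norm_le:
  "multiplies m u w \<Longrightarrow> multiplies n u z \<Longrightarrow> (\<And>\<xi>. cmod (m \<xi>) \<le> C * cmod (n \<xi>)) \<Longrightarrow> C \<ge> 0 \<Longrightarrow>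
    norm w \<le> C * norm z"
  using is_product_norm_le[of m "fourier u" "fourier w" n "fourier z" C]
  by (simp add: multiplies_def norm_fourier)

lemma multiplies_norm_eq:
  "multiplies m u w \<Longrightarrow> multiplies n u z \<Longrightarrow> (\<And>\<xi>. cmod (m \<xi>) = cmod (n \<xi>)) \<Longrightarrow> norm w = norm z"
  using is_product_norm_eq[of m "fourier u" "fourier w" n "fourier z"]
  by (simp add: multiplies_def norm_fourier)

lemma multiplies_one: "multiplies (\<lambda>\<xi>. 1) u u"
  by (simp add: multiplies_def is_product_one)

lemma multiplies_fourier_multiplier:
  assumes "multiplies n u z" "m \<in> borel_measurable borel" "\<And>\<xi>. cmod (m \<xi>) \<le> cmod (n \<xi>)"
  shows "multiplies m u (fourier_multiplier m u)"
proof -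
  obtain g where "is_product m (fourier u) g"
    using is_product_exists[OF assms(1)[unfolded multiplies_def] assms(2,3)] by blast
  then have "multiplies m u (inverse_fourier g)"
    by (rule multiplies_exists)
  with fourier_multiplier_eq[OF this] show ?thesis
    by simp
qed

lemma bounded_multiplier:
  assumes "m \<in> borel_measurable borel" "\<And>\<xi>. cmod (m \<xi>) \<le> 1"
  shows "multiplies m u (fourier_multiplier m u)"
  by (rule multiplies_fourier_multiplier[OF multiplies_one assms(1)]) (simp add: assms(2))

lemma bounded_multiplier_norm_le:
  assumes "m \<in> borel_measurable borel" "\<And>\<xi>. cmod (m \<xi>) \<le> 1"
  shows "norm (fourier_multiplier m u) \<le> norm u"
  using multiplies_norm_le[OF bounded_multiplier[OF assms] multiplies_one, of 1] assms(2) by simp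

lemma bounded_linear_bounded_multiplier:
  assumes "m \<in> borel_measurable borel" "\<And>\<xi>. cmod (m \<xi>) \<le> 1"
  shows "bounded_linear (fourier_multiplier m)"
proof (rule bounded_linear_intro[of _ 1])
  note M = bounded_multiplier[OF assms]
  show "fourier_multiplier m (u + v) = fourier_multiplier m u + fourier_multiplier m v" for u v
    by (rule fourier_multiplier_eq[OF multiplies_add[OF M M]])
  show "fourier_multiplier m (r *\<^sub>R u) = r *\<^sub>R fourier_multiplier m u" for r u
    by (rule fourier_multiplier_eq[OF multiplies_scaleR[OF M]])
  show "norm (fourier_multiplier m u) \<le> norm u * 1" for u
    using bounded_multiplier_norm_le[OF assms] by simp
qed

text \<open>Symbols commute, so a bounded multiplier maps the graph of any multiplier into itself.\<close>
lemma bounded_multiplier_commute: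
  assumes "m \<in> borel_measurable borel" "\<And>\<xi>. cmod (m \<xi>) \<le> 1" "multiplies n u w"
  shows "multiplies n (fourier_multiplier m u) (fourier_multiplier m w)"
  using multiplies_compose[OF assms(3) bounded_multiplier[OF assms(1,2)]]
  by (intro multiplies_quotient[OF bounded_multiplier[OF assms(1,2)]]) (simp add: mult.commute)

lemma bounded_multiplier_strong_limit:
  assumes "\<And>k. m k \<in> borel_measurable borel" "\<And>k \<xi>. cmod (m k \<xi>) \<le> 1" "\<And>\<xi>. (\<lambda>k. m k \<xi>) \<longlonglongrightarrow> 1"
  shows "(\<lambda>k. fourier_multiplier (m k) u) \<longlonglongrightarrow> u"
proof -
  have "(\<lambda>k. fourier (fourier_multiplier (m k) u)) \<longlonglongrightarrow> fourier u"
    using assms by (rule is_product_strong_limit)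
      (use bounded_multiplier[OF assms(1,2)] in \<open>simp add: multiplies_def\<close>)
  from bounded_linear.tendsto[OF bounded_linear_inverse_fourier this] show ?thesis
    by (simp add: inverse_fourier_fourier)
qed

lemma weak_deriv_eq:
  assumes "multiplies derivative_symbol u w"
  shows "weak_deriv u = w"
  unfolding weak_deriv_def has_weak_deriv_iff
  using assms multiplies_unique[OF _ assms] by (rule the_equality)

lemma H1_iff: "u \<in> H1 \<longleftrightarrow> multiplies derivative_symbol u (weak_deriv u)"
  unfolding H1_def has_weak_deriv_iff using weak_deriv_eq by blast

lemma H1_I: "multiplies derivative_symbol u w \<Longrightarrow> u \<in> H1"
  unfolding H1_def has_weak_deriv_iff by auto

lemma weak_deriv_linear:
  assumes "u \<in> H1" "v \<in> H1"
  shows "u + v \<in> H1" "weak_deriv (u + v) = weak_deriv u + weak_deriv v"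
    and "u - v \<in> H1" "weak_deriv (u - v) = weak_deriv u - weak_deriv v"
    and "r *\<^sub>R u \<in> H1" "weak_deriv (r *\<^sub>R u) = r *\<^sub>R weak_deriv u"
    and "cscale c u \<in> H1" "weak_deriv (cscale c u) = cscale c (weak_deriv u)"
proof -
  note M = assms[unfolded H1_iff]
  note D = multiplies_add[OF M] multiplies_diff[OF M]
    multiplies_scaleR[OF M(1), of r] multiplies_cscale[OF M(1), of c]
  show "u + v \<in> H1" "u - v \<in> H1" "r *\<^sub>R u \<in> H1" "cscale c u \<in> H1"
    by (rule D[THEN H1_I])+
  show "weak_deriv (u + v) = weak_deriv u + weak_deriv v" "weak_deriv (u - v) = weak_deriv u - weak_deriv v"
    "weak_deriv (r *\<^sub>R u) = r *\<^sub>R weak_deriv u" "weak_deriv (cscale c u) = cscale c (weak_deriv u)"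
    by (rule D[THEN weak_deriv_eq])+
qed

lemma zero_in_H1: "0 \<in> H1"
  by (rule H1_I[OF multiplies_zero])

abbreviation abs_symbol :: "real \<Rightarrow> complex" where
  "abs_symbol \<xi> \<equiv> of_real \<bar>\<xi>\<bar>"

lemma half_laplacian_eq: "multiplies abs_symbol u w \<Longrightarrow> half_laplacian u = w"
  unfolding half_laplacian_def by (rule fourier_multiplier_eq)

lemma multiplies_half_laplacian:
  assumes "u \<in> H1"
  shows "multiplies abs_symbol u (half_laplacian u)"
  unfolding half_laplacian_def
  by (rule multiplies_fourier_multiplier[OF assms[unfolded H1_iff]]) (auto simp: norm_mult)

text \<open>The symbols \<open>|\<xi>|\<close> and \<open>i \<xi>\<close> have the same modulus.\<close>
lemma norm_half_laplacian: "u \<in> H1 \<Longrightarrow> norm (half_laplacian u) = norm (weak_deriv u)"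
  by (rule multiplies_norm_eq[OF multiplies_half_laplacian]) (auto simp: H1_iff norm_mult)

lemma half_laplacian_linear:
  assumes "u \<in> H1" "v \<in> H1"
  shows "half_laplacian (u + v) = half_laplacian u + half_laplacian v"
    and "half_laplacian (u - v) = half_laplacian u - half_laplacian v"
    and "half_laplacian (r *\<^sub>R u) = r *\<^sub>R half_laplacian u"
    and "half_laplacian (cscale c u) = cscale c (half_laplacian u)"
proof -
  note M = assms[THEN multiplies_half_laplacian]
  show "half_laplacian (u + v) = half_laplacian u + half_laplacian v"
    by (rule half_laplacian_eq[OF multiplies_add[OF M]])
  show "half_laplacian (u - v) = half_laplacian u - half_laplacian v"
    by (rule half_laplacian_eq[OF multiplies_diff[OF M]])
  show "half_laplacian (r *\<^sub>R u) = r *\<^sub>R half_laplacian u"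
    by (rule half_laplacian_eq[OF multiplies_scaleR[OF M(1)]])
  show "half_laplacian (cscale c u) = cscale c (half_laplacian u)"
    by (rule half_laplacian_eq[OF multiplies_cscale[OF M(1)]])
qed

text \<open>On the level of symbols, \<open>|\<xi>| |\<xi>| = - (i \<xi>) (i \<xi>)\<close>.\<close>
lemma half_laplacian_squared:
  assumes "u \<in> H2"
  shows "multiplies abs_symbol (half_laplacian u) (- laplacian u)"
proof (rule multiplies_quotient)
  have u: "u \<in> H1" "weak_deriv u \<in> H1"
    using assms by (auto simp: H2_def)
  show "multiplies abs_symbol u (half_laplacian u)"
    by (rule multiplies_half_laplacian[OF u(1)])
  have "multiplies (\<lambda>\<xi>. - (derivative_symbol \<xi> * derivative_symbol \<xi>)) u (- laplacian u)"
    unfolding laplacian_def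
    by (rule multiplies_uminus_symbol[OF multiplies_compose[OF u[unfolded H1_iff]]])
  also have "(\<lambda>\<xi>. - (derivative_symbol \<xi> * derivative_symbol \<xi>)) = (\<lambda>\<xi>. abs_symbol \<xi> * abs_symbol \<xi>)"
    by (simp add: fun_eq_iff algebra_simps flip: of_real_mult)
  finally show "multiplies (\<lambda>\<xi>. abs_symbol \<xi> * abs_symbol \<xi>) u (- laplacian u)" .
qed

lemma norm_half_laplacian_le_H1: "u \<in> H1 \<Longrightarrow> norm (half_laplacian u) \<le> norm_H1 u"
  unfolding norm_half_laplacian norm_H1_def by (rule real_le_rsqrt) simp

lemma norm_le_norm_H1: "norm u \<le> norm_H1 u"
  unfolding norm_H1_def by (rule real_le_rsqrt) simp

section \<open>The constrained backward wave equation\<close>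

lemma has_vector_derivative_if_quotient:
  assumes "((\<lambda>s. norm ((f s - f t) /\<^sub>R (s - t) - d)) \<longlongrightarrow> 0) (at t within I)"
  shows "(f has_vector_derivative d) (at t within I)"
  unfolding has_vector_derivative_def has_derivative_within
proof
  show "bounded_linear (\<lambda>x. x *\<^sub>R d)"
    by (rule bounded_linear_scaleR_left)
  show "((\<lambda>s. (1 / norm (s - t)) *\<^sub>R (f s - (f t + (s - t) *\<^sub>R d))) \<longlongrightarrow> 0) (at t within I)"
  proof (rule Lim_null_comparison[OF _ assms])
    have "norm ((1 / norm (s - t)) *\<^sub>R (f s - (f t + (s - t) *\<^sub>R d))) \<le> norm ((f s - f t) /\<^sub>R (s - t) - d)"
      if "s \<noteq> t" for s
    proof -
      have "(f s - f t) /\<^sub>R (s - t) - d = (f s - (f t + (s - t) *\<^sub>R d)) /\<^sub>R (s - t)"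
        using that by (simp add: diff_diff_add[symmetric] scaleR_diff_right)
      then show ?thesis
        by (simp add: divide_inverse)
    qed
    then show "eventually (\<lambda>s. norm ((1 / norm (s - t)) *\<^sub>R (f s - (f t + (s - t) *\<^sub>R d)))
        \<le> norm ((f s - f t) /\<^sub>R (s - t) - d)) (at t within I)"
      by (simp add: eventually_at_filter)
  qed
qed

text \<open>Gronwall's inequality: \<open>exp (- 2 K t) |y t|\<^sup>2\<close> is nonincreasing and vanishes at 0.\<close>
lemma growth_bound_zero:
  fixes y y' :: "real \<Rightarrow> 'a::real_inner"
  assumes deriv: "\<And>t. t \<in> {0..T} \<Longrightarrow> (y has_vector_derivative y' t) (at t within {0..T})"
    and bound: "\<And>t. t \<in> {0..T} \<Longrightarrow> norm (y' t) \<le> K * norm (y t)"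
    and "y 0 = 0" and t: "t \<in> {0..T}"
  shows "y t = 0"
proof -
  define z where "z s = exp (- (2 * K * s)) * (y s \<bullet> y s)" for s
  have "(z has_derivative (\<lambda>h. h * (exp (- (2 * K * s)) * (2 * (y s \<bullet> y' s) - 2 * K * (y s \<bullet> y s))))) (at s within {0..t})"
    if "s \<in> {0..t}" for s
  proof -
    have "(y has_derivative (\<lambda>h. h *\<^sub>R y' s)) (at s within {0..t})"
      using deriv[of s] that t unfolding has_vector_derivative_def
      by (auto intro: has_derivative_subset)
    then show ?thesis
      unfolding z_def[abs_def]
      by (auto intro!: derivative_eq_intros simp: fun_eq_iff algebra_simps inner_commute)
  qed
  then obtain s where s: "s \<in> {0..t}"
    and eq: "z t - z 0 = t * (exp (- (2 * K * s)) * (2 * (y s \<bullet> y' s) - 2 * K * (y s \<bullet> y s)))"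
    using mvt_very_simple[of 0 t z "\<lambda>s h. h * (exp (- (2 * K * s)) * (2 * (y s \<bullet> y' s) - 2 * K * (y s \<bullet> y s)))"] t
    by auto
  have "y s \<bullet> y' s \<le> norm (y s) * norm (y' s)"
    by (rule norm_cauchy_schwarz)
  also have "\<dots> \<le> norm (y s) * (K * norm (y s))"
    using bound[of s] s t by (intro mult_left_mono) auto
  also have "\<dots> = K * (y s \<bullet> y s)"
    by (simp add: power2_norm_eq_inner[symmetric] power2_eq_square)
  finally have "exp (- (2 * K * s)) * (2 * (y s \<bullet> y' s) - 2 * K * (y s \<bullet> y s)) \<le> 0"
    by (intro mult_nonneg_nonpos) auto
  from mult_nonneg_nonpos[OF _ this, of t] t have "z t - z 0 \<le> 0"
    unfolding eq by simp
  then have "exp (- (2 * K * t)) * (y t \<bullet> y t) \<le> 0"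
    by (simp add: z_def \<open>y 0 = 0\<close>)
  then have "y t \<bullet> y t \<le> 0"
    by (simp add: mult_le_0_iff not_le[symmetric])
  then show ?thesis
    using inner_ge_zero[of "y t"] inner_eq_zero_iff[of "y t"] by linarith
qed

text \<open>The equation \<open>w' = K |D| w\<close> is ill-posed forwards in time, but its solutions are
  unique: on the frequencies \<open>|\<xi>| \<le> n\<close> its right-hand side is bounded with norm
  \<open>K n\<close>, so Gronwall's inequality applies to each frequency cutoff of \<open>w\<close>, and the
  cutoffs converge to \<open>w\<close>.\<close>
lemma backward_heat_uniqueness:
  assumes K: "K \<ge> 0"
    and deriv: "\<And>t. t \<in> {0..T} \<Longrightarrow> (w has_vector_derivative K *\<^sub>R a t) (at t within {0..T})"
    and a: "\<And>t. t \<in> {0..T} \<Longrightarrow> multiplies abs_symbol (w t) (a t)"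
    and "w 0 = 0" and t: "t \<in> {0..T}"
  shows "w t = 0"
proof -
  define m where "m n \<xi> = (indicator {- real n..real n} \<xi> :: complex)" for n \<xi>
  have m: "m n \<in> borel_measurable borel" "cmod (m n \<xi>) \<le> 1" for n \<xi>
    by (auto simp: m_def[abs_def] indicator_def)
  have "fourier_multiplier (m n) (w t) = 0" for n
  proof (rule growth_bound_zero[where y = "\<lambda>t. fourier_multiplier (m n) (w t)" and K = "K * real n" and T = T])
    fix s assume s: "s \<in> {0..T}"
    show "((\<lambda>t. fourier_multiplier (m n) (w t)) has_vector_derivative fourier_multiplier (m n) (K *\<^sub>R a s)) (at s within {0..T})"
      by (rule bounded_linear.has_vector_derivative[OF bounded_linear_bounded_multiplier[OF m] deriv[OF s]])
    have "norm (fourier_multiplier (m n) (a s)) \<le> real n * norm (fourier_multiplier (m n) (w s))"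
    proof (rule multiplies_norm_le[OF multiplies_compose[OF a[OF s] bounded_multiplier[OF m]] bounded_multiplier[OF m]])
      show "cmod (m n \<xi> * abs_symbol \<xi>) \<le> real n * cmod (m n \<xi>)" for \<xi>
        by (auto simp: m_def indicator_def)
    qed simp
    then have "K * norm (fourier_multiplier (m n) (a s)) \<le> K * (real n * norm (fourier_multiplier (m n) (w s)))"
      using K by (intro mult_left_mono) auto
    then show "norm (fourier_multiplier (m n) (K *\<^sub>R a s)) \<le> K * real n * norm (fourier_multiplier (m n) (w s))"
      using K by (simp add: linear_scale[OF bounded_linear.linear[OF bounded_linear_bounded_multiplier[OF m]]] mult.assoc)
  next
    show "fourier_multiplier (m n) (w 0) = 0"
      using \<open>w 0 = 0\<close> by (simp add: fourier_multiplier_eq[OF multiplies_zero])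
  qed (rule t)
  moreover have "(\<lambda>n. fourier_multiplier (m n) (w t)) \<longlonglongrightarrow> w t"
  proof (rule bounded_multiplier_strong_limit[OF m])
    fix \<xi>
    obtain N :: nat where N: "\<bar>\<xi>\<bar> \<le> real N"
      using real_arch_simple by blast
    have "eventually (\<lambda>n. 1 = m n \<xi>) sequentially"
      using eventually_ge_at_top[of N] by eventually_elim (use N in \<open>auto simp: m_def indicator_def\<close>)
    then show "(\<lambda>n. m n \<xi>) \<longlonglongrightarrow> 1"
      by (rule Lim_transform_eventually[OF tendsto_const])
  qed
  ultimately have "(\<lambda>n::nat. 0) \<longlonglongrightarrow> w t"
    by simp
  then show ?thesis
    by (simp add: LIMSEQ_const_iff)
qed

text \<open>The backward wave operator factors into two first-order operators. The defect
  \<open>w = u' + \<epsilon> (-\<Delta>)^(1/2) u\<close> satisfies \<open>w' = \<epsilon> (-\<Delta>)^(1/2) w\<close>, and the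
  constraint says that it vanishes at time 0; uniqueness makes it vanish identically.\<close>
theorem constrained_wave_solves_half_diffusion:
  assumes \<epsilon>: "\<epsilon> > 0"
    and H2: "continuous_curve H2 norm_H2 {0..T} u"
    and C1: "C1_curve H1 norm_H1 {0..T} u u'"
    and wave: "\<And>t. t \<in> {0..T} \<Longrightarrow>
      (u' has_vector_derivative - (\<epsilon>\<^sup>2 *\<^sub>R laplacian (u t))) (at t within {0..T})"
    and constraint: "u' 0 = - (\<epsilon> *\<^sub>R half_laplacian (u 0))"
    and t: "t \<in> {0..T}"
  shows "(u has_vector_derivative - (\<epsilon> *\<^sub>R half_laplacian (u t))) (at t within {0..T})"
proof -
  have uH2: "u s \<in> H2" if "s \<in> {0..T}" for s
    using H2 that by (auto simp: continuous_curve_def)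
  then have uH1: "u s \<in> H1" if "s \<in> {0..T}" for s
    using that by (auto simp: H2_def)
  have u'H1: "u' s \<in> H1" if "s \<in> {0..T}" for s
    using C1 that by (auto simp: C1_curve_def continuous_curve_def)
  have quot: "((\<lambda>r. norm_H1 ((u r - u s) /\<^sub>R (r - s) - u' s)) \<longlongrightarrow> 0) (at s within {0..T})"
    if "s \<in> {0..T}" for s
    using C1 that by (auto simp: C1_curve_def)
  have du: "(u has_vector_derivative u' s) (at s within {0..T})" if "s \<in> {0..T}" for s
    by (rule has_vector_derivative_if_quotient, rule Lim_null_comparison[OF _ quot[OF that]])
      (simp add: norm_le_norm_H1)
  \<comment> \<open>Here differentiability in \<open>H1\<close>, not only in \<open>l2\<close>, is used.\<close>
  have dL: "((\<lambda>r. half_laplacian (u r)) has_vector_derivative half_laplacian (u' s)) (at s within {0..T})"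
    if s: "s \<in> {0..T}" for s
  proof (rule has_vector_derivative_if_quotient, rule Lim_null_comparison[OF _ quot[OF s]])
    have "norm ((half_laplacian (u r) - half_laplacian (u s)) /\<^sub>R (r - s) - half_laplacian (u' s))
        \<le> norm_H1 ((u r - u s) /\<^sub>R (r - s) - u' s)" if r: "r \<in> {0..T}" for r
    proof -
      note H = uH1[OF r] uH1[OF s] u'H1[OF s]
      have d: "u r - u s \<in> H1"
        by (rule weak_deriv_linear(3)[OF H(1,2)])
      have q: "(u r - u s) /\<^sub>R (r - s) \<in> H1"
        by (rule weak_deriv_linear(5)[OF d d])
      have "(half_laplacian (u r) - half_laplacian (u s)) /\<^sub>R (r - s) - half_laplacian (u' s)
          = half_laplacian ((u r - u s) /\<^sub>R (r - s) - u' s)"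
        by (simp only: half_laplacian_linear(2)[OF q H(3)] half_laplacian_linear(3)[OF d d]
            half_laplacian_linear(2)[OF H(1,2)])
      then show ?thesis
        using norm_half_laplacian_le_H1[OF weak_deriv_linear(3)[OF q H(3)]] by simp
    qed
    then show "eventually (\<lambda>r. norm (norm ((half_laplacian (u r) - half_laplacian (u s)) /\<^sub>R (r - s) - half_laplacian (u' s)))
        \<le> norm_H1 ((u r - u s) /\<^sub>R (r - s) - u' s)) (at s within {0..T})"
      by (simp add: eventually_at_filter)
  qed
  define w where "w s = u' s + \<epsilon> *\<^sub>R half_laplacian (u s)" for s
  define a where "a s = half_laplacian (u' s) + \<epsilon> *\<^sub>R (- laplacian (u s))" for s
  have "w t = 0"
  proof (rule backward_heat_uniqueness[where a = a and K = \<epsilon>])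
    fix s assume s: "s \<in> {0..T}"
    have "(w has_vector_derivative - (\<epsilon>\<^sup>2 *\<^sub>R laplacian (u s)) + \<epsilon> *\<^sub>R half_laplacian (u' s)) (at s within {0..T})"
      unfolding w_def[abs_def]
      by (intro has_vector_derivative_add wave[OF s]
          bounded_linear.has_vector_derivative[OF bounded_linear_scaleR_right dL[OF s]])
    also have "- (\<epsilon>\<^sup>2 *\<^sub>R laplacian (u s)) + \<epsilon> *\<^sub>R half_laplacian (u' s) = \<epsilon> *\<^sub>R a s"
      by (simp add: a_def algebra_simps power2_eq_square)
    finally show "(w has_vector_derivative \<epsilon> *\<^sub>R a s) (at s within {0..T})" .
    show "multiplies abs_symbol (w s) (a s)"
      unfolding w_def a_def
      by (intro multiplies_add multiplies_scaleR multiplies_half_laplacian u'H1 half_laplacian_squared uH2 s)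
  qed (use \<epsilon> t constraint in \<open>auto simp: w_def\<close>)
  then have "u' t = - (\<epsilon> *\<^sub>R half_laplacian (u t))"
    by (simp add: w_def eq_neg_iff_add_eq_0)
  with du[OF t] show ?thesis
    by simp
qed

section \<open>The half-diffusion semigroup\<close>

lemma
  assumes "\<epsilon> > 0" "t \<ge> 0"
  shows half_diffusion_multiplies:
      "multiplies (\<lambda>\<xi>. of_real (exp (- (\<epsilon> * \<bar>\<xi>\<bar> * t)))) u (half_diffusion \<epsilon> t u)"
    and half_diffusion_commute:
      "multiplies n u w \<Longrightarrow> multiplies n (half_diffusion \<epsilon> t u) (half_diffusion \<epsilon> t w)"
    and half_diffusion_norm_le: "norm (half_diffusion \<epsilon> t u) \<le> norm u"
    and bounded_linear_half_diffusion: "bounded_linear (half_diffusion \<epsilon> t)"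
proof -
  have symbol: "(\<lambda>\<xi>. complex_of_real (exp (- (\<epsilon> * \<bar>\<xi>\<bar> * t)))) \<in> borel_measurable borel"
    "cmod (complex_of_real (exp (- (\<epsilon> * \<bar>\<xi>\<bar> * t)))) \<le> 1" for \<xi>
    using assms by auto
  show "multiplies (\<lambda>\<xi>. of_real (exp (- (\<epsilon> * \<bar>\<xi>\<bar> * t)))) u (half_diffusion \<epsilon> t u)"
    unfolding half_diffusion_def by (rule bounded_multiplier[OF symbol])
  show "norm (half_diffusion \<epsilon> t u) \<le> norm u"
    unfolding half_diffusion_def by (rule bounded_multiplier_norm_le[OF symbol])
  show "bounded_linear (half_diffusion \<epsilon> t)"
    unfolding half_diffusion_def by (rule bounded_linear_bounded_multiplier[OF symbol])
  show "multiplies n (half_diffusion \<epsilon> t u) (half_diffusion \<epsilon> t w)" if "multiplies n u w"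
    unfolding half_diffusion_def by (rule bounded_multiplier_commute[OF symbol that])
qed

lemma half_diffusion_cscale:
  "\<epsilon> > 0 \<Longrightarrow> t \<ge> 0 \<Longrightarrow> half_diffusion \<epsilon> t (cscale c u) = cscale c (half_diffusion \<epsilon> t u)"
  unfolding half_diffusion_def[of \<epsilon> t, THEN fun_cong, of "cscale c u"]
  by (rule fourier_multiplier_eq[OF multiplies_cscale[OF half_diffusion_multiplies]])

lemma half_diffusion_zero: "half_diffusion \<epsilon> 0 u = u"
  unfolding half_diffusion_def by (simp add: fourier_multiplier_eq[OF multiplies_one])

lemma half_diffusion_semigroup:
  assumes "\<epsilon> > 0" "s \<ge> 0" "t \<ge> 0"
  shows "half_diffusion \<epsilon> (s + t) u = half_diffusion \<epsilon> s (half_diffusion \<epsilon> t u)"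
proof -
  have "multiplies (\<lambda>\<xi>. of_real (exp (- (\<epsilon> * \<bar>\<xi>\<bar> * s))) * of_real (exp (- (\<epsilon> * \<bar>\<xi>\<bar> * t)))) u
      (half_diffusion \<epsilon> s (half_diffusion \<epsilon> t u))"
    by (rule multiplies_compose[OF half_diffusion_multiplies[OF assms(1,3)] half_diffusion_multiplies[OF assms(1,2)]])
  moreover have "(\<lambda>\<xi>. complex_of_real (exp (- (\<epsilon> * \<bar>\<xi>\<bar> * s))) * of_real (exp (- (\<epsilon> * \<bar>\<xi>\<bar> * t))))
      = (\<lambda>\<xi>. of_real (exp (- (\<epsilon> * \<bar>\<xi>\<bar> * (s + t)))))"
    by (simp add: fun_eq_iff algebra_simps flip: of_real_mult exp_add)
  ultimately show ?thesis
    unfolding half_diffusion_def[of \<epsilon> "s + t"] by (simp add: fourier_multiplier_eq)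
qed

lemma half_diffusion_tendsto:
  assumes "\<epsilon> > 0"
  shows "((\<lambda>t. half_diffusion \<epsilon> t u) \<longlongrightarrow> u) (at_right 0)"
proof (rule tendsto_at_right_sequentially[of 0 1])
  fix t :: "nat \<Rightarrow> real"
  assume t: "\<And>n. 0 < t n" "t \<longlonglongrightarrow> 0"
  show "(\<lambda>n. half_diffusion \<epsilon> (t n) u) \<longlonglongrightarrow> u"
    unfolding half_diffusion_def
  proof (rule bounded_multiplier_strong_limit)
    show "(\<lambda>\<xi>. complex_of_real (exp (- (\<epsilon> * \<bar>\<xi>\<bar> * t k)))) \<in> borel_measurable borel" for k
      by measurable
    show "cmod (complex_of_real (exp (- (\<epsilon> * \<bar>\<xi>\<bar> * t k)))) \<le> 1" for k \<xi>
      using assms t(1)[of k] by simp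
    have "(\<lambda>k. complex_of_real (exp (- (\<epsilon> * \<bar>\<xi>\<bar> * t k)))) \<longlonglongrightarrow> of_real (exp (- (\<epsilon> * \<bar>\<xi>\<bar> * 0)))" for \<xi>
      by (intro tendsto_intros t(2))
    then show "(\<lambda>k. complex_of_real (exp (- (\<epsilon> * \<bar>\<xi>\<bar> * t k)))) \<longlonglongrightarrow> 1" for \<xi>
      by simp
  qed
qed simp

lemma half_diffusion_H1:
  assumes "\<epsilon> > 0" "t \<ge> 0" "u \<in> H1"
  shows "half_diffusion \<epsilon> t u \<in> H1"
    and "weak_deriv (half_diffusion \<epsilon> t u) = half_diffusion \<epsilon> t (weak_deriv u)"
    and "half_laplacian (half_diffusion \<epsilon> t u) = half_diffusion \<epsilon> t (half_laplacian u)"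
proof -
  have D: "multiplies derivative_symbol (half_diffusion \<epsilon> t u) (half_diffusion \<epsilon> t (weak_deriv u))"
    by (rule half_diffusion_commute[OF assms(1,2) assms(3)[unfolded H1_iff]])
  show "half_diffusion \<epsilon> t u \<in> H1" "weak_deriv (half_diffusion \<epsilon> t u) = half_diffusion \<epsilon> t (weak_deriv u)"
    by (rule H1_I[OF D], rule weak_deriv_eq[OF D])
  show "half_laplacian (half_diffusion \<epsilon> t u) = half_diffusion \<epsilon> t (half_laplacian u)"
    by (rule half_laplacian_eq[OF half_diffusion_commute[OF assms(1,2) multiplies_half_laplacian[OF assms(3)]]])
qed

section \<open>The stable subspace and its flow\<close>

text \<open>A linear isometry (on \<open>H1 \<times> UNIV\<close>) into a product of copies of \<open>l2\<close>, which reduces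
  all statements about \<open>norm_H1L2\<close> to the product norm.\<close>
definition sobolev_graph :: "l2 \<times> l2 \<Rightarrow> l2 \<times> l2 \<times> l2" where
  "sobolev_graph p = (fst p, weak_deriv (fst p), snd p)"

lemma norm_H1L2_eq: "norm_H1L2 p = norm (sobolev_graph p)"
  by (simp add: norm_H1L2_def norm_H1_def sobolev_graph_def norm_Pair)

lemma sobolev_graph_diff:
  "p \<in> H1 \<times> UNIV \<Longrightarrow> q \<in> H1 \<times> UNIV \<Longrightarrow> sobolev_graph (p - q) = sobolev_graph p - sobolev_graph q"
  by (auto simp: sobolev_graph_def weak_deriv_linear)

text \<open>The symmetry axiom of \<open>Metric_space\<close> ranges over the whole type, so \<open>H1\<close> cannot
  be assumed. Outside \<open>H1\<close> the weak derivatives of \<open>u\<close> and \<open>- u\<close> are the same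
  default value.\<close>
lemma norm_H1L2_uminus: "norm_H1L2 (- p) = norm_H1L2 p"
proof (cases "fst p \<in> H1")
  case True
  then show ?thesis
    using weak_deriv_linear(6)[of "fst p" "fst p" "-1"] by (simp add: norm_H1L2_def norm_H1_def)
next
  case False
  then have "- fst p \<notin> H1"
    using weak_deriv_linear(5)[of "- fst p" "- fst p" "-1"] by auto
  with False have "has_weak_deriv (fst p) = has_weak_deriv (- fst p)"
    by (auto simp: H1_def)
  then show ?thesis
    by (simp add: norm_H1L2_def norm_H1_def weak_deriv_def)
qed

lemma Metric_space_H1L2: "Metric_space (H1 \<times> UNIV) (\<lambda>p q. norm_H1L2 (p - q))"
proof
  fix p q r :: "l2 \<times> l2"
  show "0 \<le> norm_H1L2 (p - q)"
    by (simp add: norm_H1L2_eq)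
  show "norm_H1L2 (p - q) = norm_H1L2 (q - p)"
    using norm_H1L2_uminus[of "p - q"] by simp
  assume p: "p \<in> H1 \<times> UNIV" and q: "q \<in> H1 \<times> UNIV"
  show "norm_H1L2 (p - q) = 0 \<longleftrightarrow> p = q"
    by (auto simp: norm_H1L2_eq sobolev_graph_diff p q) (auto simp: sobolev_graph_def prod_eq_iff)
  assume r: "r \<in> H1 \<times> UNIV"
  show "norm_H1L2 (p - r) \<le> norm_H1L2 (p - q) + norm_H1L2 (q - r)"
    unfolding norm_H1L2_eq sobolev_graph_diff[OF p q] sobolev_graph_diff[OF q r] sobolev_graph_diff[OF p r]
    using norm_triangle_ineq[of "sobolev_graph p - sobolev_graph q" "sobolev_graph q - sobolev_graph r"] by simp
qed

lemma cscale_uminus_scaleR: "cscale c (- (r *\<^sub>R u)) = - (r *\<^sub>R cscale c u)"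
  using cscale_scaleR[of c "- r" u] by simp

lemma subspace_stable_subspace: "module.subspace cscale2 (stable_subspace \<epsilon>)"
proof -
  interpret vector_space cscale2
    by (rule vector_space_cscale2)
  show ?thesis
  proof (rule subspaceI)
    show "0 \<in> stable_subspace \<epsilon>"
      using half_laplacian_eq[OF multiplies_zero] zero_in_H1 by (simp add: stable_subspace_def zero_prod_def)
    show "p + q \<in> stable_subspace \<epsilon>" if "p \<in> stable_subspace \<epsilon>" "q \<in> stable_subspace \<epsilon>" for p q
      using that by (auto simp: stable_subspace_def weak_deriv_linear half_laplacian_linear scaleR_add_right)
    show "cscale2 c p \<in> stable_subspace \<epsilon>" if "p \<in> stable_subspace \<epsilon>" for c p
      using that by (auto simp: stable_subspace_def cscale2_def weak_deriv_linear half_laplacian_linear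
          cscale_uminus_scaleR)
  qed
qed

lemma norm_le_norm_H1L2:
  "norm (weak_deriv (fst p)) \<le> norm_H1L2 p" "norm (snd p) \<le> norm_H1L2 p"
  unfolding norm_H1L2_eq sobolev_graph_def
  by (rule order_trans[OF norm_fst_le[of _ "snd p"] norm_snd_le], rule order_trans[OF norm_snd_le norm_snd_le])

text \<open>The half-Laplacian is bounded from \<open>H1\<close> to \<open>l2\<close>, and the stable subspace is,
  up to the factor \<open>- \<epsilon>\<close>, its graph.\<close>
lemma closedin_stable_subspace:
  assumes \<epsilon>: "\<epsilon> > 0"
  shows "closedin H1L2_topology (stable_subspace \<epsilon>)"
proof -
  interpret Metric_space "H1 \<times> UNIV" "\<lambda>p q. norm_H1L2 (p - q)"
    by (rule Metric_space_H1L2)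
  have "l \<in> stable_subspace \<epsilon>"
    if \<sigma>: "range \<sigma> \<subseteq> stable_subspace \<epsilon>" and lim: "limitin mtopology \<sigma> l sequentially" for \<sigma> l
  proof -
    obtain u v where l: "l = (u, v)"
      by (cases l)
    have u: "u \<in> H1"
      using lim by (auto simp: limitin_metric l)
    have "norm (v + \<epsilon> *\<^sub>R half_laplacian u) \<le> 0 + e" if "e > 0" for e
    proof -
      have "e / (1 + \<epsilon>) > 0"
        using \<epsilon> that by simp
      then have "eventually (\<lambda>n. norm_H1L2 (\<sigma> n - l) < e / (1 + \<epsilon>)) sequentially"
        using lim unfolding limitin_metric by (auto elim: eventually_mono)
      then obtain n where n: "norm_H1L2 (\<sigma> n - l) < e / (1 + \<epsilon>)"
        using eventually_happens'[OF sequentially_bot] by blast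
      define x where "x = fst (\<sigma> n)"
      have x: "x \<in> H1" and \<sigma>n: "\<sigma> n = (x, - (\<epsilon> *\<^sub>R half_laplacian x))"
        using \<sigma> by (auto simp: x_def stable_subspace_def image_subset_iff split_beta prod_eq_iff)
      have "v + \<epsilon> *\<^sub>R half_laplacian u = - (snd (\<sigma> n - l)) - \<epsilon> *\<^sub>R half_laplacian (x - u)"
        by (simp add: \<sigma>n l half_laplacian_linear(2)[OF x u] scaleR_diff_right)
      then have "norm (v + \<epsilon> *\<^sub>R half_laplacian u) \<le> norm (snd (\<sigma> n - l)) + \<epsilon> * norm (half_laplacian (x - u))"
        using norm_triangle_ineq4[of "- (snd (\<sigma> n - l))" "\<epsilon> *\<^sub>R half_laplacian (x - u)"] \<epsilon>
        by (simp only: norm_minus_cancel norm_scaleR abs_of_pos)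
      also have "norm (half_laplacian (x - u)) = norm (weak_deriv (fst (\<sigma> n - l)))"
        by (simp add: \<sigma>n l norm_half_laplacian weak_deriv_linear x u)
      also have "norm (snd (\<sigma> n - l)) + \<epsilon> * norm (weak_deriv (fst (\<sigma> n - l)))
          \<le> norm_H1L2 (\<sigma> n - l) + \<epsilon> * norm_H1L2 (\<sigma> n - l)"
        using \<epsilon> by (intro add_mono mult_left_mono norm_le_norm_H1L2) auto
      also have "\<dots> = (1 + \<epsilon>) * norm_H1L2 (\<sigma> n - l)"
        by (simp add: distrib_right)
      also have "\<dots> \<le> e"
        using n \<epsilon> by (simp add: field_simps)
      finally show ?thesis
        by simp
    qed
    then have "norm (v + \<epsilon> *\<^sub>R half_laplacian u) \<le> 0"
      by (rule field_le_epsilon)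
    then show ?thesis
      by (simp add: l stable_subspace_def u eq_neg_iff_add_eq_0)
  qed
  moreover have "stable_subspace \<epsilon> \<subseteq> H1 \<times> UNIV"
    by (auto simp: stable_subspace_def)
  ultimately show ?thesis
    unfolding H1L2_topology_def metric_closedin_iff_sequentially_closed by blast
qed

text \<open>The half-Laplacian commutes with the semigroup, so on the stable subspace the flow acts
  diagonally; the same holds for the weak derivative that enters the norm.\<close>
lemma stable_flow_on_stable_subspace:
  assumes \<epsilon>: "\<epsilon> > 0" and "t \<ge> 0" "p \<in> stable_subspace \<epsilon>"
  shows "stable_flow \<epsilon> t p = (half_diffusion \<epsilon> t (fst p), half_diffusion \<epsilon> t (snd p))"
    and "stable_flow \<epsilon> t p \<in> stable_subspace \<epsilon>"
    and "sobolev_graph (stable_flow \<epsilon> t p)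
      = (half_diffusion \<epsilon> t (fst p), half_diffusion \<epsilon> t (weak_deriv (fst p)), half_diffusion \<epsilon> t (snd p))"
proof -
  have u: "fst p \<in> H1" and v: "snd p = - (\<epsilon> *\<^sub>R half_laplacian (fst p))"
    using assms(3) by (auto simp: stable_subspace_def)
  note S = half_diffusion_H1[OF \<epsilon> assms(2) u]
  have "half_diffusion \<epsilon> t (snd p) = half_diffusion \<epsilon> t ((- \<epsilon>) *\<^sub>R half_laplacian (fst p))"
    by (simp add: v)
  also have "\<dots> = - (\<epsilon> *\<^sub>R half_laplacian (half_diffusion \<epsilon> t (fst p)))"
    unfolding S(3) linear_scale[OF bounded_linear.linear[OF bounded_linear_half_diffusion[OF \<epsilon> assms(2)]]]
    by simp
  finally show flow: "stable_flow \<epsilon> t p = (half_diffusion \<epsilon> t (fst p), half_diffusion \<epsilon> t (snd p))"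
    by (simp add: stable_flow_def)
  show "stable_flow \<epsilon> t p \<in> stable_subspace \<epsilon>"
    by (simp add: stable_flow_def stable_subspace_def S(1))
  show "sobolev_graph (stable_flow \<epsilon> t p)
      = (half_diffusion \<epsilon> t (fst p), half_diffusion \<epsilon> t (weak_deriv (fst p)), half_diffusion \<epsilon> t (snd p))"
    by (simp add: flow sobolev_graph_def S(2))
qed

text \<open>Every property is inherited from the contraction semigroup on \<open>l2\<close>, applied to the
  three components of \<open>sobolev_graph\<close>.\<close>
lemma C0_semigroup_stable_flow:
  assumes \<epsilon>: "\<epsilon> > 0"
  shows "C0_semigroup_on cscale2 (stable_subspace \<epsilon>) norm_H1L2 (stable_flow \<epsilon>)"
proof -
  interpret vector_space cscale2
    by (rule vector_space_cscale2)
  note flow = stable_flow_on_stable_subspace[OF \<epsilon>]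
  have lin: "linear (half_diffusion \<epsilon> t)" if "t \<ge> 0" for t
    using bounded_linear_half_diffusion[OF \<epsilon> that] by (rule bounded_linear.linear)
  have "norm_H1L2 (stable_flow \<epsilon> t p) \<le> 1 * norm_H1L2 p" if "t \<ge> 0" "p \<in> stable_subspace \<epsilon>" for t p
    unfolding norm_H1L2_eq flow(3)[OF that] sobolev_graph_def[of p] norm_Pair mult_1
    using half_diffusion_norm_le[OF \<epsilon> that(1)]
    by (intro real_sqrt_le_mono add_mono power_mono) auto
  then have bounded: "\<exists>C. \<forall>p\<in>stable_subspace \<epsilon>. norm_H1L2 (stable_flow \<epsilon> t p) \<le> C * norm_H1L2 p"
    if "t \<ge> 0" for t
    using that by blast
  have cont: "((\<lambda>t. norm_H1L2 (stable_flow \<epsilon> t p - p)) \<longlongrightarrow> 0) (at_right 0)"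
    if p: "p \<in> stable_subspace \<epsilon>" for p
  proof -
    have lim: "((\<lambda>t. norm ((half_diffusion \<epsilon> t (fst p), half_diffusion \<epsilon> t (weak_deriv (fst p)), half_diffusion \<epsilon> t (snd p))
        - sobolev_graph p)) \<longlongrightarrow> norm (sobolev_graph p - sobolev_graph p)) (at_right 0)"
      unfolding sobolev_graph_def[of p]
      by (intro tendsto_norm tendsto_diff tendsto_Pair half_diffusion_tendsto[OF \<epsilon>] tendsto_const)
    have ev: "eventually (\<lambda>t. norm ((half_diffusion \<epsilon> t (fst p), half_diffusion \<epsilon> t (weak_deriv (fst p)),
          half_diffusion \<epsilon> t (snd p)) - sobolev_graph p) = norm_H1L2 (stable_flow \<epsilon> t p - p)) (at_right 0)"
    proof (rule eventually_at_right_less[THEN eventually_mono])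
      fix t :: real assume "0 < t"
      then have t: "t \<ge> 0"
        by simp
      have "p \<in> H1 \<times> UNIV" "stable_flow \<epsilon> t p \<in> H1 \<times> UNIV"
        using p flow(2)[OF t p] by (auto simp: stable_subspace_def)
      then show "norm ((half_diffusion \<epsilon> t (fst p), half_diffusion \<epsilon> t (weak_deriv (fst p)),
          half_diffusion \<epsilon> t (snd p)) - sobolev_graph p) = norm_H1L2 (stable_flow \<epsilon> t p - p)"
        by (simp only: norm_H1L2_eq sobolev_graph_diff flow(3)[OF t p])
    qed
    show ?thesis
      using Lim_transform_eventually[OF lim ev] by simp
  qed
  have add: "stable_flow \<epsilon> t (p + q) = stable_flow \<epsilon> t p + stable_flow \<epsilon> t q"
    if "t \<ge> 0" "p \<in> stable_subspace \<epsilon>" "q \<in> stable_subspace \<epsilon>" for t p q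
    using that by (simp add: flow(1) subspace_add[OF subspace_stable_subspace] linear_add[OF lin])
  have scl: "stable_flow \<epsilon> t (cscale2 c p) = cscale2 c (stable_flow \<epsilon> t p)"
    if "t \<ge> 0" "p \<in> stable_subspace \<epsilon>" for t c p
    unfolding flow(1)[OF that] flow(1)[OF that(1) subspace_scale[OF subspace_stable_subspace that(2)]]
    by (simp add: cscale2_def half_diffusion_cscale[OF \<epsilon> that(1)])
  have zero: "stable_flow \<epsilon> 0 p = p" if "p \<in> stable_subspace \<epsilon>" for p
    using that by (simp add: flow(1) half_diffusion_zero)
  have semigroup: "stable_flow \<epsilon> (s + t) p = stable_flow \<epsilon> s (stable_flow \<epsilon> t p)"
    if "s \<ge> 0" "t \<ge> 0" "p \<in> stable_subspace \<epsilon>" for s t p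
    using that flow(1)[OF that(1) flow(2)[OF that(2,3)]]
    by (simp add: flow(1) half_diffusion_semigroup[OF \<epsilon>])
  show ?thesis
    unfolding C0_semigroup_on_def
    by (intro conjI allI impI ballI flow(2) add scl bounded zero semigroup cont)
qed

theorem theorem3p2:
  fixes \<epsilon> :: real
  assumes "\<epsilon> > 0"
  shows "(\<forall>(T::real) (u :: real \<Rightarrow> l2) (u' :: real \<Rightarrow> l2).
            T > 0 \<longrightarrow>
            continuous_curve H2 norm_H2 {0..T} u \<longrightarrow>
            C1_curve H1 norm_H1 {0..T} u u' \<longrightarrow>
            (\<forall>t\<in>{0..T}. (u' has_vector_derivative - (\<epsilon>\<^sup>2 *\<^sub>R laplacian (u t))) (at t within {0..T})) \<longrightarrow>
            u' 0 = - (\<epsilon> *\<^sub>R half_laplacian (u 0)) \<longrightarrow>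
            (\<forall>t\<in>{0..T}. (u has_vector_derivative - (\<epsilon> *\<^sub>R half_laplacian (u t))) (at t within {0..T})))
       \<and> module.subspace cscale2 (stable_subspace \<epsilon>)
       \<and> closedin H1L2_topology (stable_subspace \<epsilon>)
       \<and> C0_semigroup_on cscale2 (stable_subspace \<epsilon>) norm_H1L2 (stable_flow \<epsilon>)"
  using constrained_wave_solves_half_diffusion[OF assms] subspace_stable_subspace
    closedin_stable_subspace[OF assms] C0_semigroup_stable_flow[OF assms]
  by blast

end
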